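(* Let $W\subset\mathbb{R}$ be a bounded interval (open, closed or half-open) of length $s>0$ with $s\in\mathbb{Z}[\tau]$, where $\tau=(1+\sqrt5)/2$, and let $\Lambda=\{x\in\mathbb{Z}[\tau] : x^{\star}\in W\}$, where $x\mapsto x^\star$ is the algebraic conjugation of $\mathbb{Q}(\sqrt5)$. Let $\widehat{\gamma}$ be the diffraction measure of $\delta_{\Lambda}=\sum_{x\in\Lambda}\delta_x$ and set $Z(k)=\widehat{\gamma}\bigl((0,k]\bigr)$ for $k>0$. Then \[ Z(k)\asymp k^4\qquad\text{as } k\searrow 0 , \] that is, there are constants $c_1,c_2>0$ and $k_0>0$ such that $c_1k^4\leqslant Z(k)\leqslant c_2k^4$ for all $0<k\leqslant k_0$. In particular, $Z(k)=\mathcal{O}(k^4)$ as $k\searrow0$.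
   Context: $\tau=(1+\sqrt5)/2$ is the golden ratio and $\mathbb{Z}[\tau]=\{m+n\tau: m,n\in\mathbb{Z}\}$. The $\star$-map is the field automorphism of $\mathbb{Q}(\sqrt5)$ determined by $\sqrt5\mapsto-\sqrt5$. The set $\Lambda$ is the model set with window $W$ in the cut and project scheme $(\mathbb{R},\mathbb{R},\mathcal{L})$ with lattice $\mathcal{L}=\{(x,x^\star):x\in\mathbb{Z}[\tau]\}\subset\mathbb{R}^2$. The autocorrelation of $\delta_\Lambda$ is the vague limit $\gamma=\lim_{R\to\infty}\frac{1}{2R}\sum_{x,y\in\Lambda\cap[-R,R]}\delta_{x-y}$ (which exists here). The diffraction measure $\widehat{\gamma}$ is the Fourier transform of $\gamma$ (a positive measure on $\mathbb{R}$), with the convention $\widehat{g}(k)=\int_{\mathbb{R}} e^{-2\pi i kx}g(x)\,dx$ for functions. *)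

theory Defs
  imports "HOL-Analysis.Analysis" "HOL-Computational_Algebra.Primes" "HOL-Library.Landau_Symbols"
begin

subsection \<open>The golden ratio, its ring of integers and the star map\<close>

definition golden :: real where
  "golden = (1 + sqrt 5) / 2"

definition Z_tau :: "real set" where
  "Z_tau = {of_int m + of_int n * golden | m n :: int. True}"

text \<open>
  The star map is the automorphism of the field \<open>\<rat>(\<surd>5)\<close> with \<open>\<surd>5 \<mapsto> -\<surd>5\<close>. It is only
  specified on \<open>\<rat>(\<surd>5)\<close>, regarded as a subset of the reals.
\<close>

definition Q_sqrt5 :: "real set" where
  "Q_sqrt5 = {of_rat a + of_rat b * sqrt 5 | a b :: rat. True}"

definition star :: "real \<Rightarrow> real" where
  "star x = (THE y. \<exists>a b :: rat. x = of_rat a + of_rat b * sqrt 5 \<and> y = of_rat a - of_rat b * sqrt 5)"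

definition model_set :: "real set \<Rightarrow> real set" where
  "model_set W = {x \<in> Z_tau. star x \<in> W}"

lemma sqrt5_not_of_rat: "of_rat q \<noteq> sqrt 5"
proof
  assume "of_rat q = sqrt 5"
  then have "sqrt 5 \<in> \<rat>" by (metis Rats_of_rat)
  then obtain m n :: nat where n: "n \<noteq> 0" and mn: "\<bar>sqrt 5\<bar> = m / n" and cop: "coprime m n"
    by (rule Rats_abs_nat_div_natE)
  have "real m = sqrt 5 * n" using n mn by (simp add: field_simps)
  then have "real (m\<^sup>2) = real (5 * n\<^sup>2)" by (simp add: power_mult_distrib)
  then have eq: "m\<^sup>2 = 5 * n\<^sup>2" by (simp only: of_nat_eq_iff)
  have p: "prime (5::nat)" by simp
  from eq p have "5 dvd m" by (metis dvd_triv_left prime_dvd_power)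
  then obtain k where "m = 5 * k" ..
  with eq have "n\<^sup>2 = 5 * k\<^sup>2" by (simp add: power2_eq_square)
  with p have "5 dvd n" by (metis dvd_triv_left prime_dvd_power)
  with \<open>5 dvd m\<close> cop have "is_unit (5::nat)" by (metis coprime_def)
  then show False by simp
qed

lemma Q_sqrt5_coords_unique:
  fixes a b c d :: rat
  assumes "of_rat a + of_rat b * sqrt 5 = of_rat c + of_rat d * sqrt 5"
  shows "a = c \<and> b = d"
proof (cases "b = d")
  case True
  with assms show ?thesis by simp
next
  case False
  have "of_rat (b - d) * sqrt 5 = of_rat (c - a)"
    using assms by (simp add: of_rat_diff algebra_simps)
  then have "sqrt 5 = of_rat ((c - a) / (b - d))"
    using False by (simp add: of_rat_divide field_simps)
  then show ?thesis using sqrt5_not_of_rat by metis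
qed

lemma star_eq:
  fixes a b :: rat
  shows "star (of_rat a + of_rat b * sqrt 5) = of_rat a - of_rat b * sqrt 5"
  unfolding star_def by (rule the_equality) (use Q_sqrt5_coords_unique in blast)+

lemma star_sqrt5: "star (sqrt 5) = - sqrt 5"
  using star_eq[of 0 1] by simp

lemma star_1: "star 1 = 1"
  using star_eq[of 1 0] by simp

lemma star_add:
  assumes "x \<in> Q_sqrt5" "y \<in> Q_sqrt5"
  shows "star (x + y) = star x + star y"
proof -
  obtain a b c d :: rat where *: "x = of_rat a + of_rat b * sqrt 5" "y = of_rat c + of_rat d * sqrt 5"
    using assms unfolding Q_sqrt5_def by blast
  have "x + y = of_rat (a + c) + of_rat (b + d) * sqrt 5"
    by (simp add: * of_rat_add algebra_simps)
  then show ?thesis by (simp only: * star_eq) (simp add: of_rat_add algebra_simps)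
qed

lemma star_mult:
  assumes "x \<in> Q_sqrt5" "y \<in> Q_sqrt5"
  shows "star (x * y) = star x * star y"
proof -
  obtain a b c d :: rat where *: "x = of_rat a + of_rat b * sqrt 5" "y = of_rat c + of_rat d * sqrt 5"
    using assms unfolding Q_sqrt5_def by blast
  have "x * y = of_rat (a * c + 5 * b * d) + of_rat (a * d + b * c) * sqrt 5"
    by (simp add: * of_rat_add of_rat_mult algebra_simps)
  then show ?thesis
    by (simp only: * star_eq) (simp add: of_rat_add of_rat_mult algebra_simps)
qed

lemma Z_tau_subset: "Z_tau \<subseteq> Q_sqrt5"
proof
  fix x assume "x \<in> Z_tau"
  then obtain m n :: int where x: "x = of_int m + of_int n * golden"
    unfolding Z_tau_def by blast
  have "x = of_rat (of_int m + of_int n / 2) + of_rat (of_int n / 2) * sqrt 5"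
    by (simp add: x golden_def of_rat_add of_rat_divide add_divide_distrib distrib_left)
  then show "x \<in> Q_sqrt5" unfolding Q_sqrt5_def by blast
qed

subsection \<open>Autocorrelation\<close>

definition locally_finite_borel :: "real measure \<Rightarrow> bool" where
  "locally_finite_borel \<mu> \<longleftrightarrow> sets \<mu> = sets borel \<and> (\<forall>K. compact K \<longrightarrow> emeasure \<mu> K < \<infinity>)"

definition cont_compact_support :: "(real \<Rightarrow> complex) \<Rightarrow> bool" where
  "cont_compact_support f \<longleftrightarrow> continuous_on UNIV f \<and> compact (closure {x. f x \<noteq> 0})"

text \<open>
  \<open>\<gamma>\<close> is the vague limit of the measures \<open>1/(2R) \<Sum>\<^bsub>x, y \<in> \<Lambda> \<inter> [-R, R]\<^esub> \<delta>\<^bsub>x - y\<^esub>\<close>,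
  tested against compactly supported continuous functions. The sums are meaningful for
  locally finite \<open>\<Lambda>\<close> only.
\<close>

definition is_autocorrelation :: "real set \<Rightarrow> real measure \<Rightarrow> bool" where
  "is_autocorrelation \<Lambda> \<gamma> \<longleftrightarrow> locally_finite_borel \<gamma> \<and>
     (\<forall>f. cont_compact_support f \<longrightarrow>
       ((\<lambda>R::real. (\<Sum>x\<in>\<Lambda> \<inter> {-R..R}. \<Sum>y\<in>\<Lambda> \<inter> {-R..R}. f (x - y)) / of_real (2 * R))
          \<longlongrightarrow> (LINT x|\<gamma>. f x)) at_top)"

definition autocorrelation :: "real set \<Rightarrow> real measure" where
  "autocorrelation \<Lambda> = (THE \<gamma>. is_autocorrelation \<Lambda> \<gamma>)"

subsection \<open>Fourier transforms and diffraction\<close>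

definition fourier :: "(real \<Rightarrow> complex) \<Rightarrow> real \<Rightarrow> complex" where
  "fourier g k = (LINT x|lborel. exp (- 2 * of_real pi * \<i> * of_real k * of_real x) * g x)"

text \<open>Here \<open>D n\<close> is the \<open>n\<close>-th derivative of \<open>g\<close>.\<close>

definition schwartz :: "(real \<Rightarrow> complex) \<Rightarrow> bool" where
  "schwartz g \<longleftrightarrow> (\<exists>D :: nat \<Rightarrow> real \<Rightarrow> complex. D 0 = g \<and>
     (\<forall>n x. (D n has_vector_derivative D (Suc n) x) (at x)) \<and>
     (\<forall>m n. bounded (range (\<lambda>x. x ^ m *\<^sub>R D n x))))"

text \<open>
  Fourier transform in the sense of tempered distributions: \<open>\<mu>\<close> pairs with \<open>g\<close> as \<open>\<gamma>\<close> pairs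
  with the Fourier transform of \<open>g\<close>. The integrability conditions express that both measures
  are tempered; without them the pairings would take the default value 0.
\<close>

definition is_fourier_measure :: "real measure \<Rightarrow> real measure \<Rightarrow> bool" where
  "is_fourier_measure \<gamma> \<mu> \<longleftrightarrow> locally_finite_borel \<mu> \<and>
     (\<forall>g. schwartz g \<longrightarrow> integrable \<mu> g \<and> integrable \<gamma> (fourier g) \<and>
        (LINT k|\<mu>. g k) = (LINT x|\<gamma>. fourier g x))"

definition fourier_measure :: "real measure \<Rightarrow> real measure" where
  "fourier_measure \<gamma> = (THE \<mu>. is_fourier_measure \<gamma> \<mu>)"

definition diffraction :: "real set \<Rightarrow> real measure" where
  "diffraction \<Lambda> = fourier_measure (autocorrelation \<Lambda>)"

definition integrated_intensity :: "real set \<Rightarrow> real \<Rightarrow> real" where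
  "integrated_intensity \<Lambda> k = measure (diffraction \<Lambda>) {0<..k}"

end

theory Submission
  imports Defs "HOL-Probability.Probability"
begin

text \<open>
  The lattice points are indexed by \<open>z \<in> \<int>\<^sup>2\<close>, with the two embeddings \<open>emb z\<close> and \<open>emb_star z\<close>.
  By equidistribution the autocorrelation has an atom at each \<open>x = emb z\<close>, of weight
  \<open>max 0 (s - \<bar>x\<^sup>*\<bar>) / sqrt 5\<close>. Poisson summation over \<open>\<int>\<^sup>2\<close>, first for a Fejer kernel in the physical
  variable and then for Schwartz functions by approximation, shows that the diffraction is the pure
  point measure with weights \<open>(sin (\<pi> s y\<^sup>* / sqrt 5) / (\<pi> y\<^sup>*))\<^sup>2\<close> at \<open>y / sqrt 5\<close>, \<open>y \<in> \<int>[\<tau>]\<close>.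

  Since \<open>s\<close> lies in \<open>\<int>[\<tau>]\<close>, the number \<open>s y\<^sup>* - s\<^sup>* y\<close> is an integer multiple of \<open>sqrt 5\<close>, and the weight
  equals \<open>(sin (\<pi> s\<^sup>* y / sqrt 5) / (\<pi> y\<^sup>*))\<^sup>2\<close>, of order at most \<open>(y / y\<^sup>*)\<^sup>2\<close>. Multiplying \<open>y\<close> by \<open>\<tau>\<close> multiplies
  \<open>(y / y\<^sup>*)\<^sup>2\<close> by \<open>\<tau>\<^sup>4\<close>; hence the total weight in \<open>(0, k]\<close> is at most of order \<open>k\<^sup>4\<close>, and a single power
  of \<open>\<tau>\<close> close to \<open>k\<close> already contributes that much.
\<close>


text \<open>\<open>autocorrelation\<close> and \<open>fourier_measure\<close> are defined by
  \<open>THE\<close>, so each calls for existence and uniqueness. Vague limits are compared on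
  trapezoids. Fourier transforms are compared on Gaussians times waves: a Gaussian weight turns the
  measures into probability measures with equal characteristic functions.

  The Fejer cut-off is dictated by convergence. Multiplying by \<open>triangle L\<close> makes the
  lattice sum finite, and the transforms of both triangles decay quadratically, so the dual sum
  converges absolutely by comparison with \<open>lattice_decay\<close>. Averaging against
  \<open>g\<close> turns the kernel into an approximate identity, and \<open>L\<close> can tend to
  infinity because the bounds are uniform in \<open>L\<close>.

  The scaling argument needs a finite starting value. It comes from the field norm: a nonzero point
  has \<open>\<bar>emb y\<bar> * \<bar>emb_star y\<bar> \<ge> 1\<close>, so
  \<open>emb_star y\<close> is bounded away from 0 wherever \<open>emb y\<close> is at most
  1.\<close>

section \<open>The two embeddings of the lattice and the field norm\<close>

definition emb :: "int \<times> int \<Rightarrow> real" where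
  "emb z = of_int (fst z) + of_int (snd z) * golden"

definition emb_star :: "int \<times> int \<Rightarrow> real" where
  "emb_star z = of_int (fst z) + of_int (snd z) * (1 - golden)"

lemma golden_sq: "golden * golden = golden + 1"
  by (simp add: golden_def field_simps)

lemma golden_gt_1: "golden > 1"
proof -
  have "sqrt 5 > 1" by simp
  then show ?thesis by (simp add: golden_def)
qed

lemma emb_diff_star: "emb z - emb_star z = of_int (snd z) * sqrt 5"
  by (simp add: emb_def emb_star_def golden_def field_simps)

lemma star_emb: "star (emb z) = emb_star z"
proof -
  define p where "p = (of_int (fst z) + of_int (snd z) / 2 :: rat)"
  define q where "q = (of_int (snd z) / 2 :: rat)"
  have "emb z = of_rat p + of_rat q * sqrt 5"
    by (simp add: p_def q_def emb_def golden_def of_rat_add of_rat_divide)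
       (simp add: field_simps)
  moreover have "emb_star z = of_rat p - of_rat q * sqrt 5"
    by (simp add: p_def q_def emb_star_def golden_def of_rat_add of_rat_divide)
       (simp add: field_simps)
  ultimately show ?thesis using star_eq by simp
qed

lemma Z_tau_eq_range_emb: "Z_tau = range emb"
proof -
  have "of_int m + of_int n * golden = emb (m, n)" for m n by (simp add: emb_def)
  moreover have "emb z = of_int (fst z) + of_int (snd z) * golden" for z by (simp add: emb_def)
  ultimately show ?thesis unfolding Z_tau_def by blast
qed

lemma emb_add: "emb (x + y) = emb x + emb y"
  and emb_star_add: "emb_star (x + y) = emb_star x + emb_star y"
  and emb_diff: "emb (x - y) = emb x - emb y"
  and emb_star_diff: "emb_star (x - y) = emb_star x - emb_star y"
  by (simp_all add: emb_def emb_star_def algebra_simps)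

lemma emb_zero [simp]: "emb 0 = 0" "emb_star 0 = 0"
  by (simp_all add: emb_def emb_star_def)

lemma emb_times_star: "emb z * emb_star z = of_int (fst z ^ 2 + fst z * snd z - snd z ^ 2)"
proof -
  have "emb z * emb_star z = of_int (fst z)^2 + of_int (fst z) * of_int (snd z)
      + of_int (snd z)^2 * (golden - golden * golden)"
    by (simp add: emb_def emb_star_def algebra_simps power2_eq_square)
  then show ?thesis by (simp add: golden_sq)
qed

text \<open>Both embeddings are \<open>p + q sqrt 5\<close> with rational \<open>p\<close> and
  \<open>q\<close>, up to the sign of \<open>sqrt 5\<close>. The variable \<open>c\<close> is this
  sign, so one appeal to the irrationality of \<open>sqrt 5\<close> serves both.\<close>

lemma emb_eq_0_iff: "emb z = 0 \<longleftrightarrow> z = 0"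
  and emb_star_eq_0_iff: "emb_star z = 0 \<longleftrightarrow> z = 0"
proof -
  have *: "z = 0" if "of_int (fst z) + of_int (snd z) / 2 + of_int (snd z) / 2 * c * sqrt 5 = (0::real)"
    "c = 1 \<or> c = -1" for c
  proof -
    have "of_rat (of_int (fst z) + of_int (snd z) / 2) + of_rat (of_int (snd z) / 2) * (c * sqrt 5)
        = (0::real)"
      using that by (simp add: of_rat_add of_rat_divide algebra_simps)
    then have "of_int (fst z) + of_int (snd z) / 2 = (0::rat) \<and> of_int (snd z) / 2 = (0::rat)"
      using that(2) Q_sqrt5_coords_unique[of "of_int (fst z) + of_int (snd z) / 2" "of_int (snd z) / 2" 0 0]
        Q_sqrt5_coords_unique[of "of_int (fst z) + of_int (snd z) / 2" "- (of_int (snd z) / 2)" 0 0]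
      by (auto simp: of_rat_minus)
    then show ?thesis by (auto simp: zero_prod_def prod_eq_iff)
  qed
  show "emb z = 0 \<longleftrightarrow> z = 0"
    using *[of 1] by (auto simp: emb_def golden_def field_simps)
  show "emb_star z = 0 \<longleftrightarrow> z = 0"
    using *[of "-1"] by (auto simp: emb_star_def golden_def field_simps)
qed

lemma inj_emb: "inj emb"
  by (rule injI) (metis emb_diff emb_eq_0_iff eq_iff_diff_eq_0)

text \<open>The product is the absolute value of the field norm, a nonzero integer.\<close>

lemma one_le_norm_emb:
  assumes "z \<noteq> 0"
  shows "1 \<le> \<bar>emb z\<bar> * \<bar>emb_star z\<bar>"
proof -
  define k where "k = fst z ^ 2 + fst z * snd z - snd z ^ 2"
  have "of_int k \<noteq> (0::real)"
    using assms emb_eq_0_iff emb_star_eq_0_iff emb_times_star[of z] by (metis k_def mult_eq_0_iff)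
  then have "1 \<le> \<bar>k\<bar>" by auto
  then have "1 \<le> \<bar>of_int k :: real\<bar>" by linarith
  then show ?thesis by (simp add: k_def emb_times_star flip: abs_mult)
qed

subsection \<open>Summation over the lattice\<close>

abbreviation (input) counting :: "'i measure" where
  "counting \<equiv> count_space UNIV"

text \<open>The common majorant for the infinite sums over the lattice: quadratic decay in each of
  the two embeddings.\<close>

definition lattice_decay :: "int \<times> int \<Rightarrow> real" where
  "lattice_decay z = 1 / ((1 + emb z ^ 2) * (1 + emb_star z ^ 2))"

lemma nn_integral_inverse_square_int_finite:
  "(\<integral>\<^sup>+n. ennreal (1 / (1 + real_of_int n ^ 2)) \<partial>counting) < \<infinity>"
proof -
  let ?e = "\<lambda>n. ennreal (1 / (1 + real_of_int n ^ 2))" and ?e' = "\<lambda>n. ennreal (1 / (1 + real n ^ 2))"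
  have fin: "(\<integral>\<^sup>+n. ?e' n \<partial>counting) < \<infinity>"
  proof -
    have "summable (\<lambda>n. 1 / (1 + real n ^ 2))"
    proof (rule summable_comparison_test'[where N = 1])
      show "summable (\<lambda>n. 1 / real n ^ 2)" using inverse_power_summable[of 2] by (simp add: field_simps)
    next
      fix n :: nat assume "1 \<le> n"
      then show "norm (1 / (1 + real n ^ 2)) \<le> 1 / real n ^ 2"
        by (simp add: frac_le)
    qed
    then have "integrable counting (\<lambda>n. 1 / (1 + real n ^ 2))"
      by (simp add: integrable_count_space_nat_iff)
    then show ?thesis by (simp add: integrable_iff_bounded)
  qed
  have "(\<integral>\<^sup>+n. ?e n \<partial>counting)
     \<le> (\<integral>\<^sup>+n. ?e n * indicator (range int) n
         + ?e n * indicator (range (\<lambda>k. - int k)) n \<partial>counting)"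
  proof (rule nn_integral_mono)
    fix n :: int
    have "n \<in> range int \<or> n \<in> range (\<lambda>k. - int k)"
      by (metis int_cases2 rangeI)
    then show "?e n \<le> ?e n * indicator (range int) n
         + ?e n * indicator (range (\<lambda>k. - int k)) n"
      by (auto simp: indicator_def)
  qed
  also have "\<dots> = (\<integral>\<^sup>+n. ?e n \<partial>count_space (range int))
      + (\<integral>\<^sup>+n. ?e n \<partial>count_space (range (\<lambda>k. - int k)))"
    by (simp add: nn_integral_add nn_integral_count_space_indicator)
  also have "(\<integral>\<^sup>+n. ?e n \<partial>count_space (range int))
      = (\<integral>\<^sup>+n. ?e' n \<partial>counting)"
    using nn_integral_bij_count_space[of int UNIV "range int" "\<lambda>n. ?e n"]
    by (simp add: bij_betw_def)
  also have "(\<integral>\<^sup>+n. ?e n \<partial>count_space (range (\<lambda>k. - int k)))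
      = (\<integral>\<^sup>+n. ?e' n \<partial>counting)"
    using nn_integral_bij_count_space[of "\<lambda>k. - int k" UNIV "range (\<lambda>k. - int k)" "\<lambda>n. ?e n"]
    by (simp add: bij_betw_def inj_on_def)
  also have "(\<integral>\<^sup>+n. ?e' n \<partial>counting)
      + (\<integral>\<^sup>+n. ?e' n \<partial>counting) < \<infinity>" using fin by simp
  finally show ?thesis .
qed

lemma inverse_square_shift_le:
  fixes x y :: real
  assumes "\<bar>x - y\<bar> \<le> 1"
  shows "1 / (1 + x ^ 2) \<le> 3 * (1 / (1 + y ^ 2))"
proof -
  \<comment> \<open>The first inequality plus three times the second gives
    \<open>2 * y ^ 2 \<le> 6 * x ^ 2 + 3\<close>, hence the constant 3.\<close>
  have "(y - 3 * x) ^ 2 \<ge> 0" "(x - y)^2 \<le> 1" using assms by (auto simp: abs_square_le_1)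
  then have "1 + y ^ 2 \<le> 3 * (1 + x ^ 2)" by (simp add: power2_eq_square algebra_simps)
  moreover have "1 + x^2 > 0" "1 + y^2 > 0" by (auto simp: add_pos_nonneg)
  ultimately show ?thesis by (simp add: divide_simps)
qed

lemma nn_integral_inverse_square_shift_le:
  "(\<integral>\<^sup>+n. ennreal (1 / (1 + (real_of_int n + \<alpha>) ^ 2)) \<partial>counting)
    \<le> 3 * (\<integral>\<^sup>+n. ennreal (1 / (1 + real_of_int n ^ 2)) \<partial>counting)"
proof -
  let ?e = "\<lambda>n. ennreal (1 / (1 + real_of_int (n + \<lfloor>\<alpha>\<rfloor>) ^ 2))" and ?a = "\<lambda>n. ennreal (1 / (1 + (real_of_int n + \<alpha>) ^ 2))"
  have "(\<integral>\<^sup>+n. ?a n \<partial>counting)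
     \<le> (\<integral>\<^sup>+n. 3 * ?e n \<partial>counting)"
  proof (rule nn_integral_mono)
    fix n
    have "\<bar>(real_of_int n + \<alpha>) - real_of_int (n + \<lfloor>\<alpha>\<rfloor>)\<bar> \<le> 1" by simp linarith
    from inverse_square_shift_le[OF this]
    have "?a n \<le> ennreal (3 * (1 / (1 + real_of_int (n + \<lfloor>\<alpha>\<rfloor>) ^ 2)))"
      by (rule ennreal_leI)
    also have "\<dots> = 3 * ?e n"
      by (subst ennreal_mult) auto
    finally show "?a n \<le> 3 * ?e n" .
  qed
  also have "\<dots> = 3 * (\<integral>\<^sup>+n. ?e n \<partial>counting)"
    by (rule nn_integral_cmult) simp
  also have "(\<integral>\<^sup>+n. ?e n \<partial>counting)
      = (\<integral>\<^sup>+n. ennreal (1 / (1 + real_of_int n ^ 2)) \<partial>counting)"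
    by (rule nn_integral_bij_count_space[where g = "\<lambda>n. n + \<lfloor>\<alpha>\<rfloor>"])
       (rule bij_betw_byWitness[where f' = "\<lambda>n. n - \<lfloor>\<alpha>\<rfloor>"]; simp)
  finally show ?thesis .
qed

text \<open>For the two embeddings of one point, \<open>a - b\<close> is \<open>sqrt 5\<close> times
  the second coordinate. The product of two decaying factors is thus traded for decay in that
  coordinate times a sum over the other one.\<close>

lemma product_decay_le:
  fixes a b :: real
  shows "1 / ((1 + a ^ 2) * (1 + b ^ 2)) \<le> 2 / (1 + (a - b) ^ 2) * (1 / (1 + a ^ 2) + 1 / (1 + b ^ 2))"
proof -
  have "(a + b)^2 \<ge> 0" by simp
  then have "1 + (a - b)^2 \<le> 2 * ((1 + a^2) + (1 + b^2))"
    by (simp add: power2_eq_square algebra_simps)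
  moreover have "1 + (a - b)^2 > 0" "1 + a^2 > 0" "1 + b^2 > 0" by (auto simp: add_pos_nonneg)
  ultimately show ?thesis by (simp add: divide_simps)
qed

text \<open>Row by row: for fixed \<open>n\<close> the sums over \<open>m\<close> run over shifted
  integers and are at most \<open>3 * S\<close> whatever the shift, while
  \<open>product_decay_le\<close> supplies the summable factor in \<open>n\<close>.\<close>

lemma integrable_lattice_decay: "integrable counting lattice_decay"
proof -
  let ?x = "\<lambda>m n. real_of_int m + real_of_int n * golden" and ?y = "\<lambda>m n. real_of_int m + real_of_int n * (1 - golden)"
    and ?n = "\<lambda>n. 1 + real_of_int n ^ 2"
  define S where "S = (\<integral>\<^sup>+n. ennreal (1 / ?n n) \<partial>counting)"
  have S: "S < \<infinity>" unfolding S_def by (rule nn_integral_inverse_square_int_finite)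
  have nonneg: "lattice_decay z \<ge> 0" for z by (simp add: lattice_decay_def)
  have "(\<integral>\<^sup>+z. ennreal (lattice_decay z) \<partial>counting)
      = (\<integral>\<^sup>+n. (\<integral>\<^sup>+m. ennreal (lattice_decay (m, n)) \<partial>counting) \<partial>counting)"
    by (rule nn_integral_snd_count_space[symmetric])
  also have "\<dots> \<le> (\<integral>\<^sup>+n. ennreal (1 / ?n n) * (2 * (3 * S + 3 * S)) \<partial>counting)"
  proof (rule nn_integral_mono)
    fix n :: int
    have "(\<integral>\<^sup>+m. ennreal (lattice_decay (m, n)) \<partial>counting)
       \<le> (\<integral>\<^sup>+m. ennreal (2 / ?n n) *
            (ennreal (1 / (1 + ?x m n^2))
            + ennreal (1 / (1 + ?y m n^2))) \<partial>counting)"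
    proof (rule nn_integral_mono)
      fix m :: int
      have "(emb (m, n) - emb_star (m, n))^2 = 5 * real_of_int n ^ 2"
        by (simp add: emb_diff_star power_mult_distrib)
      then have "lattice_decay (m, n) \<le> 2 / (1 + 5 * real_of_int n ^ 2) *
         (1 / (1 + emb (m, n) ^ 2) + 1 / (1 + emb_star (m, n) ^ 2))"
        using product_decay_le[of "emb (m, n)" "emb_star (m, n)"] by (simp add: lattice_decay_def)
      also have "\<dots> \<le> 2 / ?n n *
         (1 / (1 + emb (m, n) ^ 2) + 1 / (1 + emb_star (m, n) ^ 2))"
        by (intro mult_right_mono divide_left_mono) (auto intro!: add_pos_nonneg mult_pos_pos)
      finally have "ennreal (lattice_decay (m, n)) \<le> ennreal (2 / ?n n *
         (1 / (1 + emb (m, n) ^ 2) + 1 / (1 + emb_star (m, n) ^ 2)))" by (rule ennreal_leI)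
      then show "ennreal (lattice_decay (m, n)) \<le> ennreal (2 / ?n n) *
            (ennreal (1 / (1 + ?x m n^2))
            + ennreal (1 / (1 + ?y m n^2)))"
        by (subst (asm) ennreal_mult) (simp_all add: emb_def emb_star_def)
    qed
    also have "\<dots> = ennreal (2 / ?n n) *
         ((\<integral>\<^sup>+m. ennreal (1 / (1 + ?x m n^2)) \<partial>counting)
         + (\<integral>\<^sup>+m. ennreal (1 / (1 + ?y m n^2)) \<partial>counting))"
      by (simp add: nn_integral_cmult nn_integral_add)
    also have "\<dots> \<le> ennreal (2 / ?n n) * (3 * S + 3 * S)"
      unfolding S_def by (intro mult_left_mono add_mono nn_integral_inverse_square_shift_le) auto
    also have "ennreal (2 / ?n n) = ennreal (1 / ?n n) * 2"
      by (simp add: ennreal_mult'[symmetric, of _ 2, simplified] flip: ennreal_numeral ennreal_mult'')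
    finally show "(\<integral>\<^sup>+m. ennreal (lattice_decay (m, n)) \<partial>counting)
       \<le> ennreal (1 / ?n n) * (2 * (3 * S + 3 * S))" by (simp add: mult.assoc)
  qed
  also have "\<dots> = S * (2 * (3 * S + 3 * S))"
    unfolding S_def by (rule nn_integral_multc) simp
  also have "\<dots> < \<infinity>" using S by (simp add: ennreal_mult_less_top)
  finally show ?thesis by (simp add: integrable_iff_bounded nonneg)
qed

lemma integrable_count_space_bound:
  fixes f :: "'i \<Rightarrow> 'b::{banach, second_countable_topology}"
  assumes "integrable counting g" "\<And>z. norm (f z) \<le> C * g z"
  shows "integrable counting f"
proof (rule Bochner_Integration.integrable_bound)
  show "integrable counting (\<lambda>z. C * g z)" using assms(1) by simp
qed (use assms(2) abs_ge_self order_trans in \<open>auto intro: order_trans[OF _ abs_ge_self]\<close>)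

subsection \<open>Weighted sums of point masses\<close>

text \<open>Written as a push-forward of a density over counting measure, so that integrals against
  the atoms become lattice sums by the rules for \<open>distr\<close> and
  \<open>density\<close>.\<close>

definition weighted_atoms :: "('i \<Rightarrow> real) \<Rightarrow> ('i \<Rightarrow> real) \<Rightarrow> real measure" where
  "weighted_atoms x w = distr (density counting (\<lambda>z. ennreal (w z))) borel x"

lemma sets_weighted_atoms [simp, measurable_cong]: "sets (weighted_atoms x w) = sets borel"
  and space_weighted_atoms [simp]: "space (weighted_atoms x w) = UNIV"
  by (simp_all add: weighted_atoms_def)

lemma emeasure_weighted_atoms:
  assumes "A \<in> sets borel"
  shows "emeasure (weighted_atoms x w) A = (\<integral>\<^sup>+z. ennreal (w z) * indicator A (x z) \<partial>counting)"
  using assms by (simp add: weighted_atoms_def emeasure_distr emeasure_density indicator_def vimage_def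
      of_bool_def cong: if_cong)

lemma
  fixes f :: "real \<Rightarrow> complex"
  assumes "f \<in> borel_measurable borel" "\<And>z. w z \<ge> 0"
  shows integrable_weighted_atoms_iff:
      "integrable (weighted_atoms x w) f \<longleftrightarrow> integrable counting (\<lambda>z. w z *\<^sub>R f (x z))"
    and integral_weighted_atoms:
      "(LINT t|weighted_atoms x w. f t) = (LINT z|counting. w z *\<^sub>R f (x z))"
  using assms
  by (simp_all add: weighted_atoms_def integrable_distr_eq integral_distr integrable_density integral_density)

text \<open>
  The bound on the weights says that the atoms form a weighted model set, whose window function
  decays quadratically.
\<close>

lemma locally_finite_weighted_atoms:
  assumes c: "c > 0" and w: "\<And>z. 0 \<le> w z" "\<And>z. w z \<le> C / (1 + emb_star z ^ 2)"
  shows "locally_finite_borel (weighted_atoms (\<lambda>z. emb z / c) w)"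
  unfolding locally_finite_borel_def
proof (intro conjI allI impI)
  fix K :: "real set" assume "compact K"
  then obtain B where B: "\<And>x. x \<in> K \<Longrightarrow> norm x \<le> B" using compact_imp_bounded bounded_iff by metis
  have K: "K \<in> sets borel" using \<open>compact K\<close> by (simp add: compact_imp_closed)
  have C: "C \<ge> 0" using w[of 0] by (simp)
  have "emeasure (weighted_atoms (\<lambda>z. emb z / c) w) K
     \<le> (\<integral>\<^sup>+z. ennreal (C * (1 + (B * c)^2) * lattice_decay z) \<partial>counting)"
    unfolding emeasure_weighted_atoms[OF K]
  proof (rule nn_integral_mono)
    fix z
    show "ennreal (w z) * indicator K (emb z / c) \<le> ennreal (C * (1 + (B * c)^2) * lattice_decay z)"
    proof (cases "emb z / c \<in> K")
      case True
      then have "\<bar>emb z\<bar> \<le> B * c" using B[OF True] c by (simp add: field_simps)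
      then have "emb z ^ 2 \<le> (B * c)^2" by (metis abs_ge_zero power2_abs power_mono)
      \<comment> \<open>On \<open>K\<close> this quotient is at least 1, so it can be inserted to
        supply the missing decay in \<open>emb z\<close>.\<close>
      then have "1 \<le> (1 + (B * c)^2) / (1 + emb z ^ 2)" by (simp add: divide_simps add_pos_nonneg)
      then have "C / (1 + emb_star z ^ 2) * 1 \<le> C / (1 + emb_star z ^ 2) * ((1 + (B * c)^2) / (1 + emb z ^ 2))"
        using C by (intro mult_left_mono) auto
      then have "w z \<le> C * (1 + (B * c)^2) * lattice_decay z"
        using w(2)[of z] by (simp add: lattice_decay_def mult.commute)
      then show ?thesis using True by (simp add: ennreal_leI)
    qed simp
  qed
  also have "\<dots> < \<infinity>"
    using integrable_lattice_decay[THEN integrable_mult_right, of "C * (1 + (B * c)^2)"]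
    by (subst (asm) integrable_iff_bounded)
       (use C in \<open>auto simp: lattice_decay_def\<close>)
  finally show "emeasure (weighted_atoms (\<lambda>z. emb z / c) w) K < \<infinity>" .
qed simp

subsection \<open>Pointwise convergence of Fourier series\<close>

definition wave :: "real \<Rightarrow> complex" where
  "wave x = cis (2 * pi * x)"

lemma wave_add: "wave (x + y) = wave x * wave y"
  by (simp add: wave_def cis_mult algebra_simps)

lemma norm_wave [simp]: "norm (wave x) = 1"
  by (simp add: wave_def)

lemma wave_of_int [simp]: "wave (of_int n) = 1"
  by (metis wave_def cis_multiple_2pi Ints_of_int)

lemma wave_0 [simp]: "wave 0 = 1"
  by (simp add: wave_def)

lemma cnj_wave: "cnj (wave x) = wave (- x)"
  by (simp add: wave_def cis_cnj)

lemma wave_minus_cancel [simp]: "wave x * wave (- x) = 1" "wave (- x) * wave x = 1"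
  by (simp_all flip: wave_add)

lemma fourier_kernel_eq_wave: "exp (- 2 * of_real pi * \<i> * of_real k * of_real x) = wave (- k * x)"
  by (simp add: wave_def cis_conv_exp algebra_simps)

lemma continuous_on_wave [continuous_intros]: "continuous_on A f \<Longrightarrow> continuous_on A (\<lambda>x. wave (f x))"
  unfolding wave_def cis_conv_exp by (intro continuous_intros)

lemma borel_measurable_wave [measurable]: "wave \<in> borel_measurable borel"
  by (intro borel_measurable_continuous_onI continuous_intros)

lemma wave_has_vector_derivative:
  "((\<lambda>x. wave (c * x)) has_vector_derivative (2 * pi * \<i> * c * wave (c * x))) (at x within S)"
proof -
  have "((\<lambda>x. exp (2 * pi * \<i> * c * of_real x)) has_vector_derivative
      (exp (2 * pi * \<i> * c * of_real x) * (2 * pi * \<i> * c))) (at x within S)"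
    by (rule has_vector_derivative_real_field) (auto intro!: derivative_eq_intros)
  then show ?thesis by (simp add: wave_def cis_conv_exp mult_ac)
qed

lemma norm_wave_diff_le: "norm (wave x - wave y) \<le> 2 * pi * \<bar>x - y\<bar>"
proof -
  have "norm (wave x - wave y) \<le> 2 * pi * norm (x - y)"
  proof (rule differentiable_bound)
    show "convex (UNIV :: real set)" by simp
    fix x :: real
    show "(wave has_derivative (\<lambda>h. h *\<^sub>R (2 * pi * \<i> * wave x))) (at x within UNIV)"
      using wave_has_vector_derivative[of 1 x UNIV] by (simp add: has_vector_derivative_def)
    show "onorm (\<lambda>h. h *\<^sub>R (2 * pi * \<i> * wave x)) \<le> 2 * pi"
      by (rule onorm_le) (simp add: norm_mult)
  qed auto
  then show ?thesis by simp
qed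

text \<open>The double angle formula reduces to half the argument, where the cosine is at least
  \<open>sqrt 2 / 2\<close>. This factor enters twice, once through the mean value theorem for the
  sine and once directly; together they give 1/2.\<close>

lemma half_abs_le_abs_sin:
  fixes x :: real
  assumes "\<bar>x\<bar> \<le> pi / 2"
  shows "\<bar>x\<bar> / 2 \<le> \<bar>sin x\<bar>"
proof -
  have *: "x / 2 \<le> sin x" if x: "0 < x" "x \<le> pi / 2" for x :: real
  proof -
    obtain z where z: "0 < z" "z < x / 2" "sin (x / 2) - sin 0 = (x / 2 - 0) * cos z"
      using MVT2[of 0 "x / 2" sin cos] x DERIV_sin by auto
    have cos_ge: "cos y \<ge> sqrt 2 / 2" if "0 \<le> y" "y \<le> x / 2" for y
    proof -
      have "cos (pi / 4) \<le> cos y" by (rule cos_monotone_0_pi_le) (use that x in auto)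
      then show ?thesis by (simp add: cos_45)
    qed
    have "x / 2 * (sqrt 2 / 2) \<le> x / 2 * cos z"
      using z x by (intro mult_left_mono cos_ge) auto
    then have "x / 2 * (sqrt 2 / 2) \<le> sin (x / 2)" using z(3) by simp
    moreover have "sqrt 2 / 2 \<le> cos (x / 2)" using x by (intro cos_ge) auto
    ultimately have "(x / 2 * (sqrt 2 / 2)) * (sqrt 2 / 2) \<le> sin (x / 2) * cos (x / 2)"
      using x by (intro mult_mono sin_ge_zero) auto
    moreover have "(x / 2 * (sqrt 2 / 2)) * (sqrt 2 / 2) = x / 4" by simp
    ultimately have "x / 4 \<le> sin (x / 2) * cos (x / 2)" by (simp only:)
    then show ?thesis using sin_double[of "x / 2"] by simp
  qed
  from *[of "\<bar>x\<bar>"] assms show ?thesis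
    by (cases x "0::real" rule: linorder_cases) auto
qed

text \<open>The zero of \<open>wave r - 1\<close> at 0 is simple and the only one in the period;
  this keeps the difference quotient of a Lipschitz function by \<open>wave r - 1\<close>
  bounded.\<close>

lemma norm_wave_minus_1_ge:
  assumes "\<bar>r\<bar> \<le> 1 / 2"
  shows "\<bar>r\<bar> \<le> norm (wave r - 1)"
proof -
  have "wave r - 1 = wave (r / 2) * (wave (r / 2) - wave (- (r / 2)))"
    by (simp add: algebra_simps flip: wave_add)
  also have "wave (r / 2) - wave (- (r / 2)) = 2 * \<i> * sin (pi * r)"
    by (simp add: wave_def complex_eq_iff)
  finally have "norm (wave r - 1) = 2 * \<bar>sin (pi * r)\<bar>" by (simp add: norm_mult)
  moreover have "\<bar>pi * r\<bar> / 2 \<le> \<bar>sin (pi * r)\<bar>"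
    using assms by (intro half_abs_le_abs_sin) (auto simp: abs_mult)
  moreover have "\<bar>r\<bar> * 1 \<le> \<bar>r\<bar> * pi" using pi_gt3 by (intro mult_left_mono) auto
  ultimately show ?thesis by (simp add: abs_mult algebra_simps)
qed

text \<open>The period is centred at 0, the point at which Fourier series are evaluated, so that the
  zero of \<open>wave r - 1\<close> lies in its interior.\<close>

definition unit_lborel :: "real measure" where
  "unit_lborel = restrict_space lborel {-1/2..1/2}"

lemma space_unit_lborel: "space unit_lborel = {-1/2..1/2}"
  by (simp add: unit_lborel_def space_restrict_space)

lemma measurable_unit_lborel [measurable (raw)]:
  "f \<in> measurable borel M \<Longrightarrow> f \<in> measurable unit_lborel M"
  unfolding unit_lborel_def by (rule measurable_restrict_space1) simp

interpretation unit_lborel: prob_space unit_lborel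
proof
  show "emeasure unit_lborel (space unit_lborel) = 1"
    unfolding space_unit_lborel by (simp add: unit_lborel_def emeasure_restrict_space)
qed

lemma integrable_unit_lborel:
  fixes f :: "real \<Rightarrow> 'b::{banach, second_countable_topology}"
  assumes "f \<in> borel_measurable borel" "\<And>r. r \<in> {-1/2..1/2} \<Longrightarrow> norm (f r) \<le> B"
  shows "integrable unit_lborel f"
  using assms by (intro unit_lborel.integrable_const_bound[where B = B])
    (auto simp: space_unit_lborel intro!: AE_I2)

lemma integral_unit_lborel_wave:
  "(LINT r|unit_lborel. wave (of_int p * r)) = (if p = 0 then 1 else 0)"
proof (cases "p = 0")
  case True
  then show ?thesis by (simp add: unit_lborel.prob_space)
next
  case False
  define F where "F = (\<lambda>r. wave (of_int p * r) / (2 * pi * \<i> * of_int p))"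
  have "(LINT r|unit_lborel. wave (of_int p * r)) = integral\<^sup>L lborel (\<lambda>x. indicator {-1/2..1/2} x *\<^sub>R wave (of_int p * x))"
    unfolding unit_lborel_def by (rule integral_restrict_space) simp
  also have "\<dots> = F (1/2) - F (-1/2)"
  proof (rule integral_FTC_atLeastAtMost)
    fix x :: real
    show "(F has_vector_derivative wave (of_int p * x)) (at x within {- 1 / 2..1 / 2})"
      unfolding F_def using has_vector_derivative_divide[OF wave_has_vector_derivative[of "of_int p" x], of "2 * pi * \<i> * of_int p"] False
      by simp
  qed (auto intro!: continuous_intros)
  also have "wave (of_int p * (1 / 2)) = wave (of_int p * (-1/2)) * wave (of_int p)"
    by (simp flip: wave_add del: wave_of_int)
  then have "F (1/2) - F (-1/2) = 0" by (simp add: F_def)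
  finally show ?thesis using False by simp
qed

definition fourier_coeff :: "(real \<Rightarrow> complex) \<Rightarrow> int \<Rightarrow> complex" where
  "fourier_coeff f p = (LINT r|unit_lborel. f r * wave (- of_int p * r))"

lemma fourier_coeff_diff_wave:
  assumes f: "f \<in> borel_measurable borel" "\<And>r. r \<in> {-1/2..1/2} \<Longrightarrow> norm (f r) \<le> B"
  shows "fourier_coeff (\<lambda>r. f r - c * wave (of_int q * r)) p = fourier_coeff f p - (if p = q then c else 0)"
proof -
  have "fourier_coeff (\<lambda>r. f r - c * wave (of_int q * r)) p
      = (LINT r|unit_lborel. f r * wave (- of_int p * r) - c * wave (of_int (q - p) * r))"
    unfolding fourier_coeff_def
    by (rule Bochner_Integration.integral_cong) (auto simp: algebra_simps simp flip: wave_add)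
  also have "\<dots> = fourier_coeff f p - c * (LINT r|unit_lborel. wave (of_int (q - p) * r))"
    unfolding fourier_coeff_def using f
    by (subst Bochner_Integration.integral_diff,
        intro integrable_unit_lborel[where B = B], simp, simp add: norm_mult,
        intro integrable_unit_lborel[where B = "norm c"]) (auto simp: norm_mult)
  finally show ?thesis by (simp add: integral_unit_lborel_wave del: of_int_diff)
qed

text \<open>Modes are removed one at a time. Subtracting the \<open>q\<close>-th mode with its own
  coefficient \<open>c\<close> lowers the mean square by \<open>norm c ^ 2\<close> and, by
  orthogonality, leaves the other coefficients alone. The induction hypothesis is applied to the
  remainder \<open>h\<close>, hence the generalisation over \<open>f\<close> and its bound.\<close>

lemma Bessel_inequality:
  assumes "finite A" and f: "f \<in> borel_measurable borel" "\<And>r. r \<in> {-1/2..1/2} \<Longrightarrow> norm (f r) \<le> B"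
  shows "(\<Sum>p\<in>A. norm (fourier_coeff f p) ^ 2) \<le> (LINT r|unit_lborel. norm (f r) ^ 2)"
  using assms
proof (induction A arbitrary: f B rule: finite_induct)
  case empty
  then show ?case by simp
next
  case (insert q A)
  note [measurable] = insert.prems(1)
  define c where "c = fourier_coeff f q"
  let ?G = "\<lambda>r. cnj c * (f r * wave (- of_int q * r))"
  define h where "h = (\<lambda>r. f r - c * wave (of_int q * r))"
  have h: "h \<in> borel_measurable borel" by (simp add: h_def)
  have hB: "norm (h r) \<le> B + norm c" if "r \<in> {-1/2..1/2}" for r
    using insert.prems(2)[OF that] norm_triangle_ineq4[of "f r" "c * wave (of_int q * r)"]
    by (simp add: h_def norm_mult)
  have sq: "norm (h r) ^ 2 = norm (f r) ^ 2 + norm c ^ 2 - 2 * Re (?G r)" for r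
  proof -
    have "complex_of_real (norm (h r) ^ 2) = (f r - c * wave (of_int q * r)) * (cnj (f r) - cnj c * wave (- of_int q * r))"
      unfolding complex_norm_square by (simp add: h_def cnj_wave)
    also have "\<dots> = f r * cnj (f r) + c * cnj c - (?G r + cnj (?G r))"
      by (simp add: cnj_wave algebra_simps)
    also have "\<dots> = complex_of_real (norm (f r) ^ 2 + norm c ^ 2 - 2 * Re (?G r))"
      unfolding complex_add_cnj by (simp add: complex_norm_square del: complex_cnj_mult of_real_power)
    finally show ?thesis using of_real_eq_iff by blast
  qed
  have coeff_h: "fourier_coeff h p = fourier_coeff f p" if "p \<in> A" for p
    using fourier_coeff_diff_wave[OF insert.prems, of c q p] insert.hyps that by (auto simp: h_def)
  have "(\<Sum>p\<in>A. norm (fourier_coeff f p) ^ 2) = (\<Sum>p\<in>A. norm (fourier_coeff h p) ^ 2)"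
    using coeff_h by simp
  also have "\<dots> \<le> (LINT r|unit_lborel. norm (h r) ^ 2)"
    using insert.IH[OF h hB] .
  also have "\<dots> = (LINT r|unit_lborel. norm (f r) ^ 2 + norm c ^ 2 - 2 * Re (?G r))"
    by (simp only: sq)
  also have "\<dots> = (LINT r|unit_lborel. norm (f r) ^ 2) + norm c ^ 2
      - 2 * Re (cnj c * (LINT r|unit_lborel. f r * wave (- of_int q * r)))"
  proof -
    have i1: "integrable unit_lborel (\<lambda>r. norm (f r) ^ 2)"
      by (rule integrable_unit_lborel[where B = "B ^ 2"]) (use insert.prems(2) in \<open>auto intro!: power_mono\<close>)
    have i2: "integrable unit_lborel (\<lambda>r. f r * wave (- of_int q * r))"
      by (rule integrable_unit_lborel[where B = B]) (use insert.prems(2) in \<open>auto simp: norm_mult\<close>)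
    define G where "G = (\<lambda>r. ?G r)"
    have "integrable unit_lborel G" unfolding G_def using i2 by simp
    with i1 have "(LINT r|unit_lborel. norm (f r) ^ 2 + norm c ^ 2 - 2 * Re (G r))
        = (LINT r|unit_lborel. norm (f r) ^ 2) + norm c ^ 2 - 2 * Re (LINT r|unit_lborel. G r)"
      by (simp add: unit_lborel.prob_space)
    also have "(LINT r|unit_lborel. G r) = cnj c * (LINT r|unit_lborel. f r * wave (- of_int q * r))"
      unfolding G_def by simp
    finally show ?thesis unfolding G_def .
  qed
  also have "cnj c * (LINT r|unit_lborel. f r * wave (- of_int q * r)) = of_real (norm c ^ 2)"
    unfolding complex_norm_square by (simp add: c_def fourier_coeff_def)
  finally show ?case using insert.hyps by (simp add: c_def)
qed

text \<open>Riemann-Lebesgue as a consequence of Bessel: the squares are summable along any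
  injective enumeration. An arbitrary injection covers both ends of the integers.\<close>

lemma fourier_coeff_tendsto_0:
  fixes g :: "nat \<Rightarrow> int"
  assumes f: "f \<in> borel_measurable borel" "\<And>r. r \<in> {-1/2..1/2} \<Longrightarrow> norm (f r) \<le> B" and "inj g"
  shows "(\<lambda>n. fourier_coeff f (g n)) \<longlonglongrightarrow> 0"
proof -
  have "summable (\<lambda>n. norm (fourier_coeff f (g n)) ^ 2)"
  proof (rule bounded_imp_summable)
    fix n
    have "(\<Sum>k\<le>n. norm (fourier_coeff f (g k)) ^ 2) = (\<Sum>p\<in>g ` {..n}. norm (fourier_coeff f p) ^ 2)"
      using \<open>inj g\<close> by (subst sum.reindex) (auto intro: inj_on_subset)
    also have "\<dots> \<le> (LINT r|unit_lborel. norm (f r) ^ 2)"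
      by (rule Bessel_inequality) (use f in auto)
    finally show "(\<Sum>k\<le>n. norm (fourier_coeff f (g k)) ^ 2) \<le> (LINT r|unit_lborel. norm (f r) ^ 2)" .
  qed simp
  then have "(\<lambda>n. norm (fourier_coeff f (g n)) ^ 2) \<longlonglongrightarrow> 0"
    by (rule summable_LIMSEQ_zero)
  then have "(\<lambda>n. sqrt (norm (fourier_coeff f (g n)) ^ 2)) \<longlonglongrightarrow> sqrt 0"
    by (rule tendsto_real_sqrt)
  then show ?thesis by (simp add: tendsto_norm_zero_iff)
qed

text \<open>
  Chernoff's argument: if \<open>q r = (f r - f 0) / (wave r - 1)\<close>, then the partial sums of the
  Fourier coefficients of \<open>f\<close> telescope to \<open>f 0\<close> plus two far-out coefficients of \<open>q\<close>.
\<close>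

lemma fourier_series_at_0:
  assumes f [measurable]: "f \<in> borel_measurable borel"
    and lip: "\<And>r. r \<in> {-1/2..1/2} \<Longrightarrow> norm (f r - f 0) \<le> C * \<bar>r\<bar>"
  shows "(\<lambda>N. \<Sum>p\<in>{- int N..int N}. fourier_coeff f p) \<longlonglongrightarrow> f 0"
proof -
  \<comment> \<open>At \<open>r = 0\<close> the quotient is \<open>0 / 0 = 0\<close>, a value
    compatible with both the bound and the decomposition of \<open>f\<close> below.\<close>
  define q where "q = (\<lambda>r. (f r - f 0) / (wave r - 1))"
  have C: "C \<ge> 0" using order_trans[OF norm_ge_zero lip[of "1/2"]] by simp
  have q_meas [measurable]: "q \<in> borel_measurable borel" by (simp add: q_def)
  have qB: "norm (q r) \<le> C" if "r \<in> {-1/2..1/2}" for r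
  proof (cases "r = 0")
    case True
    then show ?thesis using C by (simp add: q_def)
  next
    case False
    have "\<bar>r\<bar> \<le> norm (wave r - 1)" using that by (intro norm_wave_minus_1_ge) auto
    then have "C * \<bar>r\<bar> \<le> C * norm (wave r - 1)" using C by (intro mult_left_mono) auto
    with lip[OF that] have "norm (f r - f 0) \<le> C * norm (wave r - 1)" by simp
    moreover have "norm (wave r - 1) > 0" using False \<open>\<bar>r\<bar> \<le> _\<close> by linarith
    ultimately show ?thesis by (simp add: q_def norm_divide divide_simps)
  qed
  have f_eq: "f r = f 0 + q r * wave r - q r" if "r \<in> {-1/2..1/2}" for r
  proof (cases "r = 0")
    case False
    have "\<bar>r\<bar> \<le> norm (wave r - 1)" using that by (intro norm_wave_minus_1_ge) auto
    then have "wave r \<noteq> 1" using False by auto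
    then have "q r * (wave r - 1) = f r - f 0" by (simp add: q_def)
    then show ?thesis by (simp add: algebra_simps)
  qed (simp)
  have coeff: "fourier_coeff f p = (if p = 0 then f 0 else 0) + (fourier_coeff q (p - 1) - fourier_coeff q p)" for p
  proof -
    have "fourier_coeff f p = (LINT r|unit_lborel. f 0 * wave (of_int (- p) * r) +
        (q r * wave (- of_int (p - 1) * r) - q r * wave (- of_int p * r)))"
      unfolding fourier_coeff_def
    proof (rule Bochner_Integration.integral_cong[OF refl])
      fix r assume "r \<in> space unit_lborel"
      then have "f r = f 0 + q r * wave r - q r" by (intro f_eq) (simp add: space_unit_lborel)
      moreover have "wave (- of_int (p - 1) * r) = wave r * wave (- of_int p * r)"
        by (simp add: algebra_simps flip: wave_add)
      ultimately show "f r * wave (- of_int p * r) = f 0 * wave (of_int (- p) * r) +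
        (q r * wave (- of_int (p - 1) * r) - q r * wave (- of_int p * r))"
        by (simp only:) (simp add: ring_distribs mult_ac)
    qed
    also have "\<dots> = f 0 * (LINT r|unit_lborel. wave (of_int (- p) * r)) +
        ((LINT r|unit_lborel. q r * wave (- of_int (p - 1) * r)) - (LINT r|unit_lborel. q r * wave (- of_int p * r)))"
    proof -
      have i1: "integrable unit_lborel (\<lambda>r. f 0 * wave (of_int (- p) * r))"
        by (rule integrable_unit_lborel[where B = "norm (f 0)"]) (auto simp: norm_mult)
      have i2: "integrable unit_lborel (\<lambda>r. q r * wave (- of_int k * r))" for k
        by (rule integrable_unit_lborel[where B = C]) (use qB in \<open>auto simp: norm_mult\<close>)
      show ?thesis
        using i1 i2[of "p - 1"] i2[of p] by (simp del: of_int_diff of_int_minus)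
    qed
    finally show ?thesis by (simp add: integral_unit_lborel_wave fourier_coeff_def del: of_int_minus of_int_diff)
  qed
  have tele: "(\<Sum>p\<in>{- int N..int N}. fourier_coeff q (p - 1) - fourier_coeff q p)
      = fourier_coeff q (- 1 - int N) - fourier_coeff q (int N)" for N
  proof (induction N)
    case (Suc N)
    have "{- int (Suc N)..int (Suc N)} = insert (int (Suc N)) (insert (- int (Suc N)) {- int N..int N})" by auto
    then show ?case using Suc by (simp add: algebra_simps)
  qed (simp)
  have "(\<Sum>p\<in>{- int N..int N}. fourier_coeff f p) = f 0 + (fourier_coeff q (- 1 - int N) - fourier_coeff q (int N))" for N
    by (simp add: coeff sum.distrib tele sum.delta del: of_int_minus)
  moreover have "(\<lambda>N. f 0 + (fourier_coeff q (- 1 - int N) - fourier_coeff q (int N))) \<longlonglongrightarrow> f 0 + (0 - 0)"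
    by (intro tendsto_intros fourier_coeff_tendsto_0[where B = C] qB) (auto simp: inj_def)
  ultimately show ?thesis by simp
qed

subsection \<open>Poisson summation on the line\<close>

lemma integral_unit_lborel_shift:
  fixes F :: "real \<Rightarrow> 'b::{banach, second_countable_topology}"
  shows "(LINT r|unit_lborel. F (r + c)) = (LINT x|lborel. indicator {c - 1/2..c + 1/2} x *\<^sub>R F x)"
proof -
  let ?I = "LINT x|lborel. indicator {c - 1/2..c + 1/2} x *\<^sub>R F x"
  have "(LINT r|unit_lborel. F (r + c)) = (LINT r|lborel. indicator {-1/2..1/2} r *\<^sub>R F (r + c))"
    unfolding unit_lborel_def by (rule integral_restrict_space) simp
  also have "\<dots> = (LINT r|lborel. indicator {c - 1/2..c + 1/2} (c + 1 * r) *\<^sub>R F (c + 1 * r))"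
    by (rule Bochner_Integration.integral_cong) (auto simp: indicator_def add.commute)
  also have "\<dots> = ?I"
    using lborel_integral_real_affine[of 1 "\<lambda>x. indicator {c - 1/2..c + 1/2} x *\<^sub>R F x" c] by simp
  finally show ?thesis .
qed

lemma sum_integral_unit_lborel_shift:
  fixes F :: "real \<Rightarrow> 'b::{banach, second_countable_topology}"
  assumes F: "integrable lborel F"
  shows "(\<Sum>m\<in>{- int N..int N}. LINT r|unit_lborel. F (r + of_int m))
    = (LINT x|lborel. indicator {- real N - 1/2..real N + 1/2} x *\<^sub>R F x)"
proof -
  have int: "integrable lborel (\<lambda>x. indicator {a..b} x *\<^sub>R F x)" for a b :: real
    using F by (intro integrable_mult_indicator) auto
  have split: "(LINT x|lborel. indicator {a..c} x *\<^sub>R F x) =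
      (LINT x|lborel. indicator {a..b} x *\<^sub>R F x) + (LINT x|lborel. indicator {b..c} x *\<^sub>R F x)"
    if "a \<le> b" "b \<le> c" for a b c :: real
  proof -
    have "(LINT x|lborel. indicator {a..c} x *\<^sub>R F x) =
      (LINT x|lborel. indicator {a..b} x *\<^sub>R F x + indicator {b..c} x *\<^sub>R F x)"
    proof (rule integral_cong_AE)
      show "AE x in lborel. indicator {a..c} x *\<^sub>R F x = indicator {a..b} x *\<^sub>R F x + indicator {b..c} x *\<^sub>R F x"
        using AE_lborel_singleton[of b] by eventually_elim (use that in \<open>auto simp: indicator_def\<close>)
    qed (use F in \<open>auto dest: borel_measurable_integrable\<close>)
    then show ?thesis using int by simp
  qed
  show ?thesis
  proof (induction N)
    case 0
    then show ?case using integral_unit_lborel_shift[of F 0] by simp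
  next
    case (Suc N)
    let ?I = "\<lambda>a b. LINT x|lborel. indicator {a..b} x *\<^sub>R F x"
    have "{- int (Suc N)..int (Suc N)} = insert (int (Suc N)) (insert (- int (Suc N)) {- int N..int N})" by auto
    then have "(\<Sum>m\<in>{- int (Suc N)..int (Suc N)}. LINT r|unit_lborel. F (r + of_int m))
      = (LINT r|unit_lborel. F (r + (1 + real N))) + (LINT r|unit_lborel. F (r + (- 1 - real N)))
        + (LINT x|lborel. indicator {- real N - 1/2..real N + 1/2} x *\<^sub>R F x)"
      using Suc by (simp add: algebra_simps)
    also have "(LINT r|unit_lborel. F (r + (1 + real N))) = ?I (real N + 1/2) (real N + 3/2)"
      unfolding integral_unit_lborel_shift by (simp add: algebra_simps)
    also have "(LINT r|unit_lborel. F (r + (- 1 - real N))) = ?I (- real N - 3/2) (- real N - 1/2)"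
    proof -
      have e: "- 1 - real N - 1/2 = - real N - 3/2" "- 1 - real N + 1/2 = - real N - 1/2" by auto
      show ?thesis unfolding integral_unit_lborel_shift e ..
    qed
    also have "?I (real N + 1/2) (real N + 3/2) + ?I (- real N - 3/2) (- real N - 1/2) + ?I (- real N - 1/2) (real N + 1/2)
        = ?I (- real N - 3/2) (real N + 3/2)"
    proof -
      have "?I (- real N - 3/2) (real N + 3/2) = ?I (- real N - 3/2) (- real N - 1/2) + ?I (- real N - 1/2) (real N + 3/2)"
        by (rule split) auto
      moreover have "?I (- real N - 1/2) (real N + 3/2) = ?I (- real N - 1/2) (real N + 1/2) + ?I (real N + 1/2) (real N + 3/2)"
        by (rule split) auto
      ultimately show ?thesis by (simp only: add_ac)
    qed
    finally show ?case by (simp add: algebra_simps)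
  qed
qed

text \<open>The Fourier series at 0 is taken for the periodisation of \<open>F\<close>, a finite sum
  that inherits the Lipschitz bound and whose coefficients are the values of the transform at the
  integers. The conclusion concerns symmetric partial sums only, so no decay of the transform is
  required.\<close>

lemma Poisson_summation:
  fixes F :: "real \<Rightarrow> complex"
  assumes supp: "\<And>x. \<bar>x\<bar> > real K \<Longrightarrow> F x = 0"
    and lip: "\<And>x y. norm (F x - F y) \<le> C * \<bar>x - y\<bar>"
  shows "(\<lambda>N. \<Sum>p\<in>{- int N..int N}. LINT x|lborel. F x * wave (- of_int p * x)) \<longlonglongrightarrow>
    (\<Sum>m\<in>{- int K..int K}. F (of_int m))"
proof -
  have C: "C \<ge> 0" using order_trans[OF norm_ge_zero lip[of 1 0]] by simp
  have "C-lipschitz_on UNIV F"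
    by (rule lipschitz_onI) (use lip C in \<open>auto simp: dist_norm\<close>)
  then have cont: "continuous_on UNIV F" by (rule lipschitz_on_continuous_on)
  then have [measurable]: "F \<in> borel_measurable borel" by (rule borel_measurable_continuous_onI)
  have supp_ind: "F x = indicator {- real (Suc K)..real (Suc K)} x *\<^sub>R F x" for x
    using supp[of x] by (auto simp: indicator_def)
  have int: "integrable lborel (\<lambda>x. F x * wave (- of_int p * x))" for p
  proof -
    have "integrable lborel (\<lambda>x. indicator {- real (Suc K)..real (Suc K)} x *\<^sub>R (F x * wave (- of_int p * x)))"
      by (rule borel_integrable_compact) (auto intro!: continuous_intros continuous_on_subset[OF cont])
    moreover have "indicator {- real (Suc K)..real (Suc K)} x *\<^sub>R (F x * wave (- of_int p * x)) = F x * wave (- of_int p * x)" for x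
      using supp_ind[of x] by (auto simp: indicator_def)
    ultimately show ?thesis by simp
  qed
  define f where "f = (\<lambda>r. \<Sum>m\<in>{- int (Suc K)..int (Suc K)}. F (r + of_int m))"
  have [measurable]: "f \<in> borel_measurable borel" by (simp add: f_def)
  have "norm (f r - f 0) \<le> (\<Sum>m\<in>{- int (Suc K)..int (Suc K)}. C * \<bar>r\<bar>)" for r
    unfolding f_def sum_subtractf[symmetric]
  proof (rule order_trans[OF norm_sum sum_mono])
    fix m
    show "norm (F (r + of_int m) - F (0 + of_int m)) \<le> C * \<bar>r\<bar>"
      using lip[of "r + of_int m" "of_int m"] by simp
  qed
  then have "norm (f r - f 0) \<le> (real (card {- int (Suc K)..int (Suc K)}) * C) * \<bar>r\<bar>" for r
    by (simp add: mult.assoc)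
  then have lim: "(\<lambda>N. \<Sum>p\<in>{- int N..int N}. fourier_coeff f p) \<longlonglongrightarrow> f 0"
    by (intro fourier_series_at_0) auto
  have "fourier_coeff f p = (LINT x|lborel. F x * wave (- of_int p * x))" for p
  proof -
    have B: "\<exists>B. \<forall>x. norm (F x) \<le> B"
    proof -
      have "norm (F x) \<le> C * (2 * real (Suc K))" for x
      proof (cases "\<bar>x\<bar> > real K")
        case False
        then have "C * \<bar>x - real (Suc K)\<bar> \<le> C * (2 * real (Suc K))" using C by (intro mult_left_mono) auto
        then show ?thesis using lip[of x "real (Suc K)"] supp[of "real (Suc K)"] by simp
      qed (use supp[of x] C in simp)
      then show ?thesis by blast
    qed
    then obtain B where B: "\<And>x. norm (F x) \<le> B" by blast
    have "fourier_coeff f p = (LINT r|unit_lborel. (\<Sum>m\<in>{- int (Suc K)..int (Suc K)}. F (r + of_int m) * wave (- of_int p * (r + of_int m))))"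
    proof -
      have "wave (- of_int p * (r + of_int m)) = wave (- of_int p * r)" for r and m :: int
      proof -
        have "- of_int p * (r + of_int m) = - of_int p * r + of_int (- p * m)" by (simp add: algebra_simps)
        then show ?thesis by (simp only: wave_add wave_of_int mult_1_right)
      qed
      then show ?thesis by (simp add: fourier_coeff_def f_def sum_distrib_right)
    qed
    also have "\<dots> = (\<Sum>m\<in>{- int (Suc K)..int (Suc K)}. LINT r|unit_lborel. F (r + of_int m) * wave (- of_int p * (r + of_int m)))"
      by (rule Bochner_Integration.integral_sum) (auto intro!: integrable_unit_lborel[where B = B] B simp: norm_mult)
    also have "\<dots> = (LINT x|lborel. indicator {- real (Suc K) - 1/2..real (Suc K) + 1/2} x *\<^sub>R (F x * wave (- of_int p * x)))"
      by (rule sum_integral_unit_lborel_shift[OF int])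
    also have "\<dots> = (LINT x|lborel. F x * wave (- of_int p * x))"
      by (rule Bochner_Integration.integral_cong) (use supp in \<open>auto simp: indicator_def\<close>)
    finally show ?thesis .
  qed
  moreover have "f 0 = (\<Sum>m\<in>{- int K..int K}. F (of_int m))"
    unfolding f_def using supp by (intro sum.mono_neutral_cong_right) auto
  ultimately show ?thesis using lim by simp
qed

subsection \<open>Triangle functions and their transforms\<close>

text \<open>For \<open>A > 0\<close> this is the length of the overlap of an interval of length
  \<open>A\<close> with its translate by \<open>u\<close>. It serves both as the autocorrelation of
  the window and as the cut-off in physical space.\<close>

definition triangle :: "real \<Rightarrow> real \<Rightarrow> real" where
  "triangle A u = max 0 (A - \<bar>u\<bar>)"

text \<open>The Fourier transform of \<open>triangle A\<close>, with the removable singularity at 0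
  filled in.\<close>

definition fejer :: "real \<Rightarrow> real \<Rightarrow> real" where
  "fejer A k = (if k = 0 then A ^ 2 else (sin (pi * A * k) / (pi * k)) ^ 2)"

lemma triangle_nonneg: "triangle A u \<ge> 0"
  by (simp add: triangle_def)

lemma triangle_le: "A \<ge> 0 \<Longrightarrow> triangle A u \<le> A"
  by (simp add: triangle_def)

lemma triangle_eq_0: "A \<le> \<bar>u\<bar> \<Longrightarrow> triangle A u = 0"
  by (simp add: triangle_def)

lemma triangle_lipschitz: "\<bar>triangle A u - triangle A v\<bar> \<le> \<bar>u - v\<bar>"
  by (simp add: triangle_def max_def) arith

lemma continuous_on_triangle [continuous_intros]:
  "continuous_on S f \<Longrightarrow> continuous_on S (\<lambda>x. triangle A (f x))"
  unfolding triangle_def by (intro continuous_intros)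

lemma borel_measurable_triangle [measurable]: "triangle A \<in> borel_measurable borel"
  by (intro borel_measurable_continuous_onI continuous_intros)

lemma borel_measurable_fejer [measurable]: "fejer A \<in> borel_measurable borel"
  unfolding fejer_def[abs_def] by measurable

lemma fejer_nonneg: "fejer A k \<ge> 0"
  by (simp add: fejer_def)

lemma fejer_minus [simp]: "fejer A (- k) = fejer A k"
  by (simp add: fejer_def power2_eq_square)

lemma fejer_scale:
  assumes "L > 0"
  shows "fejer L (k / L) = L ^ 2 * fejer 1 k"
  using assms by (simp add: fejer_def power_divide power_mult_distrib)

lemma square_times_fejer_le: "k ^ 2 * fejer A k \<le> 1"
proof (cases "k = 0")
  case False
  have "sin (pi * A * k) ^ 2 \<le> 1" by (simp add: abs_square_le_1)
  moreover have "1 \<le> pi ^ 2" using pi_gt3 by (intro one_le_power) auto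
  ultimately have "sin (pi * A * k) ^ 2 \<le> pi ^ 2" by linarith
  then show ?thesis using False
    by (simp add: fejer_def power_divide power_mult_distrib divide_simps)
qed (simp)

lemma fejer_le_square: "fejer A k \<le> A ^ 2"
proof (cases "k = 0")
  case False
  have "\<bar>sin (pi * A * k)\<bar> \<le> \<bar>A * (pi * k)\<bar>"
    using abs_sin_x_le_abs_x[of "pi * A * k"] by (simp add: mult_ac)
  then have "sin (pi * A * k) ^ 2 \<le> (A * (pi * k)) ^ 2" by (simp add: abs_le_square_iff)
  then show ?thesis using False
    by (simp add: fejer_def power_divide power_mult_distrib divide_simps)
qed (simp add: fejer_def)

lemma fejer_le: "fejer A k \<le> (A ^ 2 + 1) / (1 + k ^ 2)"
proof -
  have "(1 + k ^ 2) * fejer A k \<le> A ^ 2 + 1"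
    using square_times_fejer_le[of k A] fejer_le_square[of A k]
    by (simp add: algebra_simps)
  then show ?thesis by (simp add: add_pos_nonneg field_simps)
qed

lemma fejer_affine_le:
  "\<exists>C\<ge>0. \<forall>x. fejer A (x / sqrt 5 + \<beta>) \<le> C / (1 + x ^ 2)"
proof (intro exI conjI allI)
  fix x :: real
  define y where "y = x / sqrt 5"
  have x2: "x ^ 2 = 5 * y ^ 2" by (simp add: y_def power_divide)
  have "0 \<le> (y + 2 * \<beta>) ^ 2" by simp
  then have "y ^ 2 \<le> 2 * (y + \<beta>) ^ 2 + 2 * \<beta> ^ 2" by (simp add: power2_eq_square algebra_simps)
  moreover have "0 \<le> \<beta> ^ 2 * (y + \<beta>) ^ 2" "0 \<le> \<beta> ^ 2" by simp_all
  moreover have "10 * (1 + \<beta> ^ 2) * (1 + (y + \<beta>) ^ 2)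
      = 10 + 10 * \<beta> ^ 2 + 10 * (y + \<beta>) ^ 2 + 10 * (\<beta> ^ 2 * (y + \<beta>) ^ 2)"
    by (simp add: algebra_simps)
  ultimately have "1 + x ^ 2 \<le> 10 * (1 + \<beta> ^ 2) * (1 + (y + \<beta>) ^ 2)"
    unfolding x2 by linarith
  then have "1 / (1 + (y + \<beta>) ^ 2) \<le> 10 * (1 + \<beta> ^ 2) / (1 + x ^ 2)"
    by (simp add: divide_simps add_pos_nonneg)
  then have "(A ^ 2 + 1) * (1 / (1 + (y + \<beta>) ^ 2)) \<le> (A ^ 2 + 1) * (10 * (1 + \<beta> ^ 2) / (1 + x ^ 2))"
    by (intro mult_left_mono) auto
  then show "fejer A (x / sqrt 5 + \<beta>) \<le> (A ^ 2 + 1) * 10 * (1 + \<beta> ^ 2) / (1 + x ^ 2)"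
    using fejer_le[of A "y + \<beta>"] unfolding y_def by (simp add: algebra_simps)
qed simp

lemma triangle_wave_lipschitz:
  assumes L: "L > 0"
  shows "norm (triangle L x * wave (- \<beta> * x) - triangle L y * wave (- \<beta> * y))
    \<le> (1 + L * (2 * pi * \<bar>\<beta>\<bar>)) * \<bar>x - y\<bar>"
proof -
  have "triangle L x * wave (- \<beta> * x) - triangle L y * wave (- \<beta> * y) = of_real (triangle L x - triangle L y) * wave (- \<beta> * x) + triangle L y * (wave (- \<beta> * x) - wave (- \<beta> * y))"
    by (simp add: algebra_simps)
  also have "norm \<dots> \<le> \<bar>x - y\<bar> + L * (2 * pi * \<bar>(- \<beta> * x) - (- \<beta> * y)\<bar>)"
  proof (intro order_trans[OF norm_triangle_ineq] add_mono)
    show "norm (of_real (triangle L x - triangle L y) * wave (- \<beta> * x)) \<le> \<bar>x - y\<bar>"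
      unfolding norm_mult norm_of_real by (simp add: triangle_lipschitz)
    show "norm (triangle L y * (wave (- \<beta> * x) - wave (- \<beta> * y))) \<le> L * (2 * pi * \<bar>(- \<beta> * x) - (- \<beta> * y)\<bar>)"
      unfolding norm_mult norm_of_real abs_of_nonneg[OF triangle_nonneg]
      using L by (intro mult_mono norm_wave_diff_le triangle_le) auto
  qed
  also have "\<bar>(- \<beta> * x) - (- \<beta> * y)\<bar> = \<bar>\<beta>\<bar> * \<bar>x - y\<bar>"
  proof -
    have "(- \<beta> * x) - (- \<beta> * y) = - \<beta> * (x - y)" by (simp add: algebra_simps)
    then show ?thesis by (simp only: abs_mult abs_minus)
  qed
  finally show ?thesis by (simp add: algebra_simps)
qed

lemma integral_triangle_wave:
  assumes "A > 0"
  shows "(LINT x|lborel. triangle A x * wave (k * x)) = fejer A k"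
proof -
  define c where "c = 2 * pi * \<i> * k"
  \<comment> \<open>\<open>G\<close> and \<open>H\<close> are antiderivatives on the right and left
    half of the triangle, found by integration by parts. The case \<open>k = 0\<close> is separate
    because there \<open>c = 0\<close>.\<close>
  define G where "G = (\<lambda>u. if k = 0 then of_real (A * u - u ^ 2 / 2)
    else (A - u) * wave (k * u) / c + wave (k * u) / c ^ 2)"
  define H where "H = (\<lambda>u. if k = 0 then of_real (A * u + u ^ 2 / 2)
    else (A + u) * wave (k * u) / c - wave (k * u) / c ^ 2)"
  have w: "((\<lambda>x. wave (k * x)) has_vector_derivative (c * wave (k * x))) (at x within S)" for x S
    unfolding c_def by (rule wave_has_vector_derivative)
  have c0: "c = 0 \<longleftrightarrow> k = 0" by (simp add: c_def)
  have 1: "(LINT x|lborel. indicator {0..A} x *\<^sub>R ((A - x) * wave (k * x))) = G A - G 0"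
  proof (rule integral_FTC_atLeastAtMost)
    show "(G has_vector_derivative (A - x) * wave (k * x)) (at x within {0..A})" for x
    proof (cases "k = 0")
      case True
      have "((\<lambda>u. complex_of_real (A * u - u ^ 2 / 2)) has_vector_derivative of_real (A - x)) (at x within S)" for S
        by (intro has_vector_derivative_of_real) (auto intro!: derivative_eq_intros)
      then show ?thesis using True by (simp add: G_def)
    next
      case False
      have "((\<lambda>u. (A - u) * wave (k * u) / c + wave (k * u) / c ^ 2) has_vector_derivative
         ((of_real (A - x) * (c * wave (k * x)) + of_real (0 - 1) * wave (k * x)) / c + c * wave (k * x) / c ^ 2)) (at x within {0..A})"
        by (intro has_vector_derivative_add has_vector_derivative_divide has_vector_derivative_mult w
              has_vector_derivative_of_real DERIV_diff DERIV_const DERIV_ident)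
      then show ?thesis using False c0 by (simp add: G_def power2_eq_square diff_divide_distrib)
    qed
  qed (use assms in \<open>auto intro!: continuous_intros\<close>)
  have 2: "(LINT x|lborel. indicator {-A..0} x *\<^sub>R ((A + x) * wave (k * x))) = H 0 - H (-A)"
  proof (rule integral_FTC_atLeastAtMost)
    show "(H has_vector_derivative (A + x) * wave (k * x)) (at x within {-A..0})" for x
    proof (cases "k = 0")
      case True
      have "((\<lambda>u. complex_of_real (A * u + u ^ 2 / 2)) has_vector_derivative of_real (A + x)) (at x within S)" for S
        by (intro has_vector_derivative_of_real) (auto intro!: derivative_eq_intros)
      then show ?thesis using True by (simp add: H_def)
    next
      case False
      have "((\<lambda>u. (A + u) * wave (k * u) / c - wave (k * u) / c ^ 2) has_vector_derivative
         ((of_real (A + x) * (c * wave (k * x)) + of_real (0 + 1) * wave (k * x)) / c - c * wave (k * x) / c ^ 2)) (at x within {-A..0})"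
        by (intro has_vector_derivative_diff has_vector_derivative_divide has_vector_derivative_mult w
              has_vector_derivative_of_real DERIV_add DERIV_const DERIV_ident)
      then show ?thesis using False c0 by (simp add: H_def power2_eq_square add_divide_distrib)
    qed
  qed (use assms in \<open>auto intro!: continuous_intros\<close>)
  have "(LINT x|lborel. triangle A x * wave (k * x)) =
     (LINT x|lborel. indicator {0..A} x *\<^sub>R ((A - x) * wave (k * x)) + indicator {-A..0} x *\<^sub>R ((A + x) * wave (k * x)))"
  proof (rule integral_cong_AE)
    show "AE x in lborel. triangle A x * wave (k * x) =
       indicator {0..A} x *\<^sub>R ((A - x) * wave (k * x)) + indicator {-A..0} x *\<^sub>R ((A + x) * wave (k * x))"
      using AE_lborel_singleton[of 0]
      by eventually_elim (use assms in \<open>auto simp: indicator_def triangle_def max_def\<close>)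
  qed simp_all
  also have "\<dots> = (G A - G 0) + (H 0 - H (- A))"
    unfolding 1[symmetric] 2[symmetric]
    by (intro Bochner_Integration.integral_add borel_integrable_compact) (auto intro!: continuous_intros)
  also have "\<dots> = fejer A k"
  proof (cases "k = 0")
    case True
    then show ?thesis by (simp add: G_def H_def fejer_def power2_eq_square)
  next
    case False
    have "(G A - G 0) + (H 0 - H (- A)) = (wave (k * A) + wave (- (k * A)) - 2) / c ^ 2"
      using False by (simp add: G_def H_def diff_divide_distrib add_divide_distrib)
    also have "wave (k * A) + wave (- (k * A)) - 2 = of_real (2 * cos (2 * (pi * A * k)) - 2)"
      by (simp add: wave_def complex_eq_iff mult_ac)
    also have "\<dots> = of_real (- 4 * sin (pi * A * k) ^ 2)"
      by (subst cos_double_sin) simp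
    also have "c ^ 2 = of_real (- 4 * (pi * k) ^ 2)"
      by (simp add: c_def power_mult_distrib)
    finally show ?thesis using False
      by (simp add: fejer_def power_divide flip: of_real_divide of_real_power)
  qed
  finally show ?thesis .
qed

subsection \<open>Poisson summation for the lattice\<close>

lemma sum_tendsto_integral_int:
  fixes f :: "int \<Rightarrow> complex"
  assumes "integrable counting f"
  shows "(\<lambda>N. \<Sum>p\<in>{- int N..int N}. f p) \<longlonglongrightarrow> (LINT p|counting. f p)"
proof -
  have "(\<lambda>N. LINT p|counting. indicator {- int N..int N} p *\<^sub>R f p) \<longlonglongrightarrow> (LINT p|counting. f p)"
  proof (rule integral_dominated_convergence[where w = "\<lambda>p. norm (f p)"])
    show "AE p in count_space UNIV. (\<lambda>N. indicator {- int N..int N} p *\<^sub>R f p) \<longlonglongrightarrow> f p"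
    proof (rule AE_I2)
      fix p :: int
      have "eventually (\<lambda>N. indicator {- int N..int N} p *\<^sub>R f p = f p) sequentially"
        using eventually_ge_at_top[of "nat \<bar>p\<bar>"] by eventually_elim (auto simp: indicator_def)
      then show "(\<lambda>N. indicator {- int N..int N} p *\<^sub>R f p) \<longlonglongrightarrow> f p" by (rule tendsto_eventually)
    qed
  qed (use assms in \<open>auto simp: indicator_def\<close>)
  moreover have "(LINT p|counting. indicator {- int N..int N} p *\<^sub>R f p) = (\<Sum>p\<in>{- int N..int N}. f p)" for N
  proof -
    have "finite {p. indicat_real {- int N..int N} p *\<^sub>R f p \<noteq> 0}"
      by (rule finite_subset[of _ "{- int N..int N}"]) (auto simp: indicator_def)
    then show ?thesis
      by (subst lebesgue_integral_count_space_finite_support)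
         (auto simp: indicator_def intro!: sum.mono_neutral_cong_left)
  qed
  ultimately show ?thesis by simp
qed

lemma lipschitz_product_bound:
  fixes f g :: "real \<Rightarrow> complex"
  assumes "\<And>x y. norm (f x - f y) \<le> C * \<bar>x - y\<bar>" "\<And>x y. norm (g x - g y) \<le> D * \<bar>x - y\<bar>"
    "\<And>x. norm (f x) \<le> M" "\<And>x. norm (g x) \<le> N"
  shows "norm (f x * g y - f x' * g y') \<le> C * N * \<bar>x - x'\<bar> + D * M * \<bar>y - y'\<bar>"
proof -
  have M: "M \<ge> 0" by (rule order_trans[OF norm_ge_zero assms(3)])
  have "f x * g y - f x' * g y' = (f x - f x') * g y + f x' * (g y - g y')" by (simp add: algebra_simps)
  also have "norm \<dots> \<le> (C * \<bar>x - x'\<bar>) * N + M * (D * \<bar>y - y'\<bar>)"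
  proof (rule order_trans[OF norm_triangle_ineq], unfold norm_mult, rule add_mono)
    show "norm (f x - f x') * norm (g y) \<le> (C * \<bar>x - x'\<bar>) * N"
      using order_trans[OF norm_ge_zero assms(1)] by (intro mult_mono assms) auto
    show "norm (f x') * norm (g y - g y') \<le> M * (D * \<bar>y - y'\<bar>)"
      using M by (intro mult_mono assms) auto
  qed
  finally show ?thesis by (simp add: mult_ac)
qed

text \<open>
  Poisson summation over \<open>\<int>\<^sup>2\<close> for \<open>F r t = f (r + t golden) h (r + t (1 - golden))\<close>, one variable at
  a time. The substitutions \<open>u = r + t (1 - golden)\<close> and \<open>x = u + t sqrt 5\<close> factor the transform of \<open>F\<close>.
\<close>

locale lattice_poisson =
  fixes L s \<beta> :: real
  assumes L: "L > 0" and s: "s > 0"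
begin

definition f :: "real \<Rightarrow> complex" where "f x = triangle L x * wave (- \<beta> * x)"
definition h :: "real \<Rightarrow> complex" where "h x = triangle s x"
definition F :: "real \<Rightarrow> real \<Rightarrow> complex" where "F r t = f (r + t * golden) * h (r + t * (1 - golden))"
definition K :: nat where "K = nat \<lceil>2 * L + 2 * s\<rceil>"
definition A :: "int \<Rightarrow> real \<Rightarrow> complex" where "A p t = (LINT r|lborel. F r t * wave (- of_int p * r))"

text \<open>The arguments of the two triangles differ by \<open>t * sqrt 5\<close>, which confines
  \<open>t\<close>; the second argument then confines \<open>r\<close>, as
  \<open>\<bar>1 - golden\<bar> \<le> 1\<close>. This gives \<open>\<bar>t\<bar> < L + s\<close> and
  \<open>\<bar>r\<bar> < L + 2 * s\<close>, both covered by \<open>K\<close>.\<close>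

lemma F_support: "F r t = 0" if "\<bar>r\<bar> > real K \<or> \<bar>t\<bar> > real K"
proof (rule ccontr)
  assume "F r t \<noteq> 0"
  then have 1: "\<bar>r + t * golden\<bar> < L" and 2: "\<bar>r + t * (1 - golden)\<bar> < s"
    using triangle_eq_0[of L "r + t * golden"] triangle_eq_0[of s "r + t * (1 - golden)"]
    by (auto simp: F_def f_def h_def not_le[symmetric])
  have K: "2 * L + 2 * s \<le> real K" using L s by (simp add: K_def)
  have "t * sqrt 5 = (r + t * golden) - (r + t * (1 - golden))"
    by (simp add: golden_def field_simps)
  then have "\<bar>t * sqrt 5\<bar> < L + s" using 1 2 by linarith
  then have "\<bar>t\<bar> * sqrt 5 < L + s" by (simp add: abs_mult)
  moreover have "\<bar>t\<bar> * 1 \<le> \<bar>t\<bar> * sqrt 5" by (intro mult_left_mono) auto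
  ultimately have t: "\<bar>t\<bar> < L + s" by linarith
  have "\<bar>t * (1 - golden)\<bar> \<le> \<bar>t\<bar> * 1"
  proof -
    have "sqrt 5 \<le> 3" by (rule real_le_lsqrt) auto
    then have "\<bar>1 - golden\<bar> \<le> 1" by (simp add: golden_def)
    then show ?thesis unfolding abs_mult by (intro mult_left_mono) auto
  qed
  then have "\<bar>r\<bar> < L + 2 * s" using 2 t by linarith
  with t K that L s show False by linarith
qed

lemma F_lipschitz: "\<exists>C\<ge>0. \<forall>r t r' t'. norm (F r t - F r' t') \<le> C * (\<bar>r - r'\<bar> + \<bar>t - t'\<bar>)"
proof -
  define Cf where "Cf = 1 + L * (2 * pi * \<bar>\<beta>\<bar>)"
  have Cf: "Cf \<ge> 0" using L by (simp add: Cf_def)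
  have f_lip: "norm (f x - f y) \<le> Cf * \<bar>x - y\<bar>" for x y
    unfolding f_def Cf_def by (rule triangle_wave_lipschitz[OF L])
  have h_lip: "norm (h x - h y) \<le> 1 * \<bar>x - y\<bar>" for x y
    using triangle_lipschitz[of s x y] unfolding h_def of_real_diff[symmetric] norm_of_real by simp
  have g1: "golden \<le> 2" "\<bar>1 - golden\<bar> \<le> 2"
  proof -
    have "sqrt 5 \<le> 3" by (rule real_le_lsqrt) auto
    then show "golden \<le> 2" "\<bar>1 - golden\<bar> \<le> 2" by (simp_all add: golden_def)
  qed
  have "norm (F r t - F r' t') \<le> 2 * (Cf * s + L) * (\<bar>r - r'\<bar> + \<bar>t - t'\<bar>)" for r t r' t'
  proof -
    have "norm (F r t - F r' t') \<le> Cf * s * \<bar>(r + t * golden) - (r' + t' * golden)\<bar> +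
      1 * L * \<bar>(r + t * (1 - golden)) - (r' + t' * (1 - golden))\<bar>"
      unfolding F_def
    proof (rule lipschitz_product_bound[OF f_lip h_lip])
      show "norm (f x) \<le> L" for x
        using triangle_nonneg[of L x] triangle_le[of L x] L by (simp add: f_def norm_mult)
      show "norm (h x) \<le> s" for x
        using triangle_nonneg[of s x] triangle_le[of s x] s by (simp add: h_def)
    qed
    also have "\<dots> \<le> Cf * s * (2 * (\<bar>r - r'\<bar> + \<bar>t - t'\<bar>)) + 1 * L * (2 * (\<bar>r - r'\<bar> + \<bar>t - t'\<bar>))"
    proof -
      have *: "\<bar>(r + t * c) - (r' + t' * c)\<bar> \<le> 2 * (\<bar>r - r'\<bar> + \<bar>t - t'\<bar>)" if "\<bar>c\<bar> \<le> 2" for c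
      proof -
        have "(r + t * c) - (r' + t' * c) = (r - r') + (t - t') * c" by (simp add: algebra_simps)
        then have "\<bar>(r + t * c) - (r' + t' * c)\<bar> \<le> \<bar>r - r'\<bar> + \<bar>t - t'\<bar> * \<bar>c\<bar>"
          using abs_triangle_ineq[of "r - r'" "(t - t') * c"] by (simp only: abs_mult)
        moreover have "\<bar>t - t'\<bar> * \<bar>c\<bar> \<le> \<bar>t - t'\<bar> * 2" using that by (intro mult_left_mono) auto
        moreover have "0 \<le> \<bar>r - r'\<bar>" by simp
        ultimately show ?thesis by argo
      qed
      show ?thesis using L s Cf g1 golden_gt_1 by (intro add_mono mult_left_mono *) auto
    qed
    finally show ?thesis by (simp add: algebra_simps)
  qed
  moreover have "2 * (Cf * s + L) \<ge> 0" using Cf s L by simp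
  ultimately show ?thesis by blast
qed

lemma continuous_on_F [continuous_intros]:
  "continuous_on S a \<Longrightarrow> continuous_on S b \<Longrightarrow> continuous_on S (\<lambda>x. F (a x) (b x))"
  unfolding F_def f_def h_def by (intro continuous_intros)

lemma integrable_F_wave: "integrable lborel (\<lambda>r. F r t * wave (- of_int p * r))"
proof -
  have "integrable lborel (\<lambda>r. indicator {- real K..real K} r *\<^sub>R (F r t * wave (- of_int p * r)))"
    by (rule borel_integrable_compact) (auto intro!: continuous_intros)
  moreover have "indicator {- real K..real K} r *\<^sub>R (F r t * wave (- of_int p * r)) = F r t * wave (- of_int p * r)" for r
    using F_support[of r t] by (auto simp: indicator_def)
  ultimately show ?thesis by simp
qed

text \<open>The partial transform must itself satisfy the hypotheses of
  \<open>Poisson_summation\<close> in the variable \<open>t\<close>; \<open>2 * K\<close> is the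
  length of the range of integration.\<close>

lemma A_lipschitz: "\<exists>C. \<forall>t t'. norm (A p t - A p t') \<le> C * \<bar>t - t'\<bar>"
proof -
  let ?f = "\<lambda>r t. F r t * wave (- of_int p * r)"
  obtain C where C: "C \<ge> 0" "\<And>r t r' t'. norm (F r t - F r' t') \<le> C * (\<bar>r - r'\<bar> + \<bar>t - t'\<bar>)"
    using F_lipschitz by blast
  have "norm (A p t - A p t') \<le> (C * (2 * real K)) * \<bar>t - t'\<bar>" for t t'
  proof -
    have A_diff: "A p t - A p t' = (LINT r|lborel. ?f r t - ?f r t')"
      unfolding A_def by (rule Bochner_Integration.integral_diff[symmetric]; rule integrable_F_wave)
    have "norm (A p t - A p t') \<le> (LINT r|lborel. indicator {- real K..real K} r *\<^sub>R (C * \<bar>t - t'\<bar>))"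
      unfolding A_diff
    proof (rule Bochner_Integration.integral_norm_bound_integral)
      fix r
      show "norm (?f r t - ?f r t')
          \<le> indicator {- real K..real K} r *\<^sub>R (C * \<bar>t - t'\<bar>)"
      proof (cases "r \<in> {- real K..real K}")
        case True
        have "norm (?f r t - ?f r t') = norm (F r t - F r t')"
          by (simp only: left_diff_distrib[symmetric] norm_mult norm_wave mult_1_right)
        also have "\<dots> \<le> C * \<bar>t - t'\<bar>" using C(2)[of r t r t'] by simp
        finally show ?thesis using True by simp
      next
        case False
        then have "\<bar>r\<bar> > real K" by auto
        then have "F r t = 0" "F r t' = 0" using F_support by blast+
        then show ?thesis using C(1) by simp
      qed
      show "integrable lborel (\<lambda>r. ?f r t - ?f r t')"
        by (rule Bochner_Integration.integrable_diff; rule integrable_F_wave)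
      show "integrable lborel (\<lambda>r. indicat_real {- real K..real K} r *\<^sub>R (C * \<bar>t - t'\<bar>))"
        by (rule borel_integrable_compact) simp_all
    qed
    also have "\<dots> = (C * (2 * real K)) * \<bar>t - t'\<bar>" by simp
    finally show ?thesis .
  qed
  then show ?thesis by blast
qed

text \<open>The lattice is self-dual up to the factor \<open>sqrt 5\<close>: the frequency pair
  \<open>(p, q)\<close> belongs to the point \<open>(q - p, p)\<close>. The first substitution has
  Jacobian 1 and isolates \<open>h\<close>; the second has Jacobian \<open>sqrt 5\<close>, which
  accounts for the last divisor. The signs disappear because \<open>fejer\<close> is even.\<close>

lemma A_transform:
  "(LINT t|lborel. A p t * wave (- of_int q * t)) =
    fejer L (emb (q - p, p) / sqrt 5 + \<beta>) * fejer s (emb_star (q - p, p) / sqrt 5) / sqrt 5"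
proof -
  let ?r = "\<lambda>t u. - t * (1 - golden) + 1 * u" and ?a = "of_int p * (1 - golden) - of_int q :: real"
  define a where "a = ?a / sqrt 5"
  define G where "G = (\<lambda>t u. f (u + t * sqrt 5) * h u * wave (- of_int p * u) * wave (?a * t))"
  have A_eq: "A p t * wave (- of_int q * t) = (LINT u|lborel. G t u)" for t
  proof -
    have A_shift: "A p t = (LINT u|lborel. F (?r t u) t * wave (- of_int p * (?r t u)))"
      unfolding A_def
      using lborel_integral_real_affine[of 1 "\<lambda>r. F r t * wave (- of_int p * r)" "- t * (1 - golden)"] by simp
    have "A p t * wave (- of_int q * t) = (LINT u|lborel. F (?r t u) t * wave (- of_int p * (?r t u)) * wave (- of_int q * t))"
      unfolding A_shift by (rule integral_mult_left_zero[symmetric])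
    also have "\<dots> = (LINT u|lborel. G t u)"
    proof (rule Bochner_Integration.integral_cong[OF refl])
      fix u
      have e: "?r t u + t * golden = u + t * sqrt 5"
        "?r t u + t * (1 - golden) = u"
        by (simp_all add: golden_def field_simps)
      have w: "wave (- of_int p * (?r t u)) * wave (- of_int q * t) =
        wave (- of_int p * u) * wave (?a * t)"
        unfolding wave_add[symmetric] by (simp add: algebra_simps)
      show "F (?r t u) t * wave (- of_int p * (?r t u)) * wave (- of_int q * t) = G t u"
        unfolding F_def e G_def mult.assoc w ..
    qed
    finally show ?thesis .
  qed
  have G_int: "integrable (lborel \<Otimes>\<^sub>M lborel) (\<lambda>(t, u). G t u)"
  proof -
    have "integrable (lborel :: (real \<times> real) measure) (\<lambda>x. indicator ({- (L + s)..L + s} \<times> {- s..s}) x *\<^sub>R (case x of (t, u) \<Rightarrow> G t u))"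
      unfolding G_def f_def h_def case_prod_beta
      by (rule borel_integrable_compact) (auto intro!: continuous_intros compact_Times)
    moreover have "indicator ({- (L + s)..L + s} \<times> {- s..s}) x *\<^sub>R (case x of (t, u) \<Rightarrow> G t u) = (case x of (t, u) \<Rightarrow> G t u)" for x
    proof -
      obtain t u where x: "x = (t, u)" by (cases x)
      have G0: "G t u = 0" if "\<not> (\<bar>t\<bar> \<le> L + s \<and> \<bar>u\<bar> \<le> s)"
      proof (cases "\<bar>u\<bar> \<le> s")
        case True
        with that have "\<bar>t\<bar> > L + s" by auto
        moreover have "\<bar>t\<bar> * 1 \<le> \<bar>t\<bar> * sqrt 5" by (intro mult_left_mono) auto
        moreover have "\<bar>t * sqrt 5\<bar> = \<bar>t\<bar> * sqrt 5" by (simp add: abs_mult)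
        ultimately have "L \<le> \<bar>u + t * sqrt 5\<bar>" using True by linarith
        then show ?thesis by (simp add: G_def f_def triangle_eq_0)
      qed (simp add: G_def h_def triangle_eq_0)
      show ?thesis
      proof (cases "x \<in> {- (L + s)..L + s} \<times> {- s..s}")
        case False
        then have "\<not> (\<bar>t\<bar> \<le> L + s \<and> \<bar>u\<bar> \<le> s)" by (simp add: x abs_le_iff) linarith
        then show ?thesis using G0 by (simp add: x)
      qed simp
    qed
    ultimately show ?thesis by (simp add: lborel_prod)
  qed
  have inner: "(LINT t|lborel. G t u) =
      h u * wave (- (of_int p + a) * u) * fejer L (a - \<beta>) / sqrt 5" for u
  proof -
    have "(LINT t|lborel. G t u) = h u * wave (- of_int p * u) * (LINT t|lborel. f (u + sqrt 5 * t) * wave (a * ((u + sqrt 5 * t) - u)))"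
      unfolding G_def a_def by (subst integral_mult_right_zero[symmetric])
        (auto intro!: Bochner_Integration.integral_cong simp: mult_ac)
    also have "(LINT t|lborel. f (u + sqrt 5 * t) * wave (a * ((u + sqrt 5 * t) - u))) =
       (LINT x|lborel. f x * wave (a * (x - u))) / sqrt 5"
      using lborel_integral_real_affine[of "sqrt 5" "\<lambda>x. f x * wave (a * (x - u))" u]
      by (simp add: scaleR_conv_of_real)
    also have "(LINT x|lborel. f x * wave (a * (x - u))) = wave (- a * u) * (LINT x|lborel. triangle L x * wave ((a - \<beta>) * x))"
    proof (subst integral_mult_right_zero[symmetric], rule Bochner_Integration.integral_cong[OF refl])
      fix x
      have "wave (- \<beta> * x) * wave (a * (x - u)) = wave (- a * u) * wave ((a - \<beta>) * x)"
        unfolding wave_add[symmetric] by (simp add: algebra_simps)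
      then show "f x * wave (a * (x - u)) = wave (- a * u) * (triangle L x * wave ((a - \<beta>) * x))"
        by (simp add: f_def mult_ac)
    qed
    also have "(LINT x|lborel. triangle L x * wave ((a - \<beta>) * x)) = fejer L (a - \<beta>)"
      by (rule integral_triangle_wave[OF L])
    also have "h u * wave (- of_int p * u) * (wave (- a * u) * fejer L (a - \<beta>) / sqrt 5) =
        h u * (wave (- of_int p * u) * wave (- a * u)) * fejer L (a - \<beta>) / sqrt 5" by simp
    also have "wave (- of_int p * u) * wave (- a * u) = wave (- (of_int p + a) * u)"
      unfolding wave_add[symmetric] by (simp add: algebra_simps)
    finally show ?thesis .
  qed
  have "(LINT t|lborel. A p t * wave (- of_int q * t)) = (LINT t|lborel. LINT u|lborel. G t u)"
    by (simp only: A_eq)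
  also have "\<dots> = (LINT u|lborel. LINT t|lborel. G t u)"
    by (rule lborel_pair.Fubini_integral[symmetric, OF G_int])
  also have "\<dots> = (LINT u|lborel. triangle s u * wave (- (of_int p + a) * u)) * (fejer L (a - \<beta>) / sqrt 5)"
    unfolding inner h_def by (subst integral_mult_left_zero[symmetric]) simp
  also have "(LINT u|lborel. triangle s u * wave (- (of_int p + a) * u)) = fejer s (- (of_int p + a))"
    by (rule integral_triangle_wave[OF s])
  also have "- (of_int p + a) = emb_star (q - p, p) / sqrt 5"
    by (simp add: a_def emb_star_def golden_def field_simps)
  also have "fejer L (a - \<beta>) = fejer L (- (a - \<beta>))" by (rule fejer_minus[symmetric])
  also have "- (a - \<beta>) = emb (q - p, p) / sqrt 5 + \<beta>"
    by (simp add: a_def emb_def field_simps)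
  finally show ?thesis by (simp add: mult_ac)
qed

definition dual_term :: "int \<times> int \<Rightarrow> complex" where
  "dual_term y = fejer L (emb y / sqrt 5 + \<beta>) * fejer s (emb_star y / sqrt 5) / sqrt 5"

lemma integrable_dual_term: "integrable counting dual_term"
proof -
  obtain C where C: "C \<ge> 0" "\<And>x. fejer L (x / sqrt 5 + \<beta>) \<le> C / (1 + x ^ 2)"
    using fejer_affine_le by blast
  obtain D where D: "D \<ge> 0" "\<And>x. fejer s (x / sqrt 5 + 0) \<le> D / (1 + x ^ 2)"
    using fejer_affine_le by blast
  show ?thesis
  proof (rule integrable_count_space_bound[OF integrable_lattice_decay])
    fix y
    have "norm (dual_term y) = fejer L (emb y / sqrt 5 + \<beta>) * fejer s (emb_star y / sqrt 5) / sqrt 5"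
      by (simp add: dual_term_def norm_mult norm_divide fejer_nonneg)
    also have "\<dots> \<le> fejer L (emb y / sqrt 5 + \<beta>) * fejer s (emb_star y / sqrt 5) / 1"
      by (intro divide_left_mono) (auto simp: fejer_nonneg)
    also have "\<dots> \<le> (C / (1 + emb y ^ 2)) * (D / (1 + emb_star y ^ 2))"
      unfolding div_by_1 using C(2)[of "emb y"] D(2)[of "emb_star y"] C(1)
      by (intro mult_mono fejer_nonneg) auto
    finally show "norm (dual_term y) \<le> (C * D) * lattice_decay y" by (simp add: lattice_decay_def)
  qed
qed

text \<open>The line formula is used in \<open>t\<close> for each frequency \<open>p\<close>, and in
  \<open>r\<close> for each integer \<open>t\<close>. Both yield limits of symmetric partial sums;
  absolute convergence of the dual side turns the iterated limit into one sum over the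
  lattice.\<close>

theorem lattice_Poisson_summation:
  "(LINT z|counting. triangle s (emb_star z) * triangle L (emb z) * wave (- \<beta> * emb z))
    = (LINT y|counting. dual_term y)"
proof -
  let ?S = "\<Sum>n\<in>{- int K..int K}. \<Sum>m\<in>{- int K..int K}. F (of_int m) (of_int n)"
  define g where "g = (\<lambda>(p, q). dual_term (q - p, p))"
  \<comment> \<open>A unimodular change of coordinates, which relabels frequencies by dual lattice
    points.\<close>
  have bij: "bij (\<lambda>(p, q). (q - p, p) :: int \<times> int)"
    by (rule bij_betw_byWitness[where f' = "\<lambda>(m, n). (n, m + n)"]) auto
  have g_comp: "g = (\<lambda>x. dual_term (case x of (p, q) \<Rightarrow> (q - p, p)))" by (auto simp: g_def)
  have g_int: "integrable counting g"
    unfolding g_comp using integrable_dual_term by (subst integrable_bij_count_space[OF bij]) auto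
  interpret P: pair_sigma_finite "count_space (UNIV :: int set)" "count_space (UNIV :: int set)"
    by (simp add: pair_sigma_finite_def sigma_finite_measure_count_space)
  have prod: "count_space UNIV \<Otimes>\<^sub>M count_space UNIV = (count_space UNIV :: (int \<times> int) measure)"
    by (subst pair_measure_countable) auto
  have g_int': "integrable (count_space UNIV \<Otimes>\<^sub>M count_space UNIV) (\<lambda>(p, q). g (p, q))"
    using g_int by (simp add: prod)
  have sec: "integrable counting (\<lambda>q. g (p, q))" for p
    using P.AE_integrable_fst[OF g_int'] by (simp add: AE_count_space)
  have A0: "A p t = 0" if "\<bar>t\<bar> > real K" for p t
    using F_support that by (simp add: A_def)
  have inner: "(\<Sum>n\<in>{- int K..int K}. A p (of_int n)) = (LINT q|counting. g (p, q))" for p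
  proof (rule LIMSEQ_unique)
    obtain C where "\<And>t t'. norm (A p t - A p t') \<le> C * \<bar>t - t'\<bar>" using A_lipschitz by blast
    then show "(\<lambda>N. \<Sum>q\<in>{- int N..int N}. LINT t|lborel. A p t * wave (- of_int q * t)) \<longlonglongrightarrow> (\<Sum>n\<in>{- int K..int K}. A p (of_int n))"
      by (intro Poisson_summation A0)
    show "(\<lambda>N. \<Sum>q\<in>{- int N..int N}. LINT t|lborel. A p t * wave (- of_int q * t)) \<longlonglongrightarrow> (LINT q|counting. g (p, q))"
      using sum_tendsto_integral_int[OF sec[of p]] unfolding A_transform g_def dual_term_def by simp
  qed
  obtain C where "\<And>r t r' t'. norm (F r t - F r' t') \<le> C * (\<bar>r - r'\<bar> + \<bar>t - t'\<bar>)"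
    using F_lipschitz by blast
  from this[of _ t _ t for t] have F_lip: "norm (F r t - F r' t) \<le> C * \<bar>r - r'\<bar>" for r r' t by simp
  have "(\<lambda>N. \<Sum>p\<in>{- int N..int N}. A p t) \<longlonglongrightarrow> (\<Sum>m\<in>{- int K..int K}. F (of_int m) t)" for t
    unfolding A_def by (rule Poisson_summation[OF _ F_lip]) (use F_support in auto)
  then have "(\<lambda>N. \<Sum>n\<in>{- int K..int K}. \<Sum>p\<in>{- int N..int N}. A p (of_int n)) \<longlonglongrightarrow>
     ?S"
    by (intro tendsto_sum) auto
  then have "(\<lambda>N. \<Sum>p\<in>{- int N..int N}. LINT q|counting. g (p, q)) \<longlonglongrightarrow>
     ?S"
    by (subst (asm) sum.swap) (simp add: inner)
  moreover have "(\<lambda>N. \<Sum>p\<in>{- int N..int N}. LINT q|counting. g (p, q)) \<longlonglongrightarrow>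
      (LINT p|counting. LINT q|counting. g (p, q))"
    by (intro sum_tendsto_integral_int P.integrable_fst g_int')
  ultimately have "?S =
      (LINT p|counting. LINT q|counting. g (p, q))" by (rule LIMSEQ_unique)
  also have "\<dots> = (LINT x|counting. g x)"
    using P.integral_fst[OF g_int'] by (simp add: prod)
  also have "\<dots> = (LINT y|counting. dual_term y)"
    unfolding g_comp by (rule integral_bij_count_space[OF bij])
  also have "?S =
      (\<Sum>z\<in>{- int K..int K} \<times> {- int K..int K}. F (of_int (fst z)) (of_int (snd z)))"
    by (subst sum.swap) (simp add: sum.cartesian_product case_prod_beta)
  also have "\<dots> = (LINT z|counting. F (of_int (fst z)) (of_int (snd z)))"
  proof -
    have sub: "{z. F (of_int (fst z)) (of_int (snd z)) \<noteq> 0} \<subseteq> {- int K..int K} \<times> {- int K..int K}"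
    proof
      fix z :: "int \<times> int" assume "z \<in> {z. F (of_int (fst z)) (of_int (snd z)) \<noteq> 0}"
      then have "\<bar>real_of_int (fst z)\<bar> \<le> real K" "\<bar>real_of_int (snd z)\<bar> \<le> real K"
        using F_support[of "of_int (fst z)" "of_int (snd z)"] by (auto simp: not_less[symmetric])
      then show "z \<in> {- int K..int K} \<times> {- int K..int K}" by (cases z) auto
    qed
    show ?thesis
      by (subst lebesgue_integral_count_space_finite_support)
         (use sub in \<open>auto intro: finite_subset intro!: sum.mono_neutral_right\<close>)
  qed
  finally show ?thesis
    unfolding F_def f_def h_def by (simp add: emb_def emb_star_def mult_ac)
qed

end

subsection \<open>The Fejer kernel\<close>

lemma integrable_inverse_square: "integrable lborel (\<lambda>x::real. 1 / (1 + x ^ 2))"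
  using integrable_inverse_1_plus_square by (simp add: set_integrable_def einterval_def inverse_eq_divide)

lemma integrable_inverse_square_bound:
  fixes f :: "real \<Rightarrow> 'b::{banach, second_countable_topology}"
  assumes "f \<in> borel_measurable borel" "\<And>x. norm (f x) \<le> C / (1 + x ^ 2)"
  shows "integrable lborel f"
proof (rule Bochner_Integration.integrable_bound)
  show "integrable lborel (\<lambda>x. C * (1 / (1 + x ^ 2)))"
    using integrable_inverse_square by (rule integrable_mult_right)
  show "AE x in lborel. norm (f x) \<le> norm (C * (1 / (1 + x ^ 2)))"
    using order_trans[OF assms(2) abs_ge_self] by (intro AE_I2) simp
qed (use assms in simp)

lemma integrable_fejer: "integrable lborel (fejer A)"
  by (rule integrable_inverse_square_bound[where C = "A ^ 2 + 1"])
     (use fejer_nonneg fejer_le in auto)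

text \<open>Poisson summation for \<open>triangle 1\<close> times a wave: the triangle vanishes at
  -1 and 1, so only the term \<open>m = 0\<close> is left.\<close>

lemma sum_fejer_tendsto_1:
  "(\<lambda>N. \<Sum>p\<in>{- int N..int N}. fejer 1 (\<beta> + of_int p)) \<longlonglongrightarrow> 1"
proof -
  define F where "F = (\<lambda>x. complex_of_real (triangle 1 x) * wave (- \<beta> * x))"
  have "(\<lambda>N. \<Sum>p\<in>{- int N..int N}. LINT x|lborel. F x * wave (- of_int p * x)) \<longlonglongrightarrow>
    (\<Sum>m\<in>{- int 1..int 1}. F (of_int m))"
    unfolding F_def by (rule Poisson_summation[OF _ triangle_wave_lipschitz]) (auto simp: triangle_eq_0)
  moreover have "(LINT x|lborel. F x * wave (- of_int p * x)) = fejer 1 (\<beta> + of_int p)" for p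
  proof -
    have "F x * wave (- of_int p * x) = triangle 1 x * wave (- (\<beta> + of_int p) * x)" for x
      by (simp add: F_def algebra_simps flip: wave_add)
    then show ?thesis
      using integral_triangle_wave[of 1 "- (\<beta> + of_int p)"] fejer_minus[of 1 "\<beta> + of_int p"] by simp
  qed
  moreover have "{- int 1..int 1} = {-1, 0, 1}" by auto
  ultimately have "(\<lambda>N. complex_of_real (\<Sum>p\<in>{- int N..int N}. fejer 1 (\<beta> + of_int p))) \<longlonglongrightarrow> of_real 1"
    by (simp add: F_def triangle_def)
  then show ?thesis by (subst (asm) tendsto_of_real_iff)
qed

text \<open>No Fourier inversion is needed: the periodisation of \<open>fejer 1\<close> is
  identically 1, and its integral over one period unfolds to the integral over the line.\<close>

lemma integral_fejer_1: "(LINT x|lborel. fejer 1 x) = 1"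
proof (rule LIMSEQ_unique)
  let ?i = "\<lambda>N x. indicator {- real N - 1/2..real N + 1/2} x *\<^sub>R fejer 1 x"
  let ?S = "\<lambda>N r. \<Sum>p\<in>{- int N..int N}. fejer 1 (r + of_int p)"
  have "incseq (\<lambda>N. ?S N r)" for r
    by (intro incseq_SucI sum_mono2) (auto simp: fejer_nonneg)
  then have le1: "?S N r \<le> 1" for N r
    using incseq_le sum_fejer_tendsto_1 by blast
  have "(\<lambda>N. LINT r|unit_lborel. ?S N r) \<longlonglongrightarrow> (LINT r|unit_lborel. 1)"
  proof (rule integral_dominated_convergence[where w = "\<lambda>_. 1"])
    show "AE r in unit_lborel. norm (?S N r) \<le> 1" for N
      using le1 by (intro AE_I2) (simp add: sum_nonneg fejer_nonneg)
  qed (auto intro!: sum_fejer_tendsto_1 AE_I2)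
  moreover have "(LINT r|unit_lborel. ?S N r)
      = (LINT x|lborel. ?i N x)" for N
  proof -
    have "(LINT r|unit_lborel. ?S N r) = (\<Sum>p\<in>{- int N..int N}. LINT r|unit_lborel. fejer 1 (r + of_int p))"
      using fejer_nonneg fejer_le_square[of 1]
      by (intro Bochner_Integration.integral_sum integrable_unit_lborel[where B = 1]) auto
    then show ?thesis by (simp only: sum_integral_unit_lborel_shift[OF integrable_fejer])
  qed
  ultimately show "(\<lambda>N. LINT x|lborel. ?i N x) \<longlonglongrightarrow> 1"
    by (simp add: unit_lborel.prob_space)
  show "(\<lambda>N. LINT x|lborel. ?i N x)
      \<longlonglongrightarrow> (LINT x|lborel. fejer 1 x)"
  proof (rule integral_dominated_convergence[where w = "fejer 1"])
    show "AE x in lborel. (\<lambda>N. ?i N x) \<longlonglongrightarrow> fejer 1 x"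
    proof (rule AE_I2)
      fix x :: real
      have "eventually (\<lambda>N. ?i N x = fejer 1 x) sequentially"
        using eventually_ge_at_top[of "nat \<lceil>\<bar>x\<bar>\<rceil>"]
      proof eventually_elim
        case (elim N)
        then have "\<bar>x\<bar> \<le> real N" by linarith
        then have "- real N - 1/2 \<le> x" "x \<le> real N + 1/2" by linarith+
        then show ?case by simp
      qed
      then show "(\<lambda>N. ?i N x) \<longlonglongrightarrow> fejer 1 x"
        by (rule tendsto_eventually)
    qed
  qed (auto intro!: integrable_fejer AE_I2 simp: indicator_def fejer_nonneg)
qed

lemma integral_fejer_shift:
  fixes g :: "real \<Rightarrow> 'b::{banach, second_countable_topology}"
  assumes "L > 0"
  shows "(LINT t|lborel. (fejer L (x - t) / L) *\<^sub>R g t)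
    = (LINT w|lborel. fejer 1 w *\<^sub>R g (x - w / L))"
proof -
  have "(LINT t|lborel. (fejer L (x - t) / L) *\<^sub>R g t)
     = \<bar>- 1 / L\<bar> *\<^sub>R (LINT w|lborel. (fejer L (x - (x + (- 1 / L) * w)) / L) *\<^sub>R g (x + (- 1 / L) * w))"
    using assms by (intro lborel_integral_real_affine) auto
  also have "\<dots> = (1 / L) *\<^sub>R (LINT w|lborel. L *\<^sub>R (fejer 1 w *\<^sub>R g (x - w / L)))"
    using assms by (simp add: fejer_scale power2_eq_square del: integral_scaleR_right)
  also have "\<dots> = (LINT w|lborel. fejer 1 w *\<^sub>R g (x - w / L))"
    using assms unfolding integral_scaleR_right by simp
  finally show ?thesis .
qed

subsection \<open>Schwartz functions\<close>

lemma schwartz_derivative: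
  assumes "schwartz g"
  obtains g' where "schwartz g'" "\<And>x. (g has_vector_derivative g' x) (at x)"
proof -
  obtain D where D: "D 0 = g" "\<And>n x. (D n has_vector_derivative D (Suc n) x) (at x)"
    "\<And>m n. bounded (range (\<lambda>x. x ^ m *\<^sub>R D n x))"
    using assms unfolding schwartz_def by blast
  have "schwartz (D 1)"
    unfolding schwartz_def using D by (intro exI[of _ "\<lambda>n. D (Suc n)"]) auto
  moreover have "(g has_vector_derivative D 1 x) (at x)" for x
    using D(2)[of 0 x] D(1) by simp
  ultimately show thesis using that by blast
qed

lemma schwartz_continuous: "schwartz g \<Longrightarrow> continuous_on UNIV g"
  by (metis schwartz_derivative has_vector_derivative_continuous continuous_at_imp_continuous_on)

lemma schwartz_measurable: "schwartz g \<Longrightarrow> g \<in> borel_measurable borel"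
  by (intro borel_measurable_continuous_onI schwartz_continuous)

text \<open>Two powers of \<open>1 + x ^ 2\<close> are kept because convolution estimates spend one
  on moving the decay from one variable to another and the other on integrability.\<close>

lemma schwartz_decay:
  assumes "schwartz g"
  obtains C where "C \<ge> 0" "\<And>x. norm (g x) \<le> C / (1 + x ^ 2) ^ 2"
proof -
  have bdd: "bounded (range (\<lambda>x. x ^ m *\<^sub>R g x))" for m
    using assms unfolding schwartz_def by metis
  obtain A where A: "\<And>x. norm (x ^ 0 *\<^sub>R g x) \<le> A"
    using bdd[of 0] unfolding bounded_iff by blast
  obtain B where B: "\<And>x. norm (x ^ 4 *\<^sub>R g x) \<le> B"
    using bdd[of 4] unfolding bounded_iff by blast
  have "norm (g x) \<le> 2 * (A + B) / (1 + x ^ 2) ^ 2" for x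
  proof -
    have "0 \<le> (1 - x ^ 2) ^ 2" by simp
    then have "(1 + x ^ 2) ^ 2 \<le> 2 * (1 + x ^ 4)"
      by (simp add: power2_eq_square power4_eq_xxxx algebra_simps)
    then have "(1 + x ^ 2) ^ 2 * norm (g x) \<le> 2 * (1 + x ^ 4) * norm (g x)"
      by (intro mult_right_mono) auto
    also have "\<dots> \<le> 2 * (A + B)" using A[of x] B[of x] by (simp add: algebra_simps)
    finally show ?thesis
      by (subst pos_le_divide_eq) (simp_all add: add_pos_nonneg mult.commute add_nonneg_eq_0_iff)
  qed
  moreover have "2 * (A + B) \<ge> 0"
    using order_trans[OF norm_ge_zero A[of 0]] order_trans[OF norm_ge_zero B[of 0]] by simp
  ultimately show thesis using that by blast
qed

lemma schwartz_decay':
  assumes "schwartz g"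
  obtains C where "C \<ge> 0" "\<And>x. norm (g x) \<le> C / (1 + x ^ 2)"
proof -
  obtain C where C: "C \<ge> 0" "\<And>x. norm (g x) \<le> C / (1 + x ^ 2) ^ 2"
    using schwartz_decay[OF assms] by blast
  have "C / (1 + x ^ 2) ^ 2 \<le> C / (1 + x ^ 2) ^ 1" for x :: real
    using C(1) by (intro divide_left_mono power_increasing mult_pos_pos zero_less_power) (auto simp: add_pos_nonneg)
  then have "norm (g x) \<le> C / (1 + x ^ 2)" for x
    using C(2)[of x] order_trans by fastforce
  with C(1) show thesis using that by blast
qed

lemma schwartz_integrable: "schwartz g \<Longrightarrow> integrable lborel g"
  by (metis schwartz_decay' schwartz_measurable integrable_inverse_square_bound)

lemma fourier_eq: "fourier g k = (LINT x|lborel. wave (- k * x) * g x)"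
  unfolding fourier_def fourier_kernel_eq_wave ..

lemma fourier_measurable:
  assumes [measurable]: "g \<in> borel_measurable borel"
  shows "fourier g \<in> borel_measurable borel"
  unfolding fourier_eq[abs_def] by measurable

lemma integrable_wave_mult:
  assumes "integrable lborel g"
  shows "integrable lborel (\<lambda>x. wave (c * x) * g x)"
proof -
  have [measurable]: "g \<in> borel_measurable borel" using borel_measurable_integrable[OF assms] by simp
  show ?thesis using assms by (rule Bochner_Integration.integrable_bound) (auto simp: norm_mult)
qed

lemma norm_fourier_le: "norm (fourier g k) \<le> (LINT x|lborel. norm (g x))"
  unfolding fourier_eq by (rule order_trans[OF integral_norm_bound]) (simp add: norm_mult)

lemma schwartz_tendsto_0:
  assumes "schwartz g" "filterlim (\<lambda>x::real. x ^ 2) at_top F"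
  shows "((\<lambda>x. wave (c * x) * g x) \<longlongrightarrow> 0) F"
proof -
  obtain C where C: "C \<ge> 0" "\<And>x. norm (g x) \<le> C / (1 + x ^ 2)"
    using schwartz_decay'[OF assms(1)] by blast
  have "filterlim (\<lambda>x::real. 1 + x ^ 2) at_top F"
    by (rule filterlim_tendsto_add_at_top[OF tendsto_const assms(2)])
  then have "((\<lambda>x. C / (1 + x ^ 2)) \<longlongrightarrow> 0) F"
    by (intro tendsto_divide_0[OF tendsto_const] filterlim_at_top_imp_at_infinity)
  then show ?thesis
    by (rule Lim_null_comparison[rotated]) (use C(2) in \<open>auto simp: norm_mult\<close>)
qed

text \<open>Integration by parts: \<open>f\<close> is the derivative of
  \<open>wave (- k * x) * g x\<close>, which vanishes at both ends of the line, so its integral is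
  0.\<close>

lemma fourier_derivative:
  assumes g: "schwartz g" and g': "schwartz g'" "\<And>x. (g has_vector_derivative g' x) (at x)"
  shows "fourier g' k = 2 * pi * \<i> * k * fourier g k"
proof -
  define c where "c = 2 * pi * \<i> * of_real (- k)"
  define f where "f = (\<lambda>x. wave (- k * x) * g' x + c * (wave (- k * x) * g x))"
  have int: "integrable lborel (\<lambda>x. wave (- k * x) * g' x)" "integrable lborel (\<lambda>x. c * (wave (- k * x) * g x))"
    by (intro integrable_wave_mult schwartz_integrable integrable_mult_right g g')+
  have "(LBINT x=-\<infinity>..\<infinity>. f x) = 0 - 0"
  proof (rule interval_integral_FTC_integrable)
    fix x :: real
    show "((\<lambda>x. wave (- k * x) * g x) has_vector_derivative f x) (at x)"
      using has_vector_derivative_mult[OF wave_has_vector_derivative[of "- k" x] g'(2)[of x]]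
      by (simp add: f_def c_def mult_ac)
    have "isCont g x" "isCont g' x"
      using schwartz_continuous g g'(1) by (auto simp: continuous_on_eq_continuous_at)
    moreover have "isCont (\<lambda>x. wave (- k * x)) x"
      using wave_has_vector_derivative has_vector_derivative_continuous by blast
    ultimately show "isCont f x" unfolding f_def by (intro continuous_intros)
  next
    show "set_integrable lborel (einterval (-\<infinity>) \<infinity>) f"
      using int by (simp add: set_integrable_def einterval_def f_def)
    have "filterlim (\<lambda>x::real. x ^ 2) at_top at_top" "filterlim (\<lambda>x::real. x ^ 2) at_top at_bot"
      by (rule filterlim_pow_at_top filterlim_pow_at_bot_even; simp add: filterlim_ident)+
    then show "(((\<lambda>x. wave (- k * x) * g x) \<circ> real_of_ereal) \<longlongrightarrow> 0) (at_right (-\<infinity>))"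
      "(((\<lambda>x. wave (- k * x) * g x) \<circ> real_of_ereal) \<longlongrightarrow> 0) (at_left \<infinity>)"
      unfolding ereal_tendsto_simps using schwartz_tendsto_0[OF g] by blast+
  qed simp
  then have "(LINT x|lborel. f x) = 0"
    by (simp add: interval_lebesgue_integral_def einterval_def set_lebesgue_integral_def)
  then have "fourier g' k + c * fourier g k = 0"
    using int by (simp add: f_def fourier_eq)
  then show ?thesis by (simp add: c_def add_eq_0_iff2)
qed

lemma fourier_decay:
  assumes g: "schwartz g"
  obtains C where "C \<ge> 0" "\<And>k. norm (fourier g k) \<le> C / (1 + k ^ 2)"
proof -
  obtain g' where g': "schwartz g'" "\<And>x. (g has_vector_derivative g' x) (at x)"
    using schwartz_derivative[OF g] by blast
  obtain g'' where g'': "schwartz g''" "\<And>x. (g' has_vector_derivative g'' x) (at x)"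
    using schwartz_derivative[OF g'(1)] by blast
  define C where "C = (LINT x|lborel. norm (g x)) + (LINT x|lborel. norm (g'' x))"
  have "norm (fourier g k) \<le> C / (1 + k ^ 2)" for k
  proof -
    have "fourier g'' k = (2 * pi * \<i> * k) ^ 2 * fourier g k"
      by (simp add: fourier_derivative[OF g g'] fourier_derivative[OF g'(1) g''] power2_eq_square)
    then have "norm (fourier g'' k) = (2 * pi) ^ 2 * (k ^ 2 * norm (fourier g k))"
      by (simp add: norm_mult norm_power power_mult_distrib)
    moreover have "1 \<le> (2 * pi) ^ 2" using pi_gt3 by (intro one_le_power) auto
    then have "1 * (k ^ 2 * norm (fourier g k)) \<le> (2 * pi) ^ 2 * (k ^ 2 * norm (fourier g k))"
      by (intro mult_right_mono) auto
    ultimately have "k ^ 2 * norm (fourier g k) \<le> norm (fourier g'' k)" by simp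
    then have "(1 + k ^ 2) * norm (fourier g k) \<le> C"
      using norm_fourier_le[of g k] norm_fourier_le[of g'' k] by (simp add: C_def algebra_simps)
    then show ?thesis by (simp add: field_simps add_pos_nonneg)
  qed
  moreover have "C \<ge> 0" by (simp add: C_def)
  ultimately show thesis using that by blast
qed

subsection \<open>Approximation by Fejer means\<close>

text \<open>The kernel \<open>fejer L / L\<close> is the transform of \<open>triangle L / L\<close>.
  Thus this mean of \<open>g\<close> is the counterpart of multiplying the transform of
  \<open>g\<close> by a cut-off that tends to 1 pointwise.\<close>

definition fejer_mean :: "(real \<Rightarrow> complex) \<Rightarrow> real \<Rightarrow> real \<Rightarrow> complex" where
  "fejer_mean g L x = (LINT t|lborel. (fejer L (x - t) / L) *\<^sub>R g t)"

text \<open>Peetre's inequality, used to carry decay across a convolution.\<close>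

lemma one_plus_square_shift_le:
  fixes x t :: real
  shows "1 + x ^ 2 \<le> 2 * ((1 + t ^ 2) * (1 + (x - t) ^ 2))"
proof -
  have "0 \<le> (x - 2 * t) ^ 2" "0 \<le> t ^ 2 * (x - t) ^ 2" by simp_all
  moreover have "2 * ((1 + t ^ 2) * (1 + (x - t) ^ 2)) - (1 + x ^ 2) = 1 + (x - 2 * t) ^ 2 + 2 * (t ^ 2 * (x - t) ^ 2)"
    by (simp add: power2_eq_square algebra_simps)
  ultimately show ?thesis by linarith
qed

lemma integrable_fejer_shift:
  "integrable lborel (\<lambda>t. fejer L (x - t) / L)"
  using lborel_integrable_real_affine[OF integrable_fejer, of "-1" L x] by simp

lemma mult_decay_le:
  fixes u x B :: real
  assumes "x \<le> B / u ^ 2" "u > 0"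
  shows "u * x \<le> B / u"
  using assms by (simp add: field_simps power2_eq_square)

text \<open>Uniformity in \<open>L\<close> is what dominated convergence requires. It holds because
  the kernel has mass 1, while \<open>(x - t) ^ 2\<close> times the kernel is at most
  \<open>1 / L\<close>, hence at most 1.\<close>

lemma fejer_mean_decay:
  assumes g: "schwartz g"
  obtains C where "C \<ge> 0" "\<And>L x. L \<ge> 1 \<Longrightarrow> norm (fejer_mean g L x) \<le> C / (1 + x ^ 2)"
proof -
  obtain B where B: "B \<ge> 0" "\<And>x. norm (g x) \<le> B / (1 + x ^ 2) ^ 2"
    using schwartz_decay[OF g] by blast
  note [measurable] = schwartz_measurable[OF g]
  define I where "I = (LINT t|lborel. 1 / (1 + t ^ 2 :: real))"
  have "norm (fejer_mean g L x) \<le> (2 * B + 2 * B * I) / (1 + x ^ 2)" if L: "L \<ge> 1" for L x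
  proof -
    define k where "k = (\<lambda>t. fejer L (x - t) / L)"
    have k: "k t \<ge> 0" for t using L by (simp add: k_def fejer_nonneg)
    have k1: "(1 + (x - t) ^ 2) * k t \<le> k t + 1" for t
    proof -
      have "((x - t) ^ 2 * fejer L (x - t)) / L \<le> 1"
        using square_times_fejer_le[of "x - t" L] L by (simp add: field_simps)
      then show ?thesis by (simp add: k_def algebra_simps)
    qed
    have int_k: "integrable lborel k" unfolding k_def by (rule integrable_fejer_shift)
    have bound: "norm (((1 + x ^ 2) * k t) *\<^sub>R g t) \<le> 2 * B * k t + 2 * B * (1 / (1 + t ^ 2))" for t
    proof -
      have p: "1 + t ^ 2 > 0" by (simp add: add_pos_nonneg)
      have q: "(1 + t ^ 2) * norm (g t) \<le> B / (1 + t ^ 2)"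
        using B(2)[of t] p by (rule mult_decay_le)
      have "norm (((1 + x ^ 2) * k t) *\<^sub>R g t) = (1 + x ^ 2) * k t * norm (g t)"
        using k[of t] by (simp add: abs_mult add_nonneg_nonneg)
      also have "\<dots> \<le> (2 * ((1 + t ^ 2) * (1 + (x - t) ^ 2))) * k t * norm (g t)"
        using one_plus_square_shift_le[of x t] k[of t] by (intro mult_right_mono) auto
      also have "\<dots> = 2 * ((1 + (x - t) ^ 2) * k t) * ((1 + t ^ 2) * norm (g t))" by simp
      also have "\<dots> \<le> 2 * (k t + 1) * (B / (1 + t ^ 2))"
        using k1[of t] q k[of t] p by (intro mult_mono) auto
      also have "\<dots> = 2 * k t * (B / (1 + t ^ 2)) + 2 * B * (1 / (1 + t ^ 2))" by (simp add: algebra_simps)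
      also have "B / (1 + t ^ 2) \<le> B / 1" using B(1) p by (intro divide_left_mono) auto
      then have "2 * k t * (B / (1 + t ^ 2)) \<le> 2 * k t * B" using k[of t] by (intro mult_left_mono) auto
      finally show ?thesis by (simp only: mult_ac)
    qed
    have "(LINT t|lborel. k t) = 1"
      using integral_fejer_shift[of L x "\<lambda>_. 1::real"] L integral_fejer_1
      by (simp add: k_def)
    moreover have "(1 + x ^ 2) * norm (fejer_mean g L x) = norm (LINT t|lborel. ((1 + x ^ 2) * k t) *\<^sub>R g t)"
    proof -
      have "(LINT t|lborel. ((1 + x ^ 2) * k t) *\<^sub>R g t) = (1 + x ^ 2) *\<^sub>R fejer_mean g L x"
        unfolding fejer_mean_def k_def scaleR_scaleR[symmetric] by (rule integral_scaleR_right)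
      then show ?thesis by (simp del: scaleR_add_left add: add_nonneg_nonneg)
    qed
    moreover have "norm (LINT t|lborel. ((1 + x ^ 2) * k t) *\<^sub>R g t) \<le> (LINT t|lborel. 2 * B * k t + 2 * B * (1 / (1 + t ^ 2)))"
    proof (rule Bochner_Integration.integral_norm_bound_integral)
      show int_w: "integrable lborel (\<lambda>t. 2 * B * k t + 2 * B * (1 / (1 + t ^ 2)))"
        using int_k integrable_inverse_square
        by (intro Bochner_Integration.integrable_add integrable_mult_right)
      show "integrable lborel (\<lambda>t. ((1 + x ^ 2) * k t) *\<^sub>R g t)"
        by (rule Bochner_Integration.integrable_bound[OF int_w])
           (use bound in \<open>auto simp: k_def intro!: AE_I2 intro: order_trans[OF _ abs_ge_self]\<close>)
    qed (rule bound)
    moreover have "(LINT t|lborel. 2 * B * k t + 2 * B * (1 / (1 + t ^ 2))) = 2 * B * (LINT t|lborel. k t) + 2 * B * I"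
      unfolding I_def using int_k integrable_inverse_square
      by (subst Bochner_Integration.integral_add) (simp_all only: integrable_mult_right integral_mult_right_zero)
    ultimately have "(1 + x ^ 2) * norm (fejer_mean g L x) \<le> 2 * B + 2 * B * I" by simp
    then show ?thesis by (subst pos_le_divide_eq) (simp_all add: add_pos_nonneg mult.commute)
  qed
  moreover have "2 * B + 2 * B * I \<ge> 0" using B(1) by (simp add: I_def)
  ultimately show thesis using that by blast
qed

lemma fejer_mean_tendsto:
  assumes g: "schwartz g"
  shows "(\<lambda>n. fejer_mean g (real (Suc n)) x) \<longlonglongrightarrow> g x"
proof -
  obtain B where B: "B \<ge> 0" "\<And>x. norm (g x) \<le> B / (1 + x ^ 2)"
    using schwartz_decay'[OF g] by blast
  have B': "norm (g x) \<le> B" for x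
  proof -
    have "B / (1 + x ^ 2) \<le> B / 1" using B(1) by (intro divide_left_mono) (auto simp: add_pos_nonneg)
    then show ?thesis using B(2)[of x] by simp
  qed
  note [measurable] = schwartz_measurable[OF g]
  have "(\<lambda>n. LINT w|lborel. fejer 1 w *\<^sub>R g (x - w / real (Suc n))) \<longlonglongrightarrow>
    (LINT w|lborel. fejer 1 w *\<^sub>R g x)"
  proof (rule integral_dominated_convergence[where w = "\<lambda>w. fejer 1 w * B"])
    show "AE w in lborel. (\<lambda>n. fejer 1 w *\<^sub>R g (x - w / real (Suc n))) \<longlonglongrightarrow> fejer 1 w *\<^sub>R g x"
    proof (rule AE_I2)
      fix w :: real
      have "(\<lambda>n. w / real (Suc n)) \<longlonglongrightarrow> 0"
        using LIMSEQ_Suc[OF lim_const_over_n[of w]] by simp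
      then have "(\<lambda>n. x - w / real (Suc n)) \<longlonglongrightarrow> x - 0" by (intro tendsto_intros)
      moreover have "isCont g x" using schwartz_continuous[OF g] by (simp add: continuous_on_eq_continuous_at)
      ultimately have "(\<lambda>n. g (x - w / real (Suc n))) \<longlonglongrightarrow> g x"
        using isCont_tendsto_compose by force
      then show "(\<lambda>n. fejer 1 w *\<^sub>R g (x - w / real (Suc n))) \<longlonglongrightarrow> fejer 1 w *\<^sub>R g x"
        by (intro tendsto_intros)
    qed
    show "AE w in lborel. norm (fejer 1 w *\<^sub>R g (x - w / real (Suc n))) \<le> fejer 1 w * B" for n
      using B' by (intro AE_I2) (auto simp: fejer_nonneg intro!: mult_left_mono)
  qed (auto intro!: integrable_mult_left integrable_fejer)
  moreover have "(LINT w|lborel. fejer 1 w *\<^sub>R g x) = g x"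
    using integral_fejer_1 integrable_fejer by simp
  ultimately show ?thesis
    unfolding fejer_mean_def by (subst integral_fejer_shift) auto
qed

subsection \<open>The Fourier transform of the autocorrelation\<close>

lemma integral_count_space_lborel_swap:
  fixes h :: "'i::countable \<Rightarrow> real \<Rightarrow> complex"
  assumes h [measurable]: "\<And>z. h z \<in> borel_measurable borel"
    and a: "integrable counting a" and b: "integrable lborel b"
    and bound: "\<And>z t. norm (h z t) \<le> a z * b t"
  shows "(LINT t|lborel. LINT z|counting. h z t) = (LINT z|counting. LINT t|lborel. h z t)"
proof -
  interpret P: pair_sigma_finite "count_space (UNIV :: 'i set)" "lborel :: real measure"
    by (simp add: pair_sigma_finite_def sigma_finite_measure_count_space sigma_finite_lborel)
  have int_h: "integrable lborel (h z)" for z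
  proof (rule Bochner_Integration.integrable_bound)
    show "integrable lborel (\<lambda>t. a z * b t)" using b by simp
  qed (use bound[of z] in \<open>auto intro!: AE_I2 intro: order_trans[OF _ abs_ge_self]\<close>)
  have "integrable (count_space UNIV \<Otimes>\<^sub>M lborel) (\<lambda>(z, t). h z t)"
  proof (rule P.Fubini_integrable)
    show "(\<lambda>(z, t). h z t) \<in> borel_measurable (count_space UNIV \<Otimes>\<^sub>M lborel)"
      by (rule measurable_pair_measure_countable1) auto
    show "integrable counting (\<lambda>z. LINT t|lborel. norm (case (z, t) of (z, t) \<Rightarrow> h z t))"
    proof (rule Bochner_Integration.integrable_bound)
      show "integrable counting (\<lambda>z. a z * (LINT t|lborel. b t))" using a by simp
      have "norm (LINT t|lborel. norm (h z t)) \<le> norm (a z * (LINT t|lborel. b t))" for z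
      proof -
        have "(LINT t|lborel. norm (h z t)) \<le> (LINT t|lborel. a z * b t)"
          using bound int_h b by (intro integral_mono integrable_norm integrable_mult_right) auto
        then show ?thesis by (simp add: abs_of_nonneg)
      qed
      then show "AE z in count_space UNIV. norm (LINT t|lborel. norm (case (z, t) of (z, t) \<Rightarrow> h z t))
          \<le> norm (a z * (LINT t|lborel. b t))" by simp
    qed simp
  qed (use int_h in simp)
  then show ?thesis by (rule P.Fubini_integral)
qed

lemma integrable_lattice_product:
  fixes f :: "int \<times> int \<Rightarrow> 'b::{banach, second_countable_topology}"
  assumes a: "\<And>z. 0 \<le> a z" "\<And>z. a z \<le> A / (1 + emb_star z ^ 2)" and f: "\<And>z. norm (f z) \<le> C / (1 + emb z ^ 2)"
  shows "integrable counting (\<lambda>z. a z *\<^sub>R f z)"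
proof (rule integrable_count_space_bound[OF integrable_lattice_decay])
  fix z
  have "a z * norm (f z) \<le> (A / (1 + emb_star z ^ 2)) * (C / (1 + emb z ^ 2))"
    using a order_trans[OF a] by (intro mult_mono f) auto
  then show "norm (a z *\<^sub>R f z) \<le> (A * C) * lattice_decay z"
    using a(1)[of z] by (simp add: lattice_decay_def mult_ac)
qed

lemma triangle_decay:
  assumes "A \<ge> 0"
  shows "triangle A u \<le> A * (1 + A ^ 2) / (1 + u ^ 2)"
proof (cases "A \<le> \<bar>u\<bar>")
  case True
  then show ?thesis using assms by (simp add: triangle_eq_0)
next
  case False
  then have "u ^ 2 \<le> A ^ 2" by (intro abs_le_square_iff[THEN iffD1]) auto
  then have "1 \<le> (1 + A ^ 2) / (1 + u ^ 2)" by (simp add: divide_simps add_pos_nonneg)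
  then have "A * 1 \<le> A * ((1 + A ^ 2) / (1 + u ^ 2))" using assms by (intro mult_left_mono)
  then show ?thesis using triangle_le[OF assms, of u] by simp
qed

lemma decay_div_sqrt5:
  fixes x C :: real
  assumes "C \<ge> 0"
  shows "C / (1 + (x / sqrt 5) ^ 2) \<le> 5 * C / (1 + x ^ 2)"
proof -
  have "(5 * C) / (5 + x ^ 2) \<le> (5 * C) / (1 + x ^ 2)" using assms by (intro divide_left_mono) (auto simp: add_pos_nonneg)
  moreover have "C / (1 + (x / sqrt 5) ^ 2) = (5 * C) / (5 + x ^ 2)" by (simp add: field_simps power_divide)
  ultimately show ?thesis by simp
qed

section \<open>Weights of the autocorrelation and of the diffraction\<close>

definition acf_weight :: "real \<Rightarrow> int \<times> int \<Rightarrow> real" where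
  "acf_weight s z = triangle s (emb_star z) / sqrt 5"

text \<open>The 5 combines the \<open>sqrt 5\<close> in \<open>acf_weight\<close> with the
  \<open>sqrt 5\<close> produced by Poisson summation over the lattice.\<close>

definition peak_weight :: "real \<Rightarrow> int \<times> int \<Rightarrow> real" where
  "peak_weight s y = fejer s (emb_star y / sqrt 5) / 5"

lemma acf_weight_nonneg: "0 \<le> acf_weight s z"
  and peak_weight_nonneg: "0 \<le> peak_weight s z"
  by (simp_all add: acf_weight_def peak_weight_def triangle_nonneg fejer_nonneg)

lemma acf_weight_decay:
  assumes "s > 0"
  shows "acf_weight s z \<le> s * (1 + s ^ 2) / (1 + emb_star z ^ 2)"
proof -
  have "triangle s (emb_star z) / sqrt 5 \<le> triangle s (emb_star z) / 1"
    by (intro divide_left_mono) (auto simp: triangle_nonneg)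
  then show ?thesis using triangle_decay[of s "emb_star z"] assms by (simp add: acf_weight_def)
qed

lemma peak_weight_decay:
  "peak_weight s z \<le> (s ^ 2 + 1) / (1 + emb_star z ^ 2)"
  using order_trans[OF fejer_le[of s "emb_star z / sqrt 5"] decay_div_sqrt5[of "s ^ 2 + 1" "emb_star z"]]
  by (simp add: peak_weight_def algebra_simps)

lemma integrable_peak_weight_scaleR:
  fixes f :: "real \<Rightarrow> 'b::{banach, second_countable_topology}"
  assumes "C \<ge> 0" "\<And>x. norm (f x) \<le> C / (1 + x ^ 2)"
  shows "integrable counting (\<lambda>y. peak_weight s y *\<^sub>R f (emb y / sqrt 5))"
  by (rule integrable_lattice_product[OF peak_weight_nonneg peak_weight_decay])
     (rule order_trans[OF assms(2) decay_div_sqrt5[OF assms(1)]])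

text \<open>Poisson summation over the lattice with phase parameter \<open>t\<close>, multiplied by
  \<open>g t\<close> and integrated over \<open>t\<close>. The waves assemble to the Fourier
  transform of \<open>g\<close>, the shifted kernels to its Fejer mean.\<close>

lemma fejer_identity:
  assumes g: "schwartz g" and L: "L > 0" and s: "s > 0"
  shows "(LINT z|counting. acf_weight s z *\<^sub>R ((triangle L (emb z) / L) *\<^sub>R fourier g (emb z)))
    = (LINT y|counting. peak_weight s y *\<^sub>R fejer_mean g L (emb y / sqrt 5))"
proof -
  let ?w = "acf_weight s" and ?v = "peak_weight s"
  let ?l = "\<lambda>z. triangle L (emb z) / L" and ?k = "\<lambda>y t. fejer L (emb y / sqrt 5 - t) / L"
  note [measurable] = schwartz_measurable[OF g]
  have poisson: "(LINT z|counting. triangle s (emb_star z) * triangle L (emb z) * wave (- t * emb z))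
     = (LINT y|counting. complex_of_real (fejer L (emb y / sqrt 5 - t) * fejer s (emb_star y / sqrt 5) / sqrt 5))" for t
  proof -
    interpret lattice_poisson L s "- t" using L s by unfold_locales
    \<comment> \<open>The instance with parameter \<open>- t\<close> carries the opposite wave;
      conjugation restores the sign and fixes the dual side, which is real.\<close>
    have "(LINT z|counting. triangle s (emb_star z) * triangle L (emb z) * wave (- t * emb z))
      = (LINT z|counting. cnj (triangle s (emb_star z) * triangle L (emb z) * wave (- (- t) * emb z)))"
      by (rule Bochner_Integration.integral_cong) (simp_all add: cnj_wave)
    also have "\<dots> = cnj (LINT z|counting. triangle s (emb_star z) * triangle L (emb z) * wave (- (- t) * emb z))"
      by (rule Bochner_Integration.integral_cnj)
    also have "\<dots> = cnj (LINT y|counting. dual_term y)"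
      by (simp only: lattice_Poisson_summation)
    also have "\<dots> = (LINT y|counting. cnj (dual_term y))"
      by (rule Bochner_Integration.integral_cnj[symmetric])
    also have "\<dots> = (LINT y|counting. complex_of_real (fejer L (emb y / sqrt 5 - t) * fejer s (emb_star y / sqrt 5) / sqrt 5))"
      by (rule Bochner_Integration.integral_cong) (simp_all add: dual_term_def)
    finally show ?thesis .
  qed
  have L_side: "(LINT t|lborel. LINT z|counting. (?w z * ?l z) *\<^sub>R (wave (- t * emb z) * g t))
     = (LINT z|counting. ?w z *\<^sub>R ((?l z) *\<^sub>R fourier g (emb z)))"
  proof (subst integral_count_space_lborel_swap[where a = "\<lambda>z. ?w z * ?l z" and b = "\<lambda>t. norm (g t)"])
    have "integrable counting (\<lambda>z. ?w z *\<^sub>R (?l z))"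
    proof (rule integrable_lattice_product[OF acf_weight_nonneg acf_weight_decay[OF s]])
      show "norm (?l z) \<le> (L * (1 + L ^ 2) / L) / (1 + emb z ^ 2)" for z
        using divide_right_mono[OF triangle_decay[of L "emb z"], of L] L triangle_nonneg[of L "emb z"]
        by (simp add: divide_divide_eq_left mult.commute)
    qed
    then show "integrable counting (\<lambda>z. ?w z * ?l z)" by simp
    show "integrable lborel (\<lambda>t. norm (g t))" using schwartz_integrable[OF g] by simp
    show "norm ((?w z * ?l z) *\<^sub>R (wave (- t * emb z) * g t))
        \<le> ?w z * ?l z * norm (g t)" for z t
      using L by (simp add: norm_mult acf_weight_nonneg triangle_nonneg)
    show "(LINT z|counting. LINT t|lborel. (?w z * ?l z) *\<^sub>R (wave (- t * emb z) * g t))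
      = (LINT z|counting. ?w z *\<^sub>R ((?l z) *\<^sub>R fourier g (emb z)))"
      by (simp add: fourier_eq mult.commute)
  qed measurable
  have R_side: "(LINT t|lborel. LINT y|counting. (?v y * (?k y t)) *\<^sub>R g t)
     = (LINT y|counting. ?v y *\<^sub>R fejer_mean g L (emb y / sqrt 5))"
  \<comment> \<open>The kernel depends on the difference of the two variables. Peetre's inequality
    splits it into decay in \<open>emb y\<close> and growth \<open>1 + t ^ 2\<close>, and the latter
    is absorbed by \<open>g\<close>.\<close>
  proof (subst integral_count_space_lborel_swap[where a = "\<lambda>y. ?v y *\<^sub>R (2 * ((L ^ 2 + 1) / L) / (1 + (emb y / sqrt 5) ^ 2))"
        and b = "\<lambda>t. (1 + t ^ 2) * norm (g t)"])
    show "integrable counting (\<lambda>y. ?v y *\<^sub>R (2 * ((L ^ 2 + 1) / L) / (1 + (emb y / sqrt 5) ^ 2)))"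
    proof (rule integrable_lattice_product[OF peak_weight_nonneg peak_weight_decay])
      show "norm (2 * ((L ^ 2 + 1) / L) / (1 + (emb z / sqrt 5) ^ 2)) \<le> 5 * (2 * ((L ^ 2 + 1) / L)) / (1 + emb z ^ 2)" for z
        using decay_div_sqrt5[of "2 * ((L ^ 2 + 1) / L)" "emb z"] L by simp
    qed
    obtain B where B: "B \<ge> 0" "\<And>x. norm (g x) \<le> B / (1 + x ^ 2) ^ 2"
      using schwartz_decay[OF g] by blast
    show "integrable lborel (\<lambda>t. (1 + t ^ 2) * norm (g t))"
    proof (rule integrable_inverse_square_bound)
      show "norm ((1 + t ^ 2) * norm (g t)) \<le> B / (1 + t ^ 2)" for t
      proof -
        have "1 + t ^ 2 > 0" by (simp add: add_pos_nonneg)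
        then show ?thesis using mult_decay_le[OF B(2)[of t]] by simp
      qed
    qed measurable
    show "norm ((?v y * (?k y t)) *\<^sub>R g t)
       \<le> ?v y *\<^sub>R (2 * ((L ^ 2 + 1) / L) / (1 + (emb y / sqrt 5) ^ 2)) * ((1 + t ^ 2) * norm (g t))" for y t
    proof -
      define x where "x = emb y / sqrt 5"
      have p: "1 + x ^ 2 > 0" "1 + (x - t) ^ 2 > 0" "L ^ 2 + 1 > 0" by (auto simp: add_pos_nonneg add_nonneg_pos)
      have "1 / (1 + (x - t) ^ 2) \<le> 2 * (1 + t ^ 2) / (1 + x ^ 2)"
        using one_plus_square_shift_le[of x t] p by (simp add: field_simps)
      then have "(L ^ 2 + 1) * (1 / (1 + (x - t) ^ 2)) \<le> (L ^ 2 + 1) * (2 * (1 + t ^ 2) / (1 + x ^ 2))"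
        using p by (intro mult_left_mono) auto
      then have "fejer L (x - t) \<le> (L ^ 2 + 1) * (2 * (1 + t ^ 2) / (1 + x ^ 2))"
        using fejer_le[of L "x - t"] by simp
      then have "fejer L (x - t) / L \<le> (L ^ 2 + 1) * (2 * (1 + t ^ 2) / (1 + x ^ 2)) / L"
        using L by (intro divide_right_mono) auto
      then have "?v y * (fejer L (x - t) / L) * norm (g t) \<le>
        ?v y * ((L ^ 2 + 1) * (2 * (1 + t ^ 2) / (1 + x ^ 2)) / L) * norm (g t)"
        by (intro mult_right_mono mult_left_mono peak_weight_nonneg) auto
      then show ?thesis
        using L by (simp add: x_def[symmetric] norm_mult abs_mult peak_weight_nonneg fejer_nonneg algebra_simps)
    qed
    show "(LINT y|counting. LINT t|lborel. (?v y * (?k y t)) *\<^sub>R g t)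
      = (LINT y|counting. ?v y *\<^sub>R fejer_mean g L (emb y / sqrt 5))"
      unfolding fejer_mean_def scaleR_scaleR[symmetric] by (simp only: integral_scaleR_right)
  qed measurable
  have "(LINT z|counting. (?w z * ?l z) *\<^sub>R (wave (- t * emb z) * g t))
     = (LINT y|counting. (?v y * (?k y t)) *\<^sub>R g t)" for t
  proof -
    define c where "c = of_real (1 / (sqrt 5 * L)) * g t"
    have "(LINT z|counting. (?w z * ?l z) *\<^sub>R (wave (- t * emb z) * g t))
      = (LINT z|counting. triangle s (emb_star z) * triangle L (emb z) * wave (- t * emb z)) * c"
      unfolding integral_mult_left_zero[symmetric]
      by (rule Bochner_Integration.integral_cong) (auto simp: acf_weight_def c_def scaleR_conv_of_real)
    also have "\<dots> = (LINT y|counting. complex_of_real (fejer L (emb y / sqrt 5 - t) * fejer s (emb_star y / sqrt 5) / sqrt 5)) * c"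
      by (simp only: poisson)
    also have "\<dots> = (LINT y|counting. (?v y * (?k y t)) *\<^sub>R g t)"
    proof -
      have "sqrt 5 * (sqrt 5 * L) = 5 * L" using real_sqrt_mult_self[of 5] by (metis abs_numeral mult.assoc)
      then have "u * v / sqrt 5 * (1 / (sqrt 5 * L)) = v / 5 * (u / L)" for u v :: real
        by (simp only: times_divide_times_eq divide_divide_eq_left) (simp add: mult.commute)
      then have "complex_of_real (u * v / sqrt 5) * c = (v / 5 * (u / L)) *\<^sub>R g t" for u v :: real
        unfolding c_def mult.assoc[symmetric] of_real_mult[symmetric] scaleR_conv_of_real by metis
      then show ?thesis
        unfolding integral_mult_left_zero[symmetric] peak_weight_def by (simp only:)
    qed
    finally show ?thesis .
  qed
  then show ?thesis using L_side R_side by simp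
qed

text \<open>Limit of \<open>fejer_identity\<close> along \<open>L = Suc n\<close>. Dominated
  convergence rests on the uniform decay of the Fejer means on one side, and on a cut-off factor
  between 0 and 1 on the other.\<close>

theorem diffraction_formula:
  assumes g: "schwartz g" and s: "s > 0"
  shows "integrable counting (\<lambda>y. peak_weight s y *\<^sub>R g (emb y / sqrt 5))"
    and "integrable counting (\<lambda>z. acf_weight s z *\<^sub>R fourier g (emb z))"
    and "(LINT y|counting. peak_weight s y *\<^sub>R g (emb y / sqrt 5)) =
      (LINT z|counting. acf_weight s z *\<^sub>R fourier g (emb z))"
proof -
  let ?w = "acf_weight s" and ?v = "peak_weight s" and ?t = "\<lambda>n z. triangle (real (Suc n)) (emb z) / real (Suc n)"
  obtain B where B: "B \<ge> 0" "\<And>x. norm (g x) \<le> B / (1 + x ^ 2)"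
    using schwartz_decay'[OF g] by blast
  then show 1: "integrable counting (\<lambda>y. ?v y *\<^sub>R g (emb y / sqrt 5))"
    by (rule integrable_peak_weight_scaleR)
  obtain C where C: "C \<ge> 0" "\<And>x. norm (fourier g x) \<le> C / (1 + x ^ 2)"
    using fourier_decay[OF g] by blast
  show 2: "integrable counting (\<lambda>z. ?w z *\<^sub>R fourier g (emb z))"
    by (rule integrable_lattice_product[OF acf_weight_nonneg acf_weight_decay[OF s] C(2)])
  obtain D where D: "D \<ge> 0" "\<And>L x. L \<ge> 1 \<Longrightarrow> norm (fejer_mean g L x) \<le> D / (1 + x ^ 2)"
    using fejer_mean_decay[OF g] by blast
  have lim1: "(\<lambda>n. LINT y|counting. ?v y *\<^sub>R fejer_mean g (real (Suc n)) (emb y / sqrt 5))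
     \<longlonglongrightarrow> (LINT y|counting. ?v y *\<^sub>R g (emb y / sqrt 5))"
  proof (rule integral_dominated_convergence)
    show "integrable counting (\<lambda>y. ?v y *\<^sub>R (D / (1 + (emb y / sqrt 5) ^ 2)))"
      using D(1) by (intro integrable_peak_weight_scaleR[where C = D and f = "\<lambda>x. D / (1 + x ^ 2)"]) auto
    show "AE y in count_space UNIV. norm (?v y *\<^sub>R fejer_mean g (real (Suc n)) (emb y / sqrt 5))
       \<le> ?v y *\<^sub>R (D / (1 + (emb y / sqrt 5) ^ 2))" for n
      using mult_left_mono[OF D(2) peak_weight_nonneg, of "real (Suc n)"]
      by (intro AE_I2) (simp add: peak_weight_nonneg del: of_nat_Suc)
  qed (auto intro!: tendsto_intros fejer_mean_tendsto g simp del: of_nat_Suc)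
  have lim2: "(\<lambda>n. LINT z|counting. ?w z *\<^sub>R (?t n z *\<^sub>R fourier g (emb z)))
     \<longlonglongrightarrow> (LINT z|counting. ?w z *\<^sub>R fourier g (emb z))"
  proof (rule integral_dominated_convergence)
    show "integrable counting (\<lambda>z. norm (?w z *\<^sub>R fourier g (emb z)))" using 2 by (rule integrable_norm)
    show "AE z in count_space UNIV. norm (?w z *\<^sub>R (?t n z *\<^sub>R fourier g (emb z)))
      \<le> norm (?w z *\<^sub>R fourier g (emb z))" for n
    proof (rule AE_I2)
      fix z
      have "\<bar>?t n z\<bar> \<le> 1"
        using triangle_le[of "real (Suc n)" "emb z"] triangle_nonneg[of "real (Suc n)" "emb z"] by (simp del: of_nat_Suc)
      then have "\<bar>?t n z\<bar> * norm (fourier g (emb z)) \<le> 1 * norm (fourier g (emb z))"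
        by (intro mult_right_mono) auto
      then show "norm (?w z *\<^sub>R (?t n z *\<^sub>R fourier g (emb z)))
         \<le> norm (?w z *\<^sub>R fourier g (emb z))"
        unfolding norm_scaleR by (intro mult_left_mono) auto
    qed
    show "AE z in count_space UNIV. (\<lambda>n. ?w z *\<^sub>R (?t n z *\<^sub>R fourier g (emb z)))
       \<longlonglongrightarrow> ?w z *\<^sub>R fourier g (emb z)"
    proof (rule AE_I2)
      fix z
      have "(\<lambda>n. 1 - \<bar>emb z\<bar> / real (Suc n)) \<longlonglongrightarrow> 1 - 0"
        using LIMSEQ_Suc[OF lim_const_over_n[of "\<bar>emb z\<bar>"]] by (intro tendsto_intros) simp
      moreover have "eventually (\<lambda>n. ?t n z = 1 - \<bar>emb z\<bar> / real (Suc n)) sequentially"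
        using eventually_ge_at_top[of "nat \<lceil>\<bar>emb z\<bar>\<rceil>"]
      proof eventually_elim
        case (elim n)
        then have "\<bar>emb z\<bar> \<le> real (Suc n)" by linarith
        then show ?case by (simp add: triangle_def field_simps)
      qed
      ultimately have "(\<lambda>n. ?t n z) \<longlonglongrightarrow> 1"
        by (simp add: tendsto_cong)
      from tendsto_scaleR[OF tendsto_const tendsto_scaleR[OF this tendsto_const]]
      show "(\<lambda>n. ?w z *\<^sub>R (?t n z *\<^sub>R fourier g (emb z)))
        \<longlonglongrightarrow> ?w z *\<^sub>R fourier g (emb z)" by fastforce
    qed
  qed simp_all
  show "(LINT y|counting. ?v y *\<^sub>R g (emb y / sqrt 5)) =
      (LINT z|counting. ?w z *\<^sub>R fourier g (emb z))"
    by (rule LIMSEQ_unique[OF lim1]) (use lim2 in \<open>simp only: fejer_identity[OF g _ s] of_nat_0_less_iff zero_less_Suc\<close>)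
qed

definition model_autocorrelation :: "real \<Rightarrow> real measure" where
  "model_autocorrelation s = weighted_atoms emb (acf_weight s)"

definition model_diffraction :: "real \<Rightarrow> real measure" where
  "model_diffraction s = weighted_atoms (\<lambda>y. emb y / sqrt 5) (peak_weight s)"

lemma is_fourier_measure_model_diffraction:
  assumes s: "s > 0"
  shows "is_fourier_measure (model_autocorrelation s) (model_diffraction s)"
  unfolding is_fourier_measure_def
proof (intro conjI allI impI)
  show "locally_finite_borel (model_diffraction s)"
    unfolding model_diffraction_def
    by (rule locally_finite_weighted_atoms[OF _ peak_weight_nonneg peak_weight_decay]) simp
  fix g assume g: "schwartz g"
  note mg = schwartz_measurable[OF g] and mf = fourier_measurable[OF schwartz_measurable[OF g]]
  show "integrable (model_diffraction s) g"
    unfolding model_diffraction_def integrable_weighted_atoms_iff[OF mg peak_weight_nonneg]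
    by (rule diffraction_formula(1)[OF g s])
  show "integrable (model_autocorrelation s) (fourier g)"
    unfolding model_autocorrelation_def integrable_weighted_atoms_iff[OF mf acf_weight_nonneg]
    by (rule diffraction_formula(2)[OF g s])
  show "(LINT k|model_diffraction s. g k) = (LINT x|model_autocorrelation s. fourier g x)"
    unfolding model_diffraction_def model_autocorrelation_def
      integral_weighted_atoms[OF mg peak_weight_nonneg] integral_weighted_atoms[OF mf acf_weight_nonneg]
    by (rule diffraction_formula(3)[OF g s])
qed

subsection \<open>Uniqueness of the Fourier transform as a measure\<close>

text \<open>A polynomial factor is carried along so that the family is closed under differentiation
  and under multiplication by monomials; the test functions of interest are those with
  \<open>p = 1\<close>.\<close>

definition gauss_wave :: "real \<Rightarrow> complex poly \<Rightarrow> real \<Rightarrow> complex" where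
  "gauss_wave t p x = poly p (of_real x) * exp (- (of_real x ^ 2) + \<i> * of_real t * of_real x)"

lemma power_times_gauss_bounded: "\<exists>B. \<forall>x::real. \<bar>x\<bar> ^ k * exp (- (x ^ 2)) \<le> B"
proof (cases "k = 0")
  case True
  then show ?thesis by (intro exI[of _ 1]) simp
next
  case False
  have "\<bar>x\<bar> ^ k * exp (- (x ^ 2)) \<le> 1 + real k ^ k" for x :: real
  proof -
    \<comment> \<open>The bound \<open>u \<le> exp u\<close> at \<open>u = x ^ 2 / k\<close>, raised
      to the power \<open>k\<close>; hence the constant \<open>k ^ k\<close>.\<close>
    have "x ^ 2 / real k \<le> exp (x ^ 2 / real k)" using exp_ge_add_one_self[of "x ^ 2 / real k"] by linarith
    then have "(x ^ 2 / real k) ^ k \<le> exp (x ^ 2 / real k) ^ k" by (intro power_mono) auto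
    also have "\<dots> = exp (x ^ 2)" using False by (simp add: exp_of_nat_mult[symmetric])
    finally have 1: "(x ^ 2) ^ k \<le> real k ^ k * exp (x ^ 2)"
      using False by (simp add: power_divide field_simps)
    have "\<bar>x\<bar> ^ k \<le> 1 + (x ^ 2) ^ k"
    proof (cases "\<bar>x\<bar> \<le> 1")
      case True
      then have "\<bar>x\<bar> ^ k \<le> 1" by (simp add: power_le_one)
      moreover have "0 \<le> (x ^ 2) ^ k" by simp
      ultimately show ?thesis by linarith
    next
      case False
      then have "\<bar>x\<bar> ^ k \<le> \<bar>x\<bar> ^ (2 * k)" by (intro power_increasing) auto
      then show ?thesis by (simp add: power_mult)
    qed
    also have "1 + (x ^ 2) ^ k \<le> exp (x ^ 2) + real k ^ k * exp (x ^ 2)"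
      using 1 one_le_exp_iff[of "x ^ 2"] by (simp del: one_le_exp_iff)
    finally have "\<bar>x\<bar> ^ k * exp (- (x ^ 2)) \<le> ((1 + real k ^ k) * exp (x ^ 2)) * exp (- (x ^ 2))"
      by (intro mult_right_mono) (auto simp: algebra_simps)
    then show ?thesis by (simp add: exp_minus field_simps)
  qed
  then show ?thesis by blast
qed

lemma norm_gauss_wave: "norm (gauss_wave t p x) = norm (poly p (of_real x)) * exp (- (x ^ 2))"
  by (simp add: gauss_wave_def norm_mult)

lemma bounded_gauss_wave: "bounded (range (gauss_wave t p))"
proof -
  obtain B where B: "\<bar>x\<bar> ^ k * exp (- (x ^ 2)) \<le> B k" for k and x :: real
    using power_times_gauss_bounded by metis
  have "norm (gauss_wave t p x) \<le> (\<Sum>i\<le>degree p. norm (coeff p i) * B i)" for x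
  proof -
    have "norm (poly p (of_real x)) \<le> (\<Sum>i\<le>degree p. norm (coeff p i) * \<bar>x\<bar> ^ i)"
      unfolding poly_altdef by (rule order_trans[OF norm_sum]) (simp add: norm_mult norm_power)
    then have "norm (gauss_wave t p x) \<le> (\<Sum>i\<le>degree p. norm (coeff p i) * \<bar>x\<bar> ^ i) * exp (- (x ^ 2))"
      unfolding norm_gauss_wave by (intro mult_right_mono) auto
    also have "\<dots> = (\<Sum>i\<le>degree p. norm (coeff p i) * (\<bar>x\<bar> ^ i * exp (- (x ^ 2))))"
      by (simp add: sum_distrib_right mult.assoc)
    also have "\<dots> \<le> (\<Sum>i\<le>degree p. norm (coeff p i) * B i)"
      by (intro sum_mono mult_left_mono B) auto
    finally show ?thesis .
  qed
  then show ?thesis unfolding bounded_iff by blast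
qed

lemma gauss_wave_has_vector_derivative:
  "(gauss_wave t p has_vector_derivative gauss_wave t (pderiv p + p * [:\<i> * of_real t, -2:]) x) (at x)"
proof -
  have "((\<lambda>x. poly p (of_real x) * exp (- (of_real x ^ 2) + \<i> * of_real t * of_real x)) has_vector_derivative
      (poly p (of_real x) * (exp (- (of_real x ^ 2) + \<i> * of_real t * of_real x) * (- (2 * of_real x) + \<i> * of_real t))
        + poly (pderiv p) (of_real x) * exp (- (of_real x ^ 2) + \<i> * of_real t * of_real x))) (at x)"
    by (rule has_vector_derivative_real_field[where f = "\<lambda>z. poly p z * exp (- (z ^ 2) + \<i> * of_real t * z)"])
       (auto intro!: derivative_eq_intros)
  then show ?thesis unfolding gauss_wave_def[abs_def] by (simp add: algebra_simps)
qed

lemma schwartz_gauss_wave: "schwartz (gauss_wave t 1)"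
proof -
  define P where "P = (\<lambda>n. ((\<lambda>p. pderiv p + p * [:\<i> * of_real t, -2:]) ^^ n) 1)"
  have "(gauss_wave t (P n) has_vector_derivative gauss_wave t (P (Suc n)) x) (at x)" for n x
    unfolding P_def using gauss_wave_has_vector_derivative by simp
  moreover have "bounded (range (\<lambda>x. x ^ m *\<^sub>R gauss_wave t (P n) x))" for m n
  proof -
    have "(\<lambda>x. x ^ m *\<^sub>R gauss_wave t (P n) x) = gauss_wave t (monom 1 m * P n)"
      by (simp add: gauss_wave_def fun_eq_iff poly_monom scaleR_conv_of_real)
    then show ?thesis by (simp only: bounded_gauss_wave)
  qed
  moreover have "gauss_wave t (P 0) = gauss_wave t 1" by (simp add: P_def)
  ultimately show ?thesis
    unfolding schwartz_def by (intro exI[of _ "\<lambda>n. gauss_wave t (P n)"]) auto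
qed

lemma gauss_wave_1: "gauss_wave t 1 x = exp (- (x ^ 2)) *\<^sub>R iexp (t * x)"
proof -
  have "exp (- (complex_of_real x ^ 2)) = of_real (exp (- (x ^ 2)))" by (simp flip: exp_of_real)
  then show ?thesis unfolding gauss_wave_def exp_add by (simp add: scaleR_conv_of_real mult_ac)
qed

lemma
  assumes int: "integrable M (gauss_wave 0 1)" and mass: "(LINT x|M. gauss_wave 0 1 x) = complex_of_real m"
  shows integrable_gauss: "integrable M (\<lambda>x. exp (- (x ^ 2)))"
    and integral_gauss: "(LINT x|M. exp (- (x ^ 2))) = m"
proof -
  have eq: "gauss_wave 0 1 x = of_real (exp (- (x ^ 2)))" for x
    by (simp add: gauss_wave_1 scaleR_conv_of_real)
  show "integrable M (\<lambda>x. exp (- (x ^ 2)))"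
    using int unfolding eq[abs_def] by (subst (asm) complex_of_real_integrable_eq)
  have "complex_of_real (LINT x|M. exp (- (x ^ 2))) = of_real m"
    using mass unfolding eq integral_complex_of_real .
  then show "(LINT x|M. exp (- (x ^ 2))) = m" by (simp only: of_real_eq_iff)
qed

text \<open>The Gaussian weight makes a tempered measure finite; after division by the mass
  \<open>m\<close>, its characteristic function is a pairing with Schwartz functions and hence known
  from the Fourier identity.\<close>

lemma char_density_gauss:
  fixes \<mu> :: "real measure"
  assumes [measurable_cong]: "sets \<mu> = sets borel" and m: "m > 0"
    and int: "integrable \<mu> (gauss_wave 0 1)" and mass: "(LINT x|\<mu>. gauss_wave 0 1 x) = complex_of_real m"
  shows "real_distribution (density \<mu> (\<lambda>x. ennreal (exp (- (x ^ 2)) / m)))"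
    and "char (density \<mu> (\<lambda>x. ennreal (exp (- (x ^ 2)) / m))) t = (LINT x|\<mu>. gauss_wave t 1 x) / m"
proof -
  let ?D = "density \<mu> (\<lambda>x. ennreal (exp (- (x ^ 2)) / m))"
  note int' = integrable_gauss[OF int mass] and mass' = integral_gauss[OF int mass]
  have "(\<integral>\<^sup>+x. ennreal (exp (- (x ^ 2)) / m) \<partial>\<mu>) = ennreal (LINT x|\<mu>. exp (- (x ^ 2)) / m)"
    using int' m by (intro nn_integral_eq_integral) auto
  also have "\<dots> = 1" using mass' m by simp
  finally have "emeasure (?D) (space \<mu>) = 1"
    by (subst emeasure_density) (simp_all cong: nn_integral_cong)
  then have "prob_space (?D)"
    by (intro prob_spaceI) simp
  then show "real_distribution (?D)"
    using assms(1) by (simp add: real_distribution_def real_distribution_axioms_def)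
  have "char (?D) t
     = (LINT x|\<mu>. (exp (- (x ^ 2)) / m) *\<^sub>R iexp (t * x))"
    unfolding char_def using m by (subst integral_density) auto
  also have "\<dots> = (LINT x|\<mu>. gauss_wave t 1 x / m)"
    by (rule Bochner_Integration.integral_cong) (simp_all add: gauss_wave_1 scaleR_conv_of_real)
  finally show "char (?D) t = (LINT x|\<mu>. gauss_wave t 1 x) / m" by simp
qed

text \<open>Levy's uniqueness theorem identifies the two Gaussian-weighted measures. The Gaussian
  never vanishes, so multiplying by the reciprocal density recovers the measures themselves.\<close>

lemma is_fourier_measure_unique:
  assumes \<mu>: "is_fourier_measure \<gamma> \<mu>" and \<nu>: "is_fourier_measure \<gamma> \<nu>"
  shows "\<mu> = \<nu>"
proof -
  have sets [measurable_cong]: "sets \<mu> = sets borel" "sets \<nu> = sets borel"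
    using \<mu> \<nu> by (auto simp: is_fourier_measure_def locally_finite_borel_def)
  have int: "integrable \<mu> (gauss_wave t 1)" "integrable \<nu> (gauss_wave t 1)"
    and eq: "(LINT x|\<mu>. gauss_wave t 1 x) = (LINT x|\<nu>. gauss_wave t 1 x)" for t
    using \<mu> \<nu> schwartz_gauss_wave[of t] by (auto simp: is_fourier_measure_def)
  define m where "m = (LINT x|\<mu>. exp (- (x ^ 2)))"
  have m\<mu>: "(LINT x|\<mu>. gauss_wave 0 1 x) = of_real m"
    unfolding m_def integral_complex_of_real[symmetric] by (simp add: gauss_wave_1 scaleR_conv_of_real)
  then have m\<nu>: "(LINT x|\<nu>. gauss_wave 0 1 x) = of_real m" using eq by simp
  show ?thesis
  proof (cases "m > 0")
    case True
    let ?d = "\<lambda>x::real. ennreal (exp (- (x ^ 2)) / m)"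
    have "density \<mu> ?d = density \<nu> ?d"
    proof (rule Levy_uniqueness)
      show "char (density \<mu> ?d) = char (density \<nu> ?d)"
        using char_density_gauss(2)[OF sets(1) True int(1) m\<mu>] char_density_gauss(2)[OF sets(2) True int(2) m\<nu>] eq
        by (intro ext) simp
    qed (use char_density_gauss(1) sets True int m\<mu> m\<nu> in auto)
    then have *: "density (density \<mu> ?d) (\<lambda>x. ennreal (m / exp (- (x ^ 2)))) = density (density \<nu> ?d) (\<lambda>x. ennreal (m / exp (- (x ^ 2))))"
      by simp
    have inv: "density (density M ?d) (\<lambda>x. ennreal (m / exp (- (x ^ 2)))) = M" if "sets M = sets borel" for M :: "real measure"
    proof -
      note [measurable_cong] = that
      have "density (density M ?d) (\<lambda>x. ennreal (m / exp (- (x ^ 2)))) = density M (\<lambda>x. ?d x * ennreal (m / exp (- (x ^ 2))))"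
        by (rule density_density_eq) measurable
      also have "\<dots> = density M (\<lambda>_. 1)"
        using True by (intro arg_cong[where f = "density M"] ext) (simp flip: ennreal_mult)
      finally show ?thesis by (simp add: density_1)
    qed
    show ?thesis using * inv[OF sets(1)] inv[OF sets(2)] by simp
  next
    case False
    \<comment> \<open>The mass is the integral of a strictly positive function. If it is not
      positive it is 0, and the measure is null.\<close>
    have null: "emeasure M A = 0" if "sets M = sets borel" "integrable M (gauss_wave 0 1)"
      "(LINT x|M. gauss_wave 0 1 x) = of_real m" for M :: "real measure" and A
    proof -
      note [measurable_cong] = that(1)
      note int' = integrable_gauss[OF that(2,3)]
      have "(LINT x|M. exp (- (x ^ 2))) = m" by (rule integral_gauss[OF that(2,3)])
      moreover have "(LINT x|M. exp (- (x ^ 2))) \<ge> 0" by simp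
      ultimately have "(LINT x|M. exp (- (x ^ 2))) = 0" using False by simp
      then have "AE x in M. exp (- (x ^ 2)) = 0"
        using integral_nonneg_eq_0_iff_AE[OF int'] by simp
      then have "emeasure M (space M) = 0"
        by (subst (asm) AE_iff_measurable[of "space M"]) auto
      moreover have "emeasure M A \<le> emeasure M (space M)" by (rule emeasure_space)
      ultimately show ?thesis by simp
    qed
    show ?thesis
      using sets null[OF sets(1) int(1) m\<mu>] null[OF sets(2) int(2) m\<nu>] by (intro measure_eqI) auto
  qed
qed

subsection \<open>Uniqueness of vague limits\<close>

text \<open>Continuous functions decreasing to the indicator of \<open>{a..b}\<close>, with linear
  flanks of width \<open>1 / (n + 1)\<close> outside the interval.\<close>

definition trapezoid :: "real \<Rightarrow> real \<Rightarrow> nat \<Rightarrow> real \<Rightarrow> real" where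
  "trapezoid a b n x = max 0 (min 1 (min (1 + real (Suc n) * (x - a)) (1 + real (Suc n) * (b - x))))"

lemma trapezoid_nonneg: "0 \<le> trapezoid a b n x"
  and trapezoid_le_1: "trapezoid a b n x \<le> 1"
  by (simp_all add: trapezoid_def)

lemma trapezoid_eq_0:
  assumes "x \<notin> {a - 1..b + 1}"
  shows "trapezoid a b n x = 0"
proof -
  have "real (Suc n) * y \<le> -1" if "y < -1" for y
    using mult_left_mono[of y "-1" "real (Suc n)"] that by simp
  from this[of "x - a"] this[of "b - x"] assms show ?thesis by (auto simp: trapezoid_def)
qed

lemma trapezoid_tendsto: "(\<lambda>n. trapezoid a b n x) \<longlonglongrightarrow> indicator {a..b} x"
proof (cases "x \<in> {a..b}")
  case True
  then show ?thesis by (simp add: trapezoid_def)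
next
  case False
  obtain d where d: "d > 0" "x - a \<le> - d \<or> b - x \<le> - d"
    using False by (cases "x < a") (auto intro: that[of "a - x"] that[of "x - b"])
  obtain N where N: "1 < real N * d" using reals_Archimedean3[OF d(1)] by blast
  have "eventually (\<lambda>n. trapezoid a b n x = 0) sequentially"
    using eventually_ge_at_top[of N]
  proof eventually_elim
    case (elim n)
    then have "real N * d \<le> real (Suc n) * d" using d(1) by (intro mult_right_mono) auto
    then have "real (Suc n) * y \<le> -1" if "y \<le> - d" for y
      using mult_left_mono[OF that, of "real (Suc n)"] N by simp
    then have "real (Suc n) * (x - a) \<le> -1 \<or> real (Suc n) * (b - x) \<le> -1" using d(2) by blast
    then have "min 1 (min (1 + real (Suc n) * (x - a)) (1 + real (Suc n) * (b - x))) \<le> 0"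
      by (auto simp: min_le_iff_disj simp del: of_nat_Suc)
    then show ?case unfolding trapezoid_def by (rule max_absorb1)
  qed
  then show ?thesis using False by (simp add: tendsto_eventually)
qed

lemma cont_compact_support_trapezoid: "cont_compact_support (\<lambda>x. complex_of_real (trapezoid a b n x))"
  unfolding cont_compact_support_def
proof
  show "continuous_on UNIV (\<lambda>x. complex_of_real (trapezoid a b n x))"
    unfolding trapezoid_def by (intro continuous_intros)
  have "{x. complex_of_real (trapezoid a b n x) \<noteq> 0} \<subseteq> {a - 1..b + 1}"
    using trapezoid_eq_0[of _ a b n] by (metis (mono_tags, lifting) mem_Collect_eq of_real_0 subsetI)
  then show "compact (closure {x. complex_of_real (trapezoid a b n x) \<noteq> 0})"
    unfolding compact_closure by (rule bounded_subset[OF bounded_closed_interval])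
qed

text \<open>Trapezoids recover the measure of each compact interval, and compact intervals are an
  intersection-stable generator on which both measures are finite.\<close>

lemma vague_limit_unique:
  assumes \<mu>: "locally_finite_borel \<mu>" and \<nu>: "locally_finite_borel \<nu>"
    and eq: "\<And>f. cont_compact_support f \<Longrightarrow> (LINT x|\<mu>. f x) = (LINT x|\<nu>. f x)"
  shows "\<mu> = \<nu>"
proof -
  have lim: "(\<lambda>n. LINT x|M. complex_of_real (trapezoid a b n x)) \<longlonglongrightarrow> of_real (measure M {a..b})"
    if M: "locally_finite_borel M" for M a b
  proof -
    have [measurable_cong]: "sets M = sets borel" and fin: "emeasure M {c..d} < \<infinity>" for c d
      using M by (auto simp: locally_finite_borel_def)
    have [measurable]: "trapezoid a b n \<in> borel_measurable borel" for n
      unfolding trapezoid_def[abs_def] by measurable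
    have "(\<lambda>n. LINT x|M. trapezoid a b n x) \<longlonglongrightarrow> (LINT x|M. indicator {a..b} x)"
    proof (rule integral_dominated_convergence)
      show "integrable M (indicat_real {a - 1..b + 1})" using fin by (intro integrable_real_indicator) auto
      show "AE x in M. norm (trapezoid a b n x) \<le> indicat_real {a - 1..b + 1} x" for n
        using trapezoid_eq_0[of _ a b n] trapezoid_le_1[of a b n] trapezoid_nonneg[of a b n]
        by (intro AE_I2) (auto simp: indicator_def)
    qed (auto intro!: trapezoid_tendsto)
    moreover have "(LINT x|M. indicat_real {a..b} x) = measure M {a..b}" using fin by simp
    ultimately show ?thesis unfolding integral_complex_of_real by (simp add: tendsto_of_real_iff)
  qed
  have meas: "measure \<mu> {a..b} = measure \<nu> {a..b}" for a b
  proof -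
    have "(\<lambda>n. LINT x|\<mu>. complex_of_real (trapezoid a b n x)) = (\<lambda>n. LINT x|\<nu>. complex_of_real (trapezoid a b n x))"
      using eq[OF cont_compact_support_trapezoid] by auto
    then show ?thesis using LIMSEQ_unique[OF lim[OF \<mu>, of a b]] lim[OF \<nu>, of a b] by (metis of_real_eq_iff)
  qed
  have fin: "emeasure \<mu> {a..b} \<noteq> \<infinity>" "emeasure \<nu> {a..b} \<noteq> \<infinity>" for a b
    using \<mu> \<nu> compact_Icc[of a b] unfolding locally_finite_borel_def by (metis less_irrefl)+
  show ?thesis
  proof (rule measure_eqI_generator_eq[where E = "range (\<lambda>(a, b). {a..b::real})" and \<Omega> = UNIV and A = "\<lambda>i. {- real i..real i}"])
    show "Int_stable (range (\<lambda>(a, b). {a..b::real}))"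
    proof (rule Int_stableI)
      fix X Y assume "X \<in> range (\<lambda>(a, b). {a..b::real})" "Y \<in> range (\<lambda>(a, b). {a..b::real})"
      then obtain a b c d where "X = {a..b}" "Y = {c..d}" by auto
      then have "X \<inter> Y = (\<lambda>(a, b). {a..b}) (max a c, min b d)" by auto
      then show "X \<inter> Y \<in> range (\<lambda>(a, b). {a..b})" by blast
    qed
    show "emeasure \<mu> X = emeasure \<nu> X" if "X \<in> range (\<lambda>(a, b). {a..b::real})" for X
    proof -
      obtain a b where X: "X = {a..b}" using \<open>X \<in> _\<close> by auto
      show ?thesis
        unfolding X using emeasure_eq_ennreal_measure[of \<mu> "{a..b}"] emeasure_eq_ennreal_measure[of \<nu> "{a..b}"] fin[of a b] meas[of a b]
        by simp
    qed
    have "sets borel = sigma_sets UNIV (range (\<lambda>(a, b). {a..b::real}))"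
      unfolding borel_eq_atLeastAtMost by (rule sets_measure_of) simp
    then show "sets \<mu> = sigma_sets UNIV (range (\<lambda>(a, b). {a..b::real}))" "sets \<nu> = sigma_sets UNIV (range (\<lambda>(a, b). {a..b::real}))"
      using \<mu> \<nu> by (simp_all only: locally_finite_borel_def)
    show "(\<Union>i. {- real i..real i}) = UNIV"
    proof -
      have "\<exists>i. x \<in> {- real i..real i}" for x :: real
      proof -
        obtain n where "\<bar>x\<bar> \<le> real n" using real_arch_simple by blast
        then show ?thesis by (intro exI[of _ n]) (simp add: abs_le_iff)
      qed
      then show ?thesis by blast
    qed
  qed (use fin in auto)
qed

lemma is_autocorrelation_unique:
  assumes \<mu>: "is_autocorrelation \<Lambda> \<mu>" and \<nu>: "is_autocorrelation \<Lambda> \<nu>"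
  shows "\<mu> = \<nu>"
  using assms unfolding is_autocorrelation_def
  by (intro vague_limit_unique) (auto intro: tendsto_unique[OF trivial_limit_at_top_linorder])

subsection \<open>Multiplication by the golden ratio\<close>

definition golden_mult :: "int \<times> int \<Rightarrow> int \<times> int" where
  "golden_mult z = (snd z, fst z + snd z)"

lemma emb_golden_mult: "emb (golden_mult z) = golden * emb z"
proof -
  have "golden * emb z = fst z * golden + snd z * (golden * golden)" by (simp add: emb_def algebra_simps)
  then show ?thesis by (simp add: golden_sq) (simp add: emb_def golden_mult_def algebra_simps)
qed

lemma emb_star_golden_mult: "emb_star (golden_mult z) = (1 - golden) * emb_star z"
proof -
  have "(1 - golden) * emb_star z = fst z * (1 - golden) + snd z * (1 - 2 * golden + golden * golden)"
    by (simp add: emb_star_def algebra_simps)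
  then show ?thesis by (simp add: golden_sq) (simp add: emb_star_def golden_mult_def algebra_simps)
qed

lemma bij_golden_mult: "bij golden_mult"
  by (rule bij_betw_byWitness[where f' = "\<lambda>z. (snd z - fst z, fst z)"]) (auto simp: golden_mult_def)

lemma golden_conj: "golden * (golden - 1) = 1"
  by (simp add: algebra_simps golden_sq)

lemma abs_conj_golden: "0 < \<bar>1 - golden\<bar>" "\<bar>1 - golden\<bar> < 1"
proof -
  have "sqrt 5 < 3" by (rule real_less_lsqrt) auto
  then show "\<bar>1 - golden\<bar> < 1" "0 < \<bar>1 - golden\<bar>" using golden_gt_1 by (auto simp: golden_def)
qed

lemma golden_power:
  "emb ((golden_mult ^^ n) (1, 0)) = golden ^ n"
  "emb_star ((golden_mult ^^ n) (1, 0)) = (1 - golden) ^ n"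
  by (induction n) (simp_all add: emb_golden_mult emb_star_golden_mult, simp_all add: emb_def emb_star_def)

lemma emb_star_scale: "emb_star (j * fst z, j * snd z) = of_int j * emb_star z"
  by (simp add: emb_star_def algebra_simps)

text \<open>The conjugate of \<open>golden\<close> has modulus below 1, so its powers are
  arbitrarily small nonzero values of \<open>emb_star\<close>. Integer multiples of one smaller than
  \<open>v - u\<close> must hit the interval.\<close>

lemma emb_star_dense:
  assumes "u < v"
  obtains z where "u < emb_star z" "emb_star z < v"
proof -
  obtain n where n: "\<bar>1 - golden\<bar> ^ n < v - u"
    using real_arch_pow_inv[of "v - u" "\<bar>1 - golden\<bar>"] abs_conj_golden assms by auto
  define w where "w = (golden_mult ^^ n) (1, 0)"
  define \<eta> where "\<eta> = \<bar>emb_star w\<bar>"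
  have \<eta>: "0 < \<eta>" "\<eta> < v - u"
    using n abs_conj_golden by (simp_all add: \<eta>_def w_def golden_power power_abs)
  define j where "j = \<lfloor>u / \<eta>\<rfloor> + 1"
  have "u / \<eta> < of_int j" "of_int j \<le> u / \<eta> + 1" by (auto simp: j_def)
  then have "u < of_int j * \<eta>" "of_int j * \<eta> \<le> u + \<eta>" using \<eta> by (simp_all add: field_simps)
  then have j: "u < of_int j * \<eta>" "of_int j * \<eta> < v" using \<eta> by auto
  define i where "i = (if emb_star w \<ge> 0 then j else - j)"
  have "emb_star (i * fst w, i * snd w) = of_int j * \<eta>"
    unfolding emb_star_scale by (simp add: i_def \<eta>_def)
  then show thesis using that j by metis
qed

subsection \<open>Densities of model sets\<close>

text \<open>Lattice coordinates of the points of the model set with window \<open>J\<close> that lie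
  in \<open>{-R..R}\<close>.\<close>

definition slab :: "real set \<Rightarrow> real \<Rightarrow> (int \<times> int) set" where
  "slab J R = {y. emb_star y \<in> J \<and> \<bar>emb y\<bar> \<le> R}"

lemma slab_mono: "I \<subseteq> J \<Longrightarrow> R \<le> R' \<Longrightarrow> slab I R \<subseteq> slab J R'"
  by (auto simp: slab_def)

lemma snd_bound:
  assumes "\<bar>emb y\<bar> \<le> R" "\<bar>emb_star y\<bar> \<le> c"
  shows "\<bar>real_of_int (snd y)\<bar> * sqrt 5 \<le> R + c"
proof -
  have "\<bar>of_int (snd y) * sqrt 5\<bar> \<le> R + c"
    using emb_diff_star[of y] assms by linarith
  then show ?thesis by (simp add: abs_mult)
qed

lemma finite_slab:
  assumes "bounded J"
  shows "finite (slab J R)"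
proof -
  obtain c where c: "\<And>x. x \<in> J \<Longrightarrow> \<bar>x\<bar> \<le> c" using assms by (auto simp: bounded_iff)
  define K where "K = \<lceil>3 * (R + c)\<rceil>"
  have "slab J R \<subseteq> {-K..K} \<times> {-K..K}"
  proof
    fix y assume "y \<in> slab J R"
    then have y: "\<bar>emb y\<bar> \<le> R" "\<bar>emb_star y\<bar> \<le> c" using c by (auto simp: slab_def)
    have "\<bar>real_of_int (snd y)\<bar> * 1 \<le> \<bar>real_of_int (snd y)\<bar> * sqrt 5" by (intro mult_left_mono) auto
    with snd_bound[OF y] have s: "\<bar>real_of_int (snd y)\<bar> \<le> R + c" by linarith
    have "golden \<le> 2"
    proof -
      have "sqrt 5 < 3" by (rule real_less_lsqrt) auto
      then show ?thesis by (simp add: golden_def)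
    qed
    then have "\<bar>of_int (snd y) * golden\<bar> \<le> \<bar>real_of_int (snd y)\<bar> * 2"
      unfolding abs_mult using golden_gt_1 by (intro mult_left_mono) auto
    moreover have "\<bar>real_of_int (fst y)\<bar> \<le> \<bar>emb y\<bar> + \<bar>of_int (snd y) * golden\<bar>"
      using abs_triangle_ineq4[of "emb y" "of_int (snd y) * golden"] by (simp add: emb_def)
    moreover have "0 \<le> c" using y(2) abs_ge_zero order_trans by blast
    ultimately have "\<bar>real_of_int (fst y)\<bar> \<le> 3 * (R + c)" using y(1) s by argo
    moreover have "\<bar>real_of_int (snd y)\<bar> \<le> 3 * (R + c)" using s abs_ge_zero[of "real_of_int (snd y)"] by argo
    ultimately have "\<bar>fst y\<bar> \<le> K" "\<bar>snd y\<bar> \<le> K" unfolding K_def by linarith+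
    then show "y \<in> {-K..K} \<times> {-K..K}" by (cases y) auto
  qed
  then show ?thesis by (rule finite_subset) simp
qed

text \<open>In each row of constant second coordinate, a half-open window of integer length
  \<open>M\<close> contains exactly \<open>M\<close> consecutive integers.\<close>

lemma card_strip:
  fixes M N :: nat and c :: real
  shows "card {y. c \<le> emb_star y \<and> emb_star y < c + real M \<and> \<bar>snd y\<bar> \<le> int N} = M * (2 * N + 1)"
proof -
  define l where "l = (\<lambda>n. \<lceil>c - of_int n * (1 - golden)\<rceil>)"
  have "{y. c \<le> emb_star y \<and> emb_star y < c + real M \<and> \<bar>snd y\<bar> \<le> int N}
      = prod.swap ` (SIGMA n : {- int N..int N}. {l n..<l n + int M})"
  proof -
    have "c \<le> emb_star (m, n) \<and> emb_star (m, n) < c + real M \<longleftrightarrow> m \<in> {l n..<l n + int M}" for m n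
    proof -
      have 1: "c \<le> emb_star (m, n) \<longleftrightarrow> l n \<le> m"
        unfolding l_def by (simp add: ceiling_le_iff emb_star_def algebra_simps)
      have "emb_star (m, n) < c + real M \<longleftrightarrow> of_int (m - int M) < c - of_int n * (1 - golden)"
        by (simp add: emb_star_def algebra_simps)
      also have "\<dots> \<longleftrightarrow> m < l n + int M"
        unfolding l_def less_ceiling_iff[symmetric] by auto
      finally show ?thesis using 1 by auto
    qed
    then show ?thesis by (force simp: image_iff)
  qed
  also have "card \<dots> = card (SIGMA n : {- int N..int N}. {l n..<l n + int M})"
    by (rule card_image) simp
  also have "\<dots> = (\<Sum>n\<in>{- int N..int N}. M)" by (subst card_SigmaI) auto
  also have "\<dots> = M * (2 * N + 1)"
  proof -
    have "nat (2 * int N + 1) = 2 * N + 1" by (simp add: nat_eq_iff)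
    then show ?thesis by simp
  qed
  finally show ?thesis .
qed

text \<open>Since \<open>emb y - emb_star y\<close> is \<open>sqrt 5\<close> times
  \<open>snd y\<close>, a bound on \<open>\<bar>emb y\<bar>\<close> amounts, up to a margin fixed by
  the window, to a bound on \<open>\<bar>snd y\<bar>\<close>, where the count is exact.\<close>

lemma card_slab_upper:
  fixes M :: nat and c :: real
  assumes "R \<ge> 0"
  shows "real (card (slab {c..<c + real M} R)) \<le> real M * (2 * (R + \<bar>c\<bar> + real M) / sqrt 5 + 1)"
proof -
  let ?S = "slab {c..<c + real M}"
  define N where "N = nat \<lfloor>(R + \<bar>c\<bar> + real M) / sqrt 5\<rfloor>"
  let ?T = "{y. c \<le> emb_star y \<and> emb_star y < c + real M \<and> \<bar>snd y\<bar> \<le> int N}"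
  have "?S R \<subseteq> ?T"
  proof
    fix y assume y: "y \<in> ?S R"
    then have "\<bar>emb_star y\<bar> \<le> \<bar>c\<bar> + real M" by (auto simp: slab_def)
    with y have "\<bar>real_of_int (snd y)\<bar> * sqrt 5 \<le> R + (\<bar>c\<bar> + real M)"
      by (intro snd_bound) (auto simp: slab_def)
    then have "\<bar>real_of_int (snd y)\<bar> \<le> (R + \<bar>c\<bar> + real M) / sqrt 5" by (simp add: field_simps)
    then have "\<bar>snd y\<bar> \<le> \<lfloor>(R + \<bar>c\<bar> + real M) / sqrt 5\<rfloor>" by (simp add: le_floor_iff)
    then have "\<bar>snd y\<bar> \<le> int N" unfolding N_def by linarith
    then show "y \<in> ?T" using y by (auto simp: slab_def)
  qed
  \<comment> \<open>An infinite set has \<open>card\<close> 0, so a positive exact count already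
    shows finiteness; \<open>M = 0\<close> is the case in which this argument fails.\<close>
  moreover have "finite ?T"
  proof (cases "M = 0")
    case True
    then have "?T = {}" by auto
    then show ?thesis by (simp only: finite.emptyI)
  next
    case False
    then have "card ?T > 0" unfolding card_strip by simp
    then show ?thesis by (rule card_ge_0_finite)
  qed
  ultimately have "card (?S R) \<le> card ?T"
    by (intro card_mono)
  then have "card (?S R) \<le> M * (2 * N + 1)" by (simp only: card_strip)
  then have "real (card (?S R)) \<le> real M * (2 * real N + 1)"
    by (metis (mono_tags) of_nat_le_iff of_nat_mult of_nat_add of_nat_1 of_nat_numeral)
  moreover have "real N \<le> (R + \<bar>c\<bar> + real M) / sqrt 5"
    unfolding N_def using assms by (simp add: of_nat_nat)
  then have "real M * (2 * real N + 1) \<le> real M * (2 * (R + \<bar>c\<bar> + real M) / sqrt 5 + 1)"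
    unfolding times_divide_eq_right[symmetric] by (intro mult_left_mono) linarith+
  ultimately show ?thesis by (rule order_trans)
qed

lemma card_slab_lower:
  fixes M :: nat and c :: real
  assumes R: "R \<ge> \<bar>c\<bar> + real M"
  shows "real M * (2 * (R - \<bar>c\<bar> - real M) / sqrt 5 - 1) \<le> real (card (slab {c..<c + real M} R))"
proof -
  let ?S = "slab {c..<c + real M}"
  define N where "N = nat \<lfloor>(R - \<bar>c\<bar> - real M) / sqrt 5\<rfloor>"
  let ?T = "{y. c \<le> emb_star y \<and> emb_star y < c + real M \<and> \<bar>snd y\<bar> \<le> int N}"
  have N: "real N \<le> (R - \<bar>c\<bar> - real M) / sqrt 5" "(R - \<bar>c\<bar> - real M) / sqrt 5 \<le> real N + 1"
    unfolding N_def using R by (simp_all add: of_nat_nat)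
  have "?T \<subseteq> ?S R"
  proof
    fix y assume y: "y \<in> ?T"
    then have "\<bar>real_of_int (snd y)\<bar> \<le> real N" by auto
    then have "\<bar>real_of_int (snd y)\<bar> * sqrt 5 \<le> (R - \<bar>c\<bar> - real M) / sqrt 5 * sqrt 5"
      using N(1) by (intro mult_right_mono) auto
    then have "\<bar>real_of_int (snd y)\<bar> * sqrt 5 \<le> R - \<bar>c\<bar> - real M" by simp
    then have "\<bar>of_int (snd y) * sqrt 5\<bar> \<le> R - \<bar>c\<bar> - real M" by (simp add: abs_mult)
    moreover have "\<bar>emb_star y\<bar> \<le> \<bar>c\<bar> + real M" using y by auto
    ultimately have "\<bar>emb y\<bar> \<le> R" using emb_diff_star[of y] by linarith
    then show "y \<in> ?S R" using y by (auto simp: slab_def)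
  qed
  moreover have "bounded {c..<c + real M}" by simp
  ultimately have "card ?T \<le> card (?S R)"
    by (intro card_mono finite_slab)
  then have "M * (2 * N + 1) \<le> card (?S R)" by (simp only: card_strip)
  then have "real M * (2 * real N + 1) \<le> real (card (?S R))"
    by (metis (mono_tags) of_nat_le_iff of_nat_mult of_nat_add of_nat_1 of_nat_numeral)
  moreover have "real M * (2 * (R - \<bar>c\<bar> - real M) / sqrt 5 - 1) \<le> real M * (2 * real N + 1)"
    unfolding times_divide_eq_right[symmetric] using N by (intro mult_left_mono) linarith+
  ultimately show ?thesis by linarith
qed

text \<open>
  Packing: \<open>k\<close> translates of an interval slightly shorter than \<open>M / k\<close> fit disjointly into \<open>[0, M)\<close>,
  where the count is explicit, and translating the window changes the count by a bounded shift of \<open>R\<close>.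
\<close>

lemma eventually_card_slab_le:
  assumes ab: "a \<le> b" and \<rho>: "b - a < \<rho>"
  shows "eventually (\<lambda>R. real (card (slab {a..b} R)) \<le> \<rho> * (2 * R / sqrt 5)) at_top"
proof -
  \<comment> \<open>For such \<open>k\<close> an integer \<open>M\<close> lies strictly between
    \<open>k * (b - a)\<close> and \<open>k * \<rho>\<close>. Cells of length
    \<open>q = M / k\<close> are then longer than the interval but shorter than
    \<open>\<rho>\<close>.\<close>
  obtain k :: nat where k: "1 < real k * (\<rho> - (b - a))"
    using reals_Archimedean3[of "\<rho> - (b - a)"] \<rho> by auto
  then have k0: "k > 0" by (cases k) auto
  define M where "M = nat \<lfloor>real k * (b - a)\<rfloor> + 1"
  have fl: "\<lfloor>real k * (b - a)\<rfloor> \<ge> 0" using ab by simp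
  then have "real M = of_int \<lfloor>real k * (b - a)\<rfloor> + 1" by (simp add: M_def of_nat_nat)
  then have M: "real k * (b - a) < real M" "real M < real k * \<rho>"
    using k by (auto simp: algebra_simps) linarith+
  define q where "q = real M / real k"
  have q: "b - a < q" "q < \<rho>" using M k0 by (simp_all add: q_def field_simps)
  \<comment> \<open>The \<open>i\<close>-th cell of length \<open>q\<close> exceeds the interval,
    which leaves an open range of admissible translations; density provides one by a lattice
    point.\<close>
  have "\<exists>z. real i * q < a + emb_star z \<and> a + emb_star z < real (Suc i) * q - (b - a)" for i :: nat
  proof -
    have "real i * q - a < real (Suc i) * q - (b - a) - a" using q by (simp add: algebra_simps)
    then obtain z where "real i * q - a < emb_star z" "emb_star z < real (Suc i) * q - (b - a) - a"
      by (rule emb_star_dense)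
    then show ?thesis by (intro exI[of _ z]) linarith
  qed
  then obtain t where t: "\<And>i. real i * q < a + emb_star (t i)" "\<And>i. a + emb_star (t i) < real (Suc i) * q - (b - a)"
    by metis
  define T where "T = (\<Sum>i<k. \<bar>emb (t i)\<bar>)"
  have T: "\<bar>emb (t i)\<bar> \<le> T" if "i < k" for i
    unfolding T_def using that by (intro member_le_sum) auto
  have T0: "T \<ge> 0" by (simp add: T_def sum_nonneg)
  have count: "real k * real (card (slab {a..b} R)) \<le> real M * (2 * (R + T + real M) / sqrt 5 + 1)" if R: "R \<ge> 0" for R
  proof -
    define S where "S = (\<lambda>i. (\<lambda>y. y + t i) ` slab {a..b} R)"
    have strip: "real i * q < emb_star y \<and> emb_star y < real (Suc i) * q" if y: "y \<in> S i" for i y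
    proof -
      obtain x where x: "y = x + t i" "a \<le> emb_star x" "emb_star x \<le> b"
        using y by (auto simp: S_def slab_def)
      then show ?thesis using t[of i] by (auto simp: emb_star_add)
    qed
    have disj: "S i \<inter> S j = {}" if "i < j" for i j
    proof -
      have "real (Suc i) * q \<le> real j * q" using that q ab by (intro mult_right_mono) auto
      then show ?thesis using strip[of _ i] strip[of _ j] by force
    qed
    have fin: "finite (S i)" for i unfolding S_def by (intro finite_imageI finite_slab) simp
    have "(\<Union>i<k. S i) \<subseteq> slab {0..<0 + real M} (R + T)"
    proof
      fix y assume "y \<in> (\<Union>i<k. S i)"
      then obtain i where i: "i < k" "y \<in> S i" by auto
      then obtain x where x: "y = x + t i" "\<bar>emb x\<bar> \<le> R" by (auto simp: S_def slab_def)
      have "\<bar>emb y\<bar> \<le> R + T" using x T[OF i(1)] by (simp add: emb_add)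
      moreover have "0 \<le> real i * q" using q ab by simp
      moreover have "real (Suc i) * q \<le> real k * q" using i q ab by (intro mult_right_mono) auto
      moreover have "real k * q = real M" using k0 by (simp add: q_def)
      ultimately show "y \<in> slab {0..<0 + real M} (R + T)" using strip[OF i(2)] by (auto simp: slab_def)
    qed
    then have "card (\<Union>i<k. S i) \<le> card (slab {0..<0 + real M} (R + T))"
      by (intro card_mono finite_slab) (auto intro: bounded_subset[OF bounded_closed_interval])
    moreover have "card (\<Union>i<k. S i) = (\<Sum>i<k. card (S i))"
    proof (rule card_UN_disjoint)
      show "\<forall>i\<in>{..<k}. \<forall>j\<in>{..<k}. i \<noteq> j \<longrightarrow> S i \<inter> S j = {}"
        using disj by (metis Int_commute linorder_neqE_nat)
    qed (use fin in auto)
    moreover have "card (S i) = card (slab {a..b} R)" for i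
      unfolding S_def by (rule card_image) (auto simp: inj_on_def)
    ultimately have "k * card (slab {a..b} R) \<le> card (slab {0..<0 + real M} (R + T))" by simp
    then have "real k * real (card (slab {a..b} R)) \<le> real (card (slab {0..<0 + real M} (R + T)))"
      by (metis of_nat_le_iff of_nat_mult)
    also have "\<dots> \<le> real M * (2 * (R + T + \<bar>0\<bar> + real M) / sqrt 5 + 1)"
      using R T0 by (intro card_slab_upper) auto
    finally show ?thesis by simp
  qed
  define C where "C = 2 * (T + real M) / sqrt 5 + 1"
  have bound: "real (card (slab {a..b} R)) \<le> q * (2 * R / sqrt 5) + q * C" if "R \<ge> 0" for R
  proof -
    have "real (card (slab {a..b} R)) \<le> real M * (2 * (R + T + real M) / sqrt 5 + 1) / real k"
      using count[OF that] k0 by (simp add: field_simps)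
    also have "\<dots> = q * (2 * R / sqrt 5) + q * C"
      by (simp add: q_def C_def add_divide_distrib algebra_simps)
    finally show ?thesis .
  qed
  have lim: "filterlim (\<lambda>R. (\<rho> - q) * (2 / sqrt 5) * R) at_top at_top"
    using q by (intro filterlim_tendsto_pos_mult_at_top[OF tendsto_const] filterlim_ident) auto
  show ?thesis
    using filterlim_at_top[THEN iffD1, OF lim, rule_format, of "q * C"] eventually_ge_at_top[of 0]
  proof eventually_elim
    case (elim R)
    moreover have "(\<rho> - q) * (2 / sqrt 5) * R = \<rho> * (2 * R / sqrt 5) - q * (2 * R / sqrt 5)"
      by (simp add: algebra_simps diff_divide_distrib)
    ultimately show ?case using bound[of R] by linarith
  qed
qed

text \<open>By complement: \<open>J\<close>, the endpoint \<open>a\<close> and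
  \<open>{b..a + M}\<close> cover a half-open window of integer length. Its count is bounded below
  explicitly, and the other two pieces are bounded above by
  \<open>eventually_card_slab_le\<close>.\<close>

lemma eventually_card_slab_ge:
  assumes ab: "a \<le> b" and \<rho>: "\<rho> < b - a" and J: "{a<..<b} \<subseteq> J" "bounded J"
  shows "eventually (\<lambda>R. \<rho> * (2 * R / sqrt 5) \<le> real (card (slab J R))) at_top"
proof -
  let ?u = "\<lambda>R. 2 * R / sqrt 5"
  \<comment> \<open>One third of the slack each pays for the endpoint \<open>a\<close>, for the
    complementary interval and for the constant \<open>C\<close>.\<close>
  define \<epsilon> where "\<epsilon> = (b - a - \<rho>) / 3"
  have \<epsilon>: "\<epsilon> > 0" using \<rho> by (simp add: \<epsilon>_def)
  define M where "M = nat \<lceil>b - a\<rceil> + 1"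
  have M: "b - a < real M" unfolding M_def by linarith
  let ?S = "slab {a..<a + real M}" and ?T = "slab {b..a + real M}"
  have cover: "real (card (?S R)) \<le>
      real (card (slab J R)) + real (card (slab {a..a} R)) + real (card (?T R))" for R
  proof -
    have "?S R \<subseteq> slab J R \<union> slab {a..a} R \<union> ?T R"
      using J(1) by (auto simp: slab_def)
    then have "card (?S R) \<le> card (slab J R \<union> slab {a..a} R \<union> ?T R)"
      using J(2) by (intro card_mono finite_UnI finite_slab) auto
    also have "\<dots> \<le> card (slab J R) + card (slab {a..a} R) + card (?T R)"
      by (meson add_right_mono card_Un_le order_trans)
    finally show ?thesis by linarith
  qed
  define C where "C = real M * (2 * (\<bar>a\<bar> + real M) / sqrt 5 + 1)"
  have lim: "filterlim (\<lambda>R. \<epsilon> * (2 / sqrt 5) * R) at_top at_top"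
    using \<epsilon> by (intro filterlim_tendsto_pos_mult_at_top[OF tendsto_const] filterlim_ident) auto
  have e1: "eventually (\<lambda>R. real (card (slab {a..a} R)) \<le> \<epsilon> * ?u R) at_top"
    using \<epsilon> by (intro eventually_card_slab_le) auto
  have e2: "eventually (\<lambda>R. real (card (?T R)) \<le> (real M - (b - a) + \<epsilon>) * ?u R) at_top"
    using \<epsilon> M by (intro eventually_card_slab_le) auto
  show ?thesis
    using filterlim_at_top[THEN iffD1, OF lim, rule_format, of C] eventually_ge_at_top[of "\<bar>a\<bar> + real M"] e1 e2
  proof eventually_elim
    case (elim R)
    have "real M * ?u R - C \<le> real (card (?S R))"
    proof -
      have "real M * ?u R - C = real M * (2 * (R - \<bar>a\<bar> - real M) / sqrt 5 - 1)"
        by (simp add: C_def diff_divide_distrib add_divide_distrib algebra_simps)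
      then show ?thesis using card_slab_lower[OF elim(2)] by simp
    qed
    moreover have "\<epsilon> * (2 / sqrt 5) * R = \<epsilon> * ?u R" by simp
    moreover have "(real M - (b - a) + \<epsilon>) * ?u R + \<epsilon> * ?u R + \<epsilon> * ?u R + \<rho> * ?u R
        = real M * ?u R"
    proof -
      have "real M - (b - a) + \<epsilon> + \<epsilon> + \<epsilon> + \<rho> = real M" by (simp add: \<epsilon>_def field_simps)
      then show ?thesis by (simp only: distrib_right[symmetric])
    qed
    ultimately show ?case using cover[of R] elim by linarith
  qed
qed

theorem slab_density:
  assumes ab: "a \<le> b" and J: "{a<..<b} \<subseteq> J" "J \<subseteq> {a..b}"
  shows "((\<lambda>R. real (card (slab J R)) / (2 * R)) \<longlongrightarrow> (b - a) / sqrt 5) at_top"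
proof (rule order_tendstoI)
  have bJ: "bounded J" using J(2) bounded_closed_interval bounded_subset by blast
  fix l assume "l < (b - a) / sqrt 5"
  then have "sqrt 5 * l < b - a" by (simp add: field_simps)
  then obtain \<rho> where \<rho>: "sqrt 5 * l < \<rho>" "\<rho> < b - a" using dense by blast
  show "eventually (\<lambda>R. l < real (card (slab J R)) / (2 * R)) at_top"
    using eventually_card_slab_ge[OF ab \<rho>(2) J(1) bJ] eventually_gt_at_top[of 0]
  proof eventually_elim
    case (elim R)
    have "(sqrt 5 * l) * (2 * R / sqrt 5) < \<rho> * (2 * R / sqrt 5)"
      using \<rho>(1) elim(2) by (intro mult_strict_right_mono) auto
    then have "l * (2 * R) < real (card (slab J R))" using elim(1) by simp
    then show ?case using elim(2) by (simp add: field_simps)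
  qed
next
  fix u assume "(b - a) / sqrt 5 < u"
  then have "b - a < sqrt 5 * u" by (simp add: field_simps)
  then obtain \<rho> where \<rho>: "b - a < \<rho>" "\<rho> < sqrt 5 * u" using dense by blast
  show "eventually (\<lambda>R. real (card (slab J R)) / (2 * R) < u) at_top"
    using eventually_card_slab_le[OF ab \<rho>(1)] eventually_gt_at_top[of 0]
  proof eventually_elim
    case (elim R)
    have "card (slab J R) \<le> card (slab {a..b} R)"
      using J(2) by (intro card_mono finite_slab slab_mono) auto
    moreover have "\<rho> * (2 * R / sqrt 5) < (sqrt 5 * u) * (2 * R / sqrt 5)"
      using \<rho>(2) elim(2) by (intro mult_strict_right_mono) auto
    ultimately have "real (card (slab J R)) < u * (2 * R)" using elim(1) by simp
    then show ?case using elim(2) by (simp add: field_simps)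
  qed
qed

subsection \<open>The autocorrelation of a model set\<close>

lemma model_set_Int_eq: "model_set W \<inter> {-R..R} = emb ` slab W R"
  by (auto simp: model_set_def slab_def Z_tau_eq_range_emb star_emb abs_le_iff image_iff)

lemma sum_differences:
  fixes F :: "'a::ab_group_add \<Rightarrow> 'b::comm_semiring_1"
  assumes S: "finite S" and D: "finite D" "\<And>p q. p \<in> S \<Longrightarrow> q \<in> S \<Longrightarrow> F (p - q) \<noteq> 0 \<Longrightarrow> p - q \<in> D"
  shows "(\<Sum>p\<in>S. \<Sum>q\<in>S. F (p - q)) = (\<Sum>z\<in>D. F z * of_nat (card {q \<in> S. q + z \<in> S}))"
proof -
  have inner: "(\<Sum>p\<in>S. F (p - q)) = (\<Sum>z\<in>D. if q + z \<in> S then F z else 0)" if q: "q \<in> S" for q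
  proof -
    have "(\<Sum>p\<in>S. F (p - q)) = (\<Sum>z\<in>(\<lambda>p. p - q) ` S. F z)"
      by (subst sum.reindex) (auto simp: inj_on_def)
    also have "\<dots> = (\<Sum>z\<in>{z \<in> D. q + z \<in> S}. F z)"
    proof (rule sum.mono_neutral_right)
      show "{z \<in> D. q + z \<in> S} \<subseteq> (\<lambda>p. p - q) ` S" by (force simp: image_iff)
      show "\<forall>z\<in>(\<lambda>p. p - q) ` S - {z \<in> D. q + z \<in> S}. F z = 0"
        using D(2)[OF _ q] by auto
    qed (use S in auto)
    also have "\<dots> = (\<Sum>z\<in>D. if q + z \<in> S then F z else 0)"
      using D(1) by (rule sum.inter_filter)
    finally show ?thesis .
  qed
  have "(\<Sum>p\<in>S. \<Sum>q\<in>S. F (p - q)) = (\<Sum>q\<in>S. \<Sum>p\<in>S. F (p - q))" by (rule sum.swap)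
  also have "\<dots> = (\<Sum>q\<in>S. \<Sum>z\<in>D. if q + z \<in> S then F z else 0)" using inner by simp
  also have "\<dots> = (\<Sum>z\<in>D. \<Sum>q\<in>S. if q + z \<in> S then F z else 0)" by (rule sum.swap)
  also have "\<dots> = (\<Sum>z\<in>D. F z * of_nat (card {q \<in> S. q + z \<in> S}))"
  proof (rule sum.cong[OF refl])
    fix z
    have "(\<Sum>q\<in>S. if q + z \<in> S then F z else 0) = (\<Sum>q\<in>{q \<in> S. q + z \<in> S}. F z)"
      using S by (rule sum.inter_filter[symmetric])
    then show "(\<Sum>q\<in>S. if q + z \<in> S then F z else 0) = F z * of_nat (card {q \<in> S. q + z \<in> S})"
      by (simp add: mult.commute)
  qed
  finally show ?thesis .
qed

text \<open>Pairs with difference \<open>z\<close> are counted by the points whose star image lies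
  in the intersection of \<open>W\<close> with its translate, an interval of length
  \<open>triangle (b - a) (emb_star z)\<close> up to endpoints. The requirement that both points lie
  in \<open>{-R..R}\<close> costs at most a shift of \<open>R\<close> by
  \<open>\<bar>emb z\<bar>\<close>, which does not affect densities.\<close>

lemma shifted_pairs_density:
  assumes W: "{a<..<b} \<subseteq> W" "W \<subseteq> {a..b}" and z: "\<bar>emb_star z\<bar> \<le> b - a"
  shows "((\<lambda>R. real (card {q \<in> slab W R. q + z \<in> slab W R}) / (2 * R)) \<longlongrightarrow> acf_weight (b - a) z) at_top"
proof -
  let ?P = "\<lambda>R. {q \<in> slab W R. q + z \<in> slab W R}"
  define c where "c = \<bar>emb z\<bar>"
  define J where "J = {u \<in> W. u + emb_star z \<in> W}"
  define a' where "a' = max a (a - emb_star z)"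
  define b' where "b' = min b (b - emb_star z)"
  have ab': "a' \<le> b'" and len: "b' - a' = triangle (b - a) (emb_star z)"
    using z by (auto simp: a'_def b'_def triangle_def max_def min_def)
  have J: "{a'<..<b'} \<subseteq> J" "J \<subseteq> {a'..b'}"
  proof -
    show "{a'<..<b'} \<subseteq> J"
    proof
      fix u assume "u \<in> {a'<..<b'}"
      then have "u \<in> {a<..<b}" "u + emb_star z \<in> {a<..<b}" by (auto simp: a'_def b'_def)
      then show "u \<in> J" using W by (auto simp: J_def)
    qed
    show "J \<subseteq> {a'..b'}"
    proof
      fix u assume "u \<in> J"
      then have "u \<in> {a..b}" "u + emb_star z \<in> {a..b}" using W by (auto simp: J_def)
      then show "u \<in> {a'..b'}" by (auto simp: a'_def b'_def)
    qed
  qed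
  define N where "N = (\<lambda>R. real (card (slab J R)))"
  have lim: "((\<lambda>R. N R / (2 * R)) \<longlongrightarrow> acf_weight (b - a) z) at_top"
    using slab_density[OF ab' J] by (simp add: N_def len acf_weight_def)
  have lim': "((\<lambda>R. N (R - c) / (2 * R)) \<longlongrightarrow> acf_weight (b - a) z) at_top"
  proof -
    have "filterlim (\<lambda>R::real. R - c) at_top at_top"
      using filterlim_tendsto_add_at_top[OF tendsto_const[of "- c"] filterlim_ident] by simp
    from filterlim_compose[OF lim this]
    have "((\<lambda>R. N (R - c) / (2 * (R - c))) \<longlongrightarrow> acf_weight (b - a) z) at_top" .
    moreover have "((\<lambda>R::real. 1 - c / R) \<longlongrightarrow> 1 - 0) at_top"
      by (intro tendsto_intros tendsto_divide_0[OF tendsto_const] filterlim_at_top_imp_at_infinity filterlim_ident)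
    ultimately have "((\<lambda>R. N (R - c) / (2 * (R - c)) * (1 - c / R)) \<longlongrightarrow> acf_weight (b - a) z * (1 - 0)) at_top"
      by (rule tendsto_mult)
    moreover have "eventually (\<lambda>R. N (R - c) / (2 * (R - c)) * (1 - c / R) = N (R - c) / (2 * R)) at_top"
      using eventually_gt_at_top[of "max 0 c"]
    proof eventually_elim
      case (elim R)
      then have e: "1 - c / R = (R - c) / R" by (simp add: field_simps)
      have cancel: "x / (2 * d) * (d / R) = x / (2 * R)" if "d \<noteq> 0" for x d :: real using that by simp
      show ?case unfolding e by (rule cancel) (use elim in simp)
    qed
    ultimately show ?thesis by (simp add: tendsto_cong)
  qed
  have bdd: "bounded W" "bounded J"
    using W(2) J(2) bounded_closed_interval bounded_subset by blast+
  show ?thesis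
  proof (rule tendsto_sandwich[OF _ _ lim' lim])
    show "eventually (\<lambda>R. N (R - c) / (2 * R) \<le> real (card (?P R)) / (2 * R)) at_top"
      using eventually_gt_at_top[of 0]
    proof eventually_elim
      case (elim R)
      have "slab J (R - c) \<subseteq> (?P R)"
        by (auto simp: slab_def J_def c_def emb_add emb_star_add)
      then have "card (slab J (R - c)) \<le> card (?P R)"
        by (intro card_mono finite_subset[OF Collect_restrict finite_slab[OF bdd(1)]])
      then show ?case using elim by (simp add: N_def divide_right_mono)
    qed
    show "eventually (\<lambda>R. real (card (?P R)) / (2 * R) \<le> N R / (2 * R)) at_top"
      using eventually_gt_at_top[of 0]
    proof eventually_elim
      case (elim R)
      have "(?P R) \<subseteq> slab J R"
        by (auto simp: slab_def J_def emb_add emb_star_add)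
      then have "card (?P R) \<le> card (slab J R)"
        by (intro card_mono finite_slab[OF bdd(2)])
      then show ?case using elim by (simp add: N_def divide_right_mono)
    qed
  qed
qed

text \<open>Differences have star image in a fixed bounded interval, so only the finitely many in
  \<open>D\<close> meet the support of \<open>f\<close>. Vague convergence is thus the convergence
  of finitely many pair densities.\<close>

lemma is_autocorrelation_model_autocorrelation:
  assumes ab: "a < b" and W: "{a<..<b} \<subseteq> W" "W \<subseteq> {a..b}"
  shows "is_autocorrelation (model_set W) (model_autocorrelation (b - a))"
  unfolding is_autocorrelation_def
proof (intro conjI allI impI)
  let ?w = "acf_weight (b - a)" and ?n = "\<lambda>R z. card {q \<in> slab W R. q + z \<in> slab W R}"
  let ?S = "\<lambda>f R. \<Sum>x\<in>model_set W \<inter> {-R..R}. \<Sum>y\<in>model_set W \<inter> {-R..R}. f (x - y) :: complex"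
  have "locally_finite_borel (weighted_atoms (\<lambda>z. emb z / 1) (?w))"
    by (rule locally_finite_weighted_atoms[OF _ acf_weight_nonneg acf_weight_decay]) (use ab in auto)
  then show "locally_finite_borel (model_autocorrelation (b - a))" by (simp add: model_autocorrelation_def)
  fix f assume f: "cont_compact_support f"
  have bdd: "bounded W" using W(2) bounded_closed_interval bounded_subset by blast
  have f_meas: "f \<in> borel_measurable borel"
    using f by (intro borel_measurable_continuous_onI) (simp add: cont_compact_support_def)
  have "bounded {x. f x \<noteq> 0}"
    using f by (simp add: cont_compact_support_def compact_closure)
  then obtain B where B: "\<And>x. f x \<noteq> 0 \<Longrightarrow> \<bar>x\<bar> \<le> B" by (auto simp: bounded_iff)
  define D where "D = slab {- (b - a)..b - a} B"
  have D: "finite D" unfolding D_def by (rule finite_slab) simp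
  have inj: "inj_on emb A" for A using inj_emb by (rule inj_on_subset) simp
  have sum_eq: "?S f R
      = (\<Sum>z\<in>D. f (emb z) * of_nat (?n R z))" for R
  proof -
    have "?S f R
      = (\<Sum>p\<in>slab W R. \<Sum>q\<in>slab W R. f (emb (p - q)))"
      unfolding model_set_Int_eq by (simp add: sum.reindex[OF inj] emb_diff)
    also have "\<dots> = (\<Sum>z\<in>D. f (emb z) * of_nat (?n R z))"
    proof (rule sum_differences[OF finite_slab[OF bdd] D])
      fix p q assume pq: "p \<in> slab W R" "q \<in> slab W R" "f (emb (p - q)) \<noteq> 0"
      then have "emb_star p \<in> {a..b}" "emb_star q \<in> {a..b}" using W(2) by (auto simp: slab_def)
      then have "emb_star (p - q) \<in> {- (b - a)..b - a}" by (auto simp: emb_star_diff)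
      then show "p - q \<in> D" using B[OF pq(3)] by (simp add: D_def slab_def)
    qed
    finally show ?thesis .
  qed
  have integral_eq: "(LINT x|model_autocorrelation (b - a). f x) = (\<Sum>z\<in>D. f (emb z) * of_real (?w z))"
  proof -
    have sub: "{z. ?w z *\<^sub>R f (emb z) \<noteq> 0} \<subseteq> D"
    proof
      fix z assume "z \<in> {z. ?w z *\<^sub>R f (emb z) \<noteq> 0}"
      then have "triangle (b - a) (emb_star z) \<noteq> 0" "f (emb z) \<noteq> 0" by (auto simp: acf_weight_def)
      then have "\<bar>emb_star z\<bar> \<le> b - a" "\<bar>emb z\<bar> \<le> B"
        using triangle_eq_0[of "b - a" "emb_star z"] B linorder_le_cases by blast+
      then show "z \<in> D" by (auto simp: D_def slab_def)
    qed
    have "(LINT x|model_autocorrelation (b - a). f x) = (LINT z|counting. ?w z *\<^sub>R f (emb z))"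
      unfolding model_autocorrelation_def by (rule integral_weighted_atoms[OF f_meas acf_weight_nonneg])
    also have "\<dots> = (\<Sum>z\<in>{z \<in> UNIV. ?w z *\<^sub>R f (emb z) \<noteq> 0}. ?w z *\<^sub>R f (emb z))"
      by (rule lebesgue_integral_count_space_finite_support) (use finite_subset[OF sub D] in simp)
    also have "\<dots> = (\<Sum>z\<in>D. ?w z *\<^sub>R f (emb z))"
      using sub by (intro sum.mono_neutral_left D) auto
    finally show ?thesis by (simp add: scaleR_conv_of_real mult.commute)
  qed
  have "((\<lambda>R. \<Sum>z\<in>D. f (emb z) * of_real (real (?n R z) / (2 * R)))
      \<longlongrightarrow> (\<Sum>z\<in>D. f (emb z) * of_real (?w z))) at_top"
  proof (intro tendsto_sum tendsto_mult tendsto_const tendsto_of_real)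
    fix z assume "z \<in> D"
    then show "((\<lambda>R. real (?n R z) / (2 * R)) \<longlongrightarrow> ?w z) at_top"
      by (intro shifted_pairs_density[OF W]) (auto simp: D_def slab_def abs_le_iff)
  qed
  moreover have "(\<Sum>z\<in>D. f (emb z) * of_real (real (?n R z) / (2 * R)))
     = ?S f R / of_real (2 * R)" for R
    unfolding sum_eq by (simp add: sum_divide_distrib)
  ultimately show "((\<lambda>R::real. ?S f R / of_real (2 * R))
     \<longlongrightarrow> (LINT x|model_autocorrelation (b - a). f x)) at_top"
    unfolding integral_eq by simp
qed

theorem diffraction_model_set:
  assumes "a < b" "{a<..<b} \<subseteq> W" "W \<subseteq> {a..b}"
  shows "diffraction (model_set W) = model_diffraction (b - a)"
proof -
  have "autocorrelation (model_set W) = model_autocorrelation (b - a)"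
    unfolding autocorrelation_def
    using is_autocorrelation_model_autocorrelation[OF assms] is_autocorrelation_unique by blast
  moreover have "fourier_measure (model_autocorrelation (b - a)) = model_diffraction (b - a)"
    unfolding fourier_measure_def
    using is_fourier_measure_model_diffraction[of "b - a"] is_fourier_measure_unique assms(1) by (intro the_equality) auto
  ultimately show ?thesis by (simp add: diffraction_def)
qed

subsection \<open>Scaling of the intensity near the origin\<close>

lemma nn_integral_golden_mult:
  "(\<integral>\<^sup>+y. f (golden_mult y) \<partial>counting) = (\<integral>\<^sup>+y. f y \<partial>counting)"
  using bij_golden_mult by (rule nn_integral_bij_count_space)

text \<open>Up to a constant factor, a majorant for the intensity in
  \<open>{0<..K / sqrt 5}\<close>. Unlike the intensity it scales exactly under
  \<open>golden_mult\<close>; values in \<open>ennreal\<close> permit the reindexing before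
  finiteness is known.\<close>

definition ratio_mass :: "real \<Rightarrow> ennreal" where
  "ratio_mass K = (\<integral>\<^sup>+y. ennreal (emb y ^ 2 / emb_star y ^ 2) * indicator {0<..K} (emb y) \<partial>counting)"

lemma ratio_mass_mono: "K \<le> L \<Longrightarrow> ratio_mass K \<le> ratio_mass L"
  unfolding ratio_mass_def by (intro nn_integral_mono mult_left_mono) (auto simp: indicator_def)

text \<open>For \<open>0 < emb y \<le> 1\<close> the norm bound forces
  \<open>\<bar>emb_star y\<bar> \<ge> 1\<close>. Then \<open>emb_star y ^ 2\<close> is comparable to
  \<open>1 + emb_star y ^ 2\<close>, and a factor in \<open>emb y\<close> costs at most another
  2.\<close>

lemma ratio_mass_1_finite: "ratio_mass 1 < \<infinity>"
proof -
  have "ratio_mass 1 \<le> (\<integral>\<^sup>+y. ennreal (4 * lattice_decay y) \<partial>counting)"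
    unfolding ratio_mass_def
  proof (rule nn_integral_mono)
    fix y
    show "ennreal (emb y ^ 2 / emb_star y ^ 2) * indicator {0<..1} (emb y) \<le> ennreal (4 * lattice_decay y)"
    proof (cases "emb y \<in> {0<..1}")
      case True
      then have y: "0 < emb y" "emb y \<le> 1" by auto
      then have "1 \<le> emb y * \<bar>emb_star y\<bar>" using one_le_norm_emb[of y] by fastforce
      also have "\<dots> \<le> 1 * \<bar>emb_star y\<bar>" using y by (intro mult_right_mono) auto
      finally have "1 \<le> \<bar>emb_star y\<bar> ^ 2" by (intro one_le_power) simp
      then have s: "1 \<le> emb_star y ^ 2" by simp
      have e: "emb y ^ 2 \<le> 1" using y by (simp add: power_le_one)
      have "emb y ^ 2 / emb_star y ^ 2 \<le> 1 / emb_star y ^ 2" using e by (intro divide_right_mono) auto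
      also have "\<dots> \<le> 2 / (1 + emb_star y ^ 2)" using s by (simp add: divide_simps)
      also have "\<dots> \<le> 2 / (1 + emb_star y ^ 2) * (2 / (1 + emb y ^ 2))"
      proof -
        have "1 \<le> 2 / (1 + emb y ^ 2)" using e by (simp add: divide_simps add_pos_nonneg)
        then show ?thesis using mult_left_mono[of 1 "2 / (1 + emb y ^ 2)" "2 / (1 + emb_star y ^ 2)"] by simp
      qed
      also have "\<dots> = 4 * lattice_decay y" by (simp add: lattice_decay_def mult.commute)
      finally show ?thesis using True by (simp add: ennreal_leI)
    qed simp
  qed
  also have "\<dots> < \<infinity>"
    using integrable_lattice_decay[THEN integrable_mult_right, of 4]
    by (subst (asm) integrable_iff_bounded) (simp add: lattice_decay_def)
  finally show ?thesis .
qed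

lemma ratio_mass_scale: "ratio_mass (golden * K) = ennreal (golden ^ 4) * ratio_mass K"
proof -
  let ?f = "\<lambda>y. ennreal (emb y ^ 2 / emb_star y ^ 2) * indicator {0<..golden * K} (emb y)"
    and ?g = "\<lambda>y. ennreal (emb y ^ 2 / emb_star y ^ 2) * indicator {0<..K} (emb y)"
  have "ratio_mass (golden * K) = (\<integral>\<^sup>+y. ?f (golden_mult y) \<partial>counting)"
    unfolding ratio_mass_def by (rule nn_integral_golden_mult[symmetric])
  also have "\<dots> = (\<integral>\<^sup>+y. ennreal (golden ^ 4) * (?g y) \<partial>counting)"
  proof (rule nn_integral_cong)
    fix y
    \<comment> \<open>\<open>golden\<close> is a unit of norm -1, so dividing by
      \<open>(1 - golden) ^ 2\<close> is multiplying by \<open>golden ^ 2\<close>.\<close>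
    have "golden * (1 - golden) = -1" using golden_conj by (simp add: algebra_simps)
    then have "(golden * (1 - golden)) ^ 2 = 1" by simp
    then have "golden ^ 2 = golden ^ 2 * (golden * (1 - golden)) ^ 2" by simp
    also have "\<dots> = golden ^ 4 * (1 - golden) ^ 2" by (simp add: power_mult_distrib flip: power_add)
    finally have "golden ^ 2 / (1 - golden) ^ 2 = golden ^ 4"
      using abs_conj_golden(1) by (simp add: nonzero_divide_eq_eq)
    then have "emb (golden_mult y) ^ 2 / emb_star (golden_mult y) ^ 2 = golden ^ 4 * (emb y ^ 2 / emb_star y ^ 2)"
      by (simp add: emb_golden_mult emb_star_golden_mult power_mult_distrib) (simp flip: times_divide_times_eq)
    moreover have "indicator {0<..golden * K} (emb (golden_mult y)) = (indicator {0<..K} (emb y) :: ennreal)"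
      using golden_gt_1 by (simp add: indicator_def emb_golden_mult zero_less_mult_iff)
    ultimately show "?f (golden_mult y)
      = ennreal (golden ^ 4) * (?g y)"
      using golden_gt_1 by (simp only: ennreal_mult'[of "golden ^ 4"] zero_le_power mult.assoc)
  qed
  also have "\<dots> = ennreal (golden ^ 4) * ratio_mass K"
    unfolding ratio_mass_def by (rule nn_integral_cmult) simp
  finally show ?thesis .
qed

lemma golden_power_bracket:
  assumes "0 < K" "K \<le> 1"
  obtains N where "inverse golden ^ Suc N < K" "K \<le> inverse golden ^ N"
proof -
  have i: "0 < inverse golden" "inverse golden < 1" using golden_gt_1 by (auto simp: inverse_less_1_iff)
  obtain n where n: "inverse golden ^ n < K" using real_arch_pow_inv[of K "inverse golden"] assms i by auto
  define N where "N = (LEAST n. inverse golden ^ n < K)"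
  have N: "inverse golden ^ N < K" unfolding N_def using n by (rule LeastI)
  then have "N \<noteq> 0" using assms by (cases N) auto
  then obtain M where M: "N = Suc M" using not0_implies_Suc by blast
  have "\<not> inverse golden ^ M < K" using not_less_Least[of M "\<lambda>n. inverse golden ^ n < K"] M N_def by simp
  then show thesis using that[of M] N M by simp
qed

text \<open>Stated as a product because the iteration of \<open>ratio_mass_scale\<close> takes place
  in \<open>ennreal\<close>, where division is awkward.\<close>

lemma ratio_mass_power: "ratio_mass (inverse golden ^ N) * ennreal (golden ^ 4) ^ N = ratio_mass 1"
proof (induction N)
  case (Suc N)
  have "golden * inverse golden ^ Suc N = inverse golden ^ N" using golden_gt_1 by simp
  then have "ratio_mass (inverse golden ^ N) = ennreal (golden ^ 4) * ratio_mass (inverse golden ^ Suc N)"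
    using ratio_mass_scale[of "inverse golden ^ Suc N"] by (simp only:)
  then show ?case using Suc by (simp add: mult_ac)
qed simp

lemma ratio_mass_le:
  obtains C where "C > 0" "\<And>K. 0 < K \<Longrightarrow> K \<le> 1 \<Longrightarrow> ratio_mass K \<le> ennreal (C * K ^ 4)"
proof -
  obtain c where c: "ratio_mass 1 = ennreal c" "c \<ge> 0"
    using ratio_mass_1_finite by (cases "ratio_mass 1") auto
  \<comment> \<open>\<open>golden ^ 4\<close> pays for rounding \<open>K\<close> up to a power of
    \<open>inverse golden\<close>; \<open>c + 1\<close> in place of \<open>c\<close> keeps the
    constant positive.\<close>
  have "ratio_mass K \<le> ennreal ((c + 1) * golden ^ 4 * K ^ 4)" if K: "0 < K" "K \<le> 1" for K
  proof -
    obtain N where N: "inverse golden ^ Suc N < K" "K \<le> inverse golden ^ N"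
      using golden_power_bracket[OF K] by blast
    define r where "r = inverse golden ^ N"
    have r: "r > 0" using golden_gt_1 by (simp add: r_def)
    have rg: "r * golden ^ N = 1" using golden_gt_1 by (simp add: r_def flip: power_mult_distrib)
    have "ratio_mass K \<le> ratio_mass r" unfolding r_def using N(2) by (rule ratio_mass_mono)
    also have "ratio_mass r = ratio_mass r * (ennreal (golden ^ 4) ^ N * ennreal (r ^ 4))"
    proof -
      have "(golden ^ 4) ^ N * r ^ 4 = (r * golden ^ N) ^ 4"
        by (simp add: power_mult_distrib flip: power_mult) (simp add: mult.commute)
      then have "(golden ^ 4) ^ N * r ^ 4 = 1" using rg by simp
      then have "ennreal (golden ^ 4) ^ N * ennreal (r ^ 4) = 1"
        using golden_gt_1 r by (simp add: ennreal_power flip: ennreal_mult)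
      then show ?thesis by simp
    qed
    also have "\<dots> = ratio_mass 1 * ennreal (r ^ 4)"
      using ratio_mass_power[of N] by (simp add: r_def mult.assoc[symmetric])
    also have "\<dots> = ennreal (c * r ^ 4)" using c r by (simp add: ennreal_mult)
    also have "\<dots> \<le> ennreal ((c + 1) * golden ^ 4 * K ^ 4)"
    proof (rule ennreal_leI)
      have "r = golden * inverse golden ^ Suc N" using golden_gt_1 by (simp add: r_def)
      then have "r \<le> golden * K" using N(1) golden_gt_1 by simp
      then have "r ^ 4 \<le> (golden * K) ^ 4" using r by (intro power_mono) auto
      then have "c * r ^ 4 \<le> (c + 1) * (golden * K) ^ 4" using c r by (intro mult_mono) auto
      then show "c * r ^ 4 \<le> (c + 1) * golden ^ 4 * K ^ 4" by (simp add: power_mult_distrib mult.assoc)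
    qed
    finally show ?thesis .
  qed
  moreover have "(c + 1) * golden ^ 4 > 0" using c golden_gt_1 by (intro mult_pos_pos) auto
  ultimately show thesis using that by blast
qed

text \<open>
  Here the arithmetic of \<open>s\<close> enters: \<open>s y\<^sup>* - s\<^sup>* y\<close> is an integer multiple of \<open>sqrt 5\<close>, so that the sine
  is as small as \<open>y\<close>, although \<open>y\<^sup>*\<close> is large.
\<close>

lemma peak_weight_eq:
  assumes "emb y \<noteq> 0"
  shows "peak_weight (emb \<sigma>) y = (sin (pi * emb_star \<sigma> * emb y / sqrt 5)) ^ 2 / (pi * emb_star y) ^ 2"
proof -
  \<comment> \<open>Up to sign, the determinant of the coordinate vectors of \<open>\<sigma>\<close>
    and \<open>y\<close>.\<close>
  define j where "j = snd \<sigma> * fst y - fst \<sigma> * snd y"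
  have y: "emb_star y \<noteq> 0" using assms emb_eq_0_iff emb_star_eq_0_iff by metis
  have g: "2 * golden - 1 = sqrt 5" by (simp add: golden_def field_simps)
  have "emb \<sigma> * emb_star y - emb_star \<sigma> * emb y = of_int j * (2 * golden - 1)"
    by (simp add: emb_def emb_star_def j_def algebra_simps)
  then have "emb \<sigma> * emb_star y / sqrt 5 = emb_star \<sigma> * emb y / sqrt 5 + of_int j"
    unfolding g by (simp add: field_simps)
  then have "pi * (emb \<sigma> * emb_star y / sqrt 5) = pi * (emb_star \<sigma> * emb y / sqrt 5 + of_int j)" by (simp only:)
  then have "pi * emb \<sigma> * (emb_star y / sqrt 5) = pi * emb_star \<sigma> * emb y / sqrt 5 + pi * of_int j"
    by (simp add: distrib_left mult.assoc)
  moreover have "sin (x + pi * of_int j) ^ 2 = sin x ^ 2" for x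
    by (simp add: sin_add)
  ultimately have "sin (pi * emb \<sigma> * (emb_star y / sqrt 5)) ^ 2 = sin (pi * emb_star \<sigma> * emb y / sqrt 5) ^ 2"
    by simp
  then show ?thesis using y
    by (simp add: peak_weight_def fejer_def power_divide power_mult_distrib)
qed

text \<open>Division by the unit \<open>golden\<close> stays within the lattice. Applied repeatedly
  to 1 it yields the points tending to 0 whose peaks give the lower bound.\<close>

definition golden_div :: "int \<times> int \<Rightarrow> int \<times> int" where
  "golden_div z = (snd z - fst z, fst z)"

lemma golden_mult_div: "golden_mult (golden_div z) = z"
  by (simp add: golden_mult_def golden_div_def)

lemma golden_div_power:
  "emb ((golden_div ^^ n) (1, 0)) = inverse golden ^ n"
  "emb_star ((golden_div ^^ n) (1, 0)) = inverse (1 - golden) ^ n"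
proof -
  have 1: "emb (golden_div z) = inverse golden * emb z" for z
    using emb_golden_mult[of "golden_div z"] golden_gt_1 by (simp add: golden_mult_div)
  have 2: "emb_star (golden_div z) = inverse (1 - golden) * emb_star z" for z
    using emb_star_golden_mult[of "golden_div z"] abs_conj_golden(1) by (simp add: golden_mult_div)
  show "emb ((golden_div ^^ n) (1, 0)) = inverse golden ^ n"
    by (induction n) (simp_all add: 1, simp add: emb_def)
  show "emb_star ((golden_div ^^ n) (1, 0)) = inverse (1 - golden) ^ n"
    by (induction n) (simp_all add: 2, simp add: emb_star_def)
qed

lemma peak_weight_le_ratio:
  assumes "emb y \<noteq> 0"
  shows "peak_weight (emb \<sigma>) y \<le> emb_star \<sigma> ^ 2 / 5 * (emb y ^ 2 / emb_star y ^ 2)"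
proof -
  let ?\<theta> = "pi * emb_star \<sigma> * emb y / sqrt 5"
  have "sin ?\<theta> ^ 2 \<le> ?\<theta> ^ 2"
    using abs_sin_x_le_abs_x[of ?\<theta>] by (simp only: abs_le_square_iff)
  then have "peak_weight (emb \<sigma>) y \<le> ?\<theta> ^ 2 / (pi * emb_star y) ^ 2"
    unfolding peak_weight_eq[OF assms] by (intro divide_right_mono) auto
  also have "\<dots> = emb_star \<sigma> ^ 2 / 5 * (emb y ^ 2 / emb_star y ^ 2)"
    by (simp add: power_mult_distrib power_divide)
  finally show ?thesis .
qed

lemma emeasure_model_diffraction_le:
  assumes "k > 0"
  shows "emeasure (model_diffraction (emb \<sigma>)) {0<..k} \<le> ennreal (emb_star \<sigma> ^ 2 / 5) * ratio_mass (sqrt 5 * k)"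
proof -
  let ?c = "ennreal (emb_star \<sigma> ^ 2 / 5)" and ?e = "\<lambda>y. ennreal (emb y ^ 2 / emb_star y ^ 2)"
    and ?f = "\<lambda>y. ennreal (peak_weight (emb \<sigma>) y) * indicator {0<..k} (emb y / sqrt 5)"
  have "emeasure (model_diffraction (emb \<sigma>)) {0<..k}
     = (\<integral>\<^sup>+y. ?f y \<partial>counting)"
    unfolding model_diffraction_def by (rule emeasure_weighted_atoms) simp
  also have "\<dots> \<le> (\<integral>\<^sup>+y. ?c * (?e y * indicator {0<..sqrt 5 * k} (emb y)) \<partial>counting)"
  proof (rule nn_integral_mono)
    fix y
    show "?f y
       \<le> ?c * (?e y * indicator {0<..sqrt 5 * k} (emb y))"
    proof (cases "emb y / sqrt 5 \<in> {0<..k}")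
      case True
      then have "emb y \<in> {0<..sqrt 5 * k}" "emb y \<noteq> 0" by (auto simp: field_simps)
      moreover have "ennreal (peak_weight (emb \<sigma>) y) \<le> ?c * ?e y"
        using peak_weight_le_ratio[OF \<open>emb y \<noteq> 0\<close>, of \<sigma>] by (subst ennreal_mult[symmetric]) (auto intro: ennreal_leI)
      ultimately show ?thesis using True by simp
    qed simp
  qed
  also have "\<dots> = ?c * ratio_mass (sqrt 5 * k)"
    unfolding ratio_mass_def by (rule nn_integral_cmult) simp
  finally show ?thesis .
qed

text \<open>Powers of a unit have norm 1 or -1, so \<open>1 / emb_star y ^ 2\<close> is
  \<open>v ^ 2\<close>. Smallness keeps the argument \<open>\<theta>\<close> of the sine within
  \<open>pi / 2\<close>, where the square of the sine is at least \<open>\<theta> ^ 2 / 4\<close>;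
  with the 5 in \<open>\<theta> ^ 2\<close> this makes 20.\<close>

lemma peak_weight_power_ge:
  fixes n :: nat
  defines "v \<equiv> inverse golden ^ n"
  assumes small: "\<bar>emb_star \<sigma>\<bar> * v \<le> 1"
  shows "emb_star \<sigma> ^ 2 / 20 * v ^ 4 \<le> peak_weight (emb \<sigma>) ((golden_div ^^ n) (1, 0))"
proof -
  define y where "y = (golden_div ^^ n) (1, 0)"
  have y: "emb y = v" "emb_star y = inverse (1 - golden) ^ n"
    by (simp_all add: y_def v_def golden_div_power)
  have v: "v > 0" using golden_gt_1 by (simp add: v_def)
  have "v * inverse (1 - golden) ^ n = inverse (golden * (1 - golden)) ^ n"
    by (simp add: v_def power_mult_distrib)
  also have "golden * (1 - golden) = -1" using golden_conj by (simp add: algebra_simps)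
  finally have "(v * emb_star y) ^ 2 = 1"
    unfolding y by (simp flip: power_mult add: mult.commute[of n 2] power_mult)
  then have star: "emb_star y ^ 2 = 1 / v ^ 2" using v by (simp add: power_mult_distrib field_simps)
  define \<theta> where "\<theta> = pi * emb_star \<sigma> * v / sqrt 5"
  have "\<bar>\<theta>\<bar> = pi / sqrt 5 * (\<bar>emb_star \<sigma>\<bar> * v)"
    using v by (simp add: \<theta>_def abs_mult)
  also have "\<dots> \<le> pi / sqrt 5 * 1" using small by (intro mult_left_mono) auto
  also have "\<dots> \<le> pi / 2"
  proof -
    have "2 \<le> sqrt 5" by (rule real_le_rsqrt) simp
    then show ?thesis unfolding mult_1_right by (intro divide_left_mono) auto
  qed
  finally have "\<bar>\<theta>\<bar> / 2 \<le> \<bar>sin \<theta>\<bar>" by (rule half_abs_le_abs_sin)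
  then have "(\<bar>\<theta>\<bar> / 2) ^ 2 \<le> \<bar>sin \<theta>\<bar> ^ 2" by (intro power_mono) auto
  then have sin_ge: "\<theta> ^ 2 / 4 \<le> sin \<theta> ^ 2" by (simp add: power_divide)
  have "emb_star \<sigma> ^ 2 / 20 * v ^ 4 = \<theta> ^ 2 / 4 * v ^ 2 / pi ^ 2"
    by (simp add: \<theta>_def power_mult_distrib power_divide power4_eq_xxxx power2_eq_square[of v])
  also have "\<dots> \<le> sin \<theta> ^ 2 * v ^ 2 / pi ^ 2"
    using sin_ge by (intro divide_right_mono mult_right_mono) auto
  also have "\<dots> = peak_weight (emb \<sigma>) y"
    using v by (simp add: peak_weight_eq y(1) star power_mult_distrib \<theta>_def)
  finally show ?thesis unfolding y_def .
qed

theorem model_diffraction_near_0: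
  assumes \<sigma>: "emb \<sigma> > 0"
  shows "\<exists>c1>0. \<exists>c2>0. \<exists>k0>0. \<forall>k. 0 < k \<and> k \<le> k0 \<longrightarrow>
    c1 * k ^ 4 \<le> measure (model_diffraction (emb \<sigma>)) {0<..k} \<and> measure (model_diffraction (emb \<sigma>)) {0<..k} \<le> c2 * k ^ 4"
proof -
  let ?\<mu> = "model_diffraction (emb \<sigma>)"
  define S where "S = emb_star \<sigma>"
  have "\<sigma> \<noteq> 0" using \<sigma> by auto
  then have S: "S \<noteq> 0" by (simp add: S_def emb_star_eq_0_iff)
  obtain C where C: "C > 0" "\<And>K. 0 < K \<Longrightarrow> K \<le> 1 \<Longrightarrow> ratio_mass K \<le> ennreal (C * K ^ 4)"
    using ratio_mass_le by blast
  have sqrt5_pow: "(sqrt 5 * k) ^ 4 = 25 * k ^ 4" for k :: real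
  proof -
    have "sqrt 5 ^ 4 = (sqrt 5 ^ 2) ^ 2" by (simp only: power_mult[symmetric]) simp
    then show ?thesis by (simp add: power_mult_distrib)
  qed
  \<comment> \<open>The 25 is \<open>sqrt 5 ^ 4\<close>, since the peak of \<open>y\<close> sits at
    \<open>emb y / sqrt 5\<close>; in \<open>c1\<close> the factor \<open>inverse golden ^ 4\<close>
    is the loss from passing to a power of \<open>inverse golden\<close>.\<close>
  define c2 where "c2 = S ^ 2 / 5 * (C * 25)"
  define c1 where "c1 = S ^ 2 / 20 * (inverse golden ^ 4 * 25)"
  \<comment> \<open>Chosen, with 3 as a bound for \<open>sqrt 5\<close>, so that both
    \<open>sqrt 5 * k \<le> 1\<close> and
    \<open>\<bar>S\<bar> * (sqrt 5 * k) \<le> 1\<close>.\<close>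
  define k0 where "k0 = 1 / (3 * (1 + \<bar>S\<bar>))"
  have "c1 * k ^ 4 \<le> measure (?\<mu>) {0<..k} \<and> measure (?\<mu>) {0<..k} \<le> c2 * k ^ 4"
    if k: "0 < k" "k \<le> k0" for k
  proof -
    have k3: "3 * k * (1 + \<bar>S\<bar>) \<le> 1" using k by (simp add: k0_def field_simps add_pos_nonneg)
    have "sqrt 5 \<le> 3" by (rule real_le_lsqrt) auto
    then have K3: "sqrt 5 * k \<le> 3 * k" using k by (intro mult_right_mono) auto
    have "0 \<le> k * \<bar>S\<bar>" using k by simp
    then have K1: "sqrt 5 * k \<le> 1" using k3 K3 by (simp add: algebra_simps)
    have KS: "\<bar>S\<bar> * (sqrt 5 * k) \<le> 1"
    proof -
      have "\<bar>S\<bar> * (sqrt 5 * k) \<le> \<bar>S\<bar> * (3 * k)" using K3 by (intro mult_left_mono) auto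
      moreover have "3 * k * (1 + \<bar>S\<bar>) = 3 * k + \<bar>S\<bar> * (3 * k)" by (simp add: algebra_simps)
      ultimately show ?thesis using k3 k(1) by linarith
    qed
    have K0: "0 < sqrt 5 * k" using k by simp
    have "emeasure (?\<mu>) {0<..k} \<le> ennreal (S ^ 2 / 5) * ratio_mass (sqrt 5 * k)"
      unfolding S_def by (rule emeasure_model_diffraction_le[OF k(1)])
    also have "\<dots> \<le> ennreal (S ^ 2 / 5) * ennreal (C * (sqrt 5 * k) ^ 4)"
      using C(2)[OF K0 K1] by (intro mult_left_mono) auto
    also have "\<dots> = ennreal (c2 * k ^ 4)"
      using C(1) by (subst ennreal_mult[symmetric]) (simp_all only: c2_def sqrt5_pow mult.assoc, auto)
    finally have upper: "emeasure (?\<mu>) {0<..k} \<le> ennreal (c2 * k ^ 4)" .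
    then have fin: "emeasure (?\<mu>) {0<..k} \<noteq> \<infinity>"
      by (auto simp: top_unique)
    then have eq: "emeasure (?\<mu>) {0<..k} = ennreal (measure (?\<mu>) {0<..k})"
      by (intro emeasure_eq_ennreal_measure) simp
    have "c2 * k ^ 4 \<ge> 0" using C(1) by (simp add: c2_def)
    then have "measure (?\<mu>) {0<..k} \<le> c2 * k ^ 4"
      using upper unfolding eq by simp
    \<comment> \<open>One peak is enough: the largest power of \<open>inverse golden\<close> below
      \<open>sqrt 5 * k\<close>, which is at least \<open>sqrt 5 * k / golden\<close>.\<close>
    moreover have "c1 * k ^ 4 \<le> measure (?\<mu>) {0<..k}"
    proof -
      obtain N where N: "inverse golden ^ Suc N < sqrt 5 * k" "sqrt 5 * k \<le> inverse golden ^ N"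
        using golden_power_bracket[OF K0 K1] by blast
      define v where "v = inverse golden ^ Suc N"
      define y where "y = (golden_div ^^ Suc N) (1, 0)"
      have y: "emb y = v" unfolding y_def v_def by (rule golden_div_power)
      have v: "0 < v" using golden_gt_1 by (simp add: v_def)
      have "\<bar>S\<bar> * v \<le> \<bar>S\<bar> * (sqrt 5 * k)" using N(1) by (intro mult_left_mono) (auto simp: v_def)
      then have "\<bar>S\<bar> * v \<le> 1" using KS by linarith
      then have w: "S ^ 2 / 20 * v ^ 4 \<le> peak_weight (emb \<sigma>) y"
        unfolding S_def v_def y_def by (rule peak_weight_power_ge)
      have "inverse golden * (sqrt 5 * k) \<le> v"
        unfolding v_def power_Suc using N(2) golden_gt_1 by (intro mult_left_mono) auto
      then have "(inverse golden * (sqrt 5 * k)) ^ 4 \<le> v ^ 4" using k golden_gt_1 by (intro power_mono) auto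
      then have "S ^ 2 / 20 * (inverse golden ^ 4 * (25 * k ^ 4)) \<le> S ^ 2 / 20 * v ^ 4"
        unfolding power_mult_distrib[of "inverse golden"] sqrt5_pow by (intro mult_left_mono) auto
      then have c1_le: "c1 * k ^ 4 \<le> peak_weight (emb \<sigma>) y" using w by (simp add: c1_def mult_ac)
      have "v < sqrt 5 * k" using N(1) by (simp only: v_def)
      then have "emb y / sqrt 5 \<in> {0<..k}" using v by (simp add: y field_simps)
      then have "ennreal (peak_weight (emb \<sigma>) y) = ennreal (peak_weight (emb \<sigma>) y) * indicator {0<..k} (emb y / sqrt 5)"
        by simp
      also have "\<dots> \<le> (\<integral>\<^sup>+y. ennreal (peak_weight (emb \<sigma>) y) * indicator {0<..k} (emb y / sqrt 5) \<partial>counting)"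
        by (rule nn_integral_ge_point) simp
      also have "\<dots> = emeasure (?\<mu>) {0<..k}"
        unfolding model_diffraction_def by (rule emeasure_weighted_atoms[symmetric]) simp
      finally have "peak_weight (emb \<sigma>) y \<le> measure (?\<mu>) {0<..k}"
        unfolding eq by simp
      then show ?thesis using c1_le by simp
    qed
    ultimately show ?thesis by simp
  qed
  moreover have "c1 > 0" "c2 > 0" "k0 > 0"
    using S C(1) golden_gt_1 by (auto simp: c1_def c2_def k0_def add_pos_nonneg)
  ultimately show ?thesis by blast
qed

theorem theorem3p2:
  fixes W \<Lambda> :: "real set" and a b s :: real and Z :: "real \<Rightarrow> real"
  assumes "W \<in> {{a..b}, {a<..b}, {a..<b}, {a<..<b}}"
    and "s = b - a" and "s > 0" and "s \<in> Z_tau"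
  defines "\<Lambda> \<equiv> model_set W"
  defines "Z \<equiv> integrated_intensity \<Lambda>"
  shows "(\<exists>c1>0. \<exists>c2>0. \<exists>k0>0. \<forall>k. 0 < k \<and> k \<le> k0 \<longrightarrow> c1 * k ^ 4 \<le> Z k \<and> Z k \<le> c2 * k ^ 4)
         \<and> Z \<in> O[at_right 0](\<lambda>k. k ^ 4)"
proof -
  \<comment> \<open>All four kinds of interval enter only through these two inclusions; endpoints
    have density 0.\<close>
  from assms(1) have W: "{a<..<b} \<subseteq> W" "W \<subseteq> {a..b}" by auto
  have ab: "a < b" using assms(2,3) by simp
  obtain \<sigma> where \<sigma>: "s = emb \<sigma>" using assms(4) unfolding Z_tau_eq_range_emb by auto
  have Z: "Z k = measure (model_diffraction (emb \<sigma>)) {0<..k}" for k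
    unfolding Z_def \<Lambda>_def integrated_intensity_def diffraction_model_set[OF ab W]
    using assms(2) \<sigma> by simp
  have "\<exists>c1>0. \<exists>c2>0. \<exists>k0>0. \<forall>k. 0 < k \<and> k \<le> k0 \<longrightarrow> c1 * k ^ 4 \<le> Z k \<and> Z k \<le> c2 * k ^ 4"
    unfolding Z by (rule model_diffraction_near_0) (use assms(3) \<sigma> in simp)
  moreover from this obtain c2 k0 where k0: "k0 > 0" and c2: "\<And>k. 0 < k \<Longrightarrow> k \<le> k0 \<Longrightarrow> Z k \<le> c2 * k ^ 4"
    by blast
  have "Z \<in> O[at_right 0](\<lambda>k. k ^ 4)"
  proof (rule bigoI)
    have "eventually (\<lambda>k. k \<in> {0<..<k0}) (at_right 0)"
      using k0 by (rule eventually_at_right_real)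
    then show "eventually (\<lambda>k. norm (Z k) \<le> c2 * norm (k ^ 4)) (at_right 0)"
    proof eventually_elim
      case (elim k)
      then show ?case using c2[of k] by (simp add: Z)
    qed
  qed
  ultimately show ?thesis by blast
qed

end
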